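(* Let $n>3$, let $F^{n}=(M^{n},L)$ be a projectively flat Finsler space, and let $F^{*n}=(M^{n},L^{*})$ be a Finsler space obtained from $F^{n}$ by a projective Randers conformal change $L^{*}(x,y)=e^{\sigma(x)}L(x,y)+\beta(x,y)$, where $\sigma$ is a smooth function on $M^{n}$ and $\beta(x,y)=b_{i}(x)y^{i}$ is a 1-form on $M^{n}$. Let $M^{n-1}$ be a hypersurface of $M^{n}$, and let $F^{n-1}=(M^{n-1},\bar L)$ and $F^{*(n-1)}=(M^{n-1},\bar L^{*})$ be the Finslerian hypersurfaces of $F^{n}$ and $F^{*n}$ respectively, with the metrics induced on $M^{n-1}$ by $L$ and $L^{*}$. If $F^{n-1}$ is totally geodesic in $F^{n}$, then $F^{*(n-1)}$ is projectively flat.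
   Context: A Finsler space $F^{n}=(M^{n},L)$ is an $n$-dimensional smooth manifold $M^{n}$ with a fundamental function $L(x,y)>0$, smooth for nonzero tangent vectors $y$ and positively homogeneous of degree one in $y$, with fundamental tensor $g_{ij}=\frac12\dot\partial_{i}\dot\partial_{j}L^{2}$, where $\dot\partial_{i}=\partial/\partial y^{i}$. The metrics $L^{2}$ and $L^{*2}$ are assumed positive-definite, i.e. $g_{ij}$ and $g^{*}_{ij}=\frac12\dot\partial_{i}\dot\partial_{j}L^{*2}$ are positive definite; also $L^{*}>0$. A geodesic of $(M^{n},L)$ is a regular curve $x(t)$, with $y^{i}=dx^{i}/dt$, satisfying the Euler-Lagrange equations $\partial L/\partial x^{i}-\frac{d}{dt}(\partial L/\partial y^{i})=0$ (invariant under orientation-preserving reparametrization). A change of metric $L\rightarrow L'$ on the same manifold is called projective if every geodesic of $(M^{n},L)$ is also a geodesic of $(M^{n},L')$ and conversely. A Finsler space $(M,L)$ is called projectively flat if there exists a projective change $L\rightarrow L'$ such that the Finsler space $(M,L')$ is a locally Minkowski space, i.e. around each point there are local coordinates of $M$ in which $L'(x,y)$ does not depend on $x$. A hypersurface $M^{n-1}$ of $M^{n}$ is represented parametrically by $x^{i}=x^{i}(u^{\alpha})$, $\alpha=1,\dots,n-1$, with the matrix $B^{i}_{\alpha}=\partial x^{i}/\partial u^{\alpha}$ of rank $n-1$. The induced metrics are $\bar L(u,v)=L(x(u),y(u,v))$ and $\bar L^{*}(u,v)=L^{*}(x(u),y(u,v))$, where $y^{i}=B^{i}_{\alpha}(u)v^{\alpha}$.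 The hypersurface $F^{n-1}=(M^{n-1},\bar L)$ of $F^{n}$ is called totally geodesic if each geodesic of $F^{n-1}$ with respect to the induced metric $\bar L$ is also a geodesic of $F^{n}$. *)

theory Defs
  imports "HOL-Analysis.Analysis"
begin

section \<open>Smooth functions on open subsets of normed spaces\<close>

text \<open>\<open>Ck_on k S f\<close> is meant for open \<open>S\<close> in a finite-dimensional space.\<close>

primrec Ck_on :: "nat \<Rightarrow> 'a::real_normed_vector set \<Rightarrow> ('a \<Rightarrow> 'b::real_normed_vector) \<Rightarrow> bool" where
  "Ck_on 0 S f \<longleftrightarrow> continuous_on S f"
| "Ck_on (Suc k) S f \<longleftrightarrow>
     (\<forall>x\<in>S. f differentiable (at x)) \<and>
     (\<forall>v. Ck_on k S (\<lambda>x. frechet_derivative f (at x) v))"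

definition smooth_on :: "'a::real_normed_vector set \<Rightarrow> ('a \<Rightarrow> 'b::real_normed_vector) \<Rightarrow> bool" where
  "smooth_on S f \<longleftrightarrow> (\<forall>k. Ck_on k S f)"

definition partial :: "'n \<Rightarrow> (real ^ 'n \<Rightarrow> real) \<Rightarrow> real ^ 'n \<Rightarrow> real" where
  "partial i f x = frechet_derivative f (at x) (axis i 1)"


section \<open>Smooth manifolds\<close>

text \<open>
  A chart is a pair of an open domain and a coordinate map. The values of the
  coordinate map outside the domain are irrelevant. Manifolds are modelled on whole types;
  the dimension is \<open>CARD('n)\<close>.
\<close>

type_synonym ('m, 'n) chart = "'m set \<times> ('m \<Rightarrow> real ^ 'n)"

abbreviation chart_dom :: "('m, 'n) chart \<Rightarrow> 'm set" where
  "chart_dom c \<equiv> fst c"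

abbreviation coord :: "('m, 'n) chart \<Rightarrow> 'm \<Rightarrow> real ^ 'n" where
  "coord c \<equiv> snd c"

definition chart_img :: "('m, 'n) chart \<Rightarrow> (real ^ 'n) set" where
  "chart_img c = coord c ` chart_dom c"

definition point :: "('m, 'n) chart \<Rightarrow> real ^ 'n \<Rightarrow> 'm" where
  "point c = inv_into (chart_dom c) (coord c)"

definition is_chart :: "('m::topological_space, 'n::finite) chart \<Rightarrow> bool" where
  "is_chart c \<longleftrightarrow> open (chart_dom c) \<and> open (chart_img c) \<and> inj_on (coord c) (chart_dom c) \<and>
     homeomorphism (chart_dom c) (chart_img c) (coord c) (point c)"

definition coord_expr ::
  "('h, 'k) chart \<Rightarrow> ('m, 'n) chart \<Rightarrow> ('h \<Rightarrow> 'm) \<Rightarrow> real ^ 'k \<Rightarrow> real ^ 'n" where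
  "coord_expr c d f = coord d \<circ> f \<circ> point c"

definition smooth_map ::
  "('h::topological_space, 'k::finite) chart set \<Rightarrow> ('m::topological_space, 'n::finite) chart set
    \<Rightarrow> ('h \<Rightarrow> 'm) \<Rightarrow> bool" where
  "smooth_map B A f \<longleftrightarrow> continuous_on UNIV f \<and>
     (\<forall>c\<in>B. \<forall>d\<in>A. smooth_on (coord c ` (chart_dom c \<inter> f -` chart_dom d)) (coord_expr c d f))"

definition compatible :: "('m, 'n::finite) chart \<Rightarrow> ('m, 'n) chart \<Rightarrow> bool" where
  "compatible c d \<longleftrightarrow>
     smooth_on (coord c ` (chart_dom c \<inter> chart_dom d)) (coord_expr c d (\<lambda>p. p)) \<and>
     smooth_on (coord d ` (chart_dom c \<inter> chart_dom d)) (coord_expr d c (\<lambda>p. p))"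

text \<open>
  The atlas is maximal, so that its members are exactly the local coordinates of the manifold.
\<close>

definition smooth_manifold ::
  "('m::{t2_space,second_countable_topology}, 'n::finite) chart set \<Rightarrow> bool" where
  "smooth_manifold A \<longleftrightarrow>
     (\<forall>c\<in>A. is_chart c) \<and>
     (\<Union>c\<in>A. chart_dom c) = UNIV \<and>
     (\<forall>c\<in>A. \<forall>d\<in>A. compatible c d) \<and>
     (\<forall>c. is_chart c \<and> (\<forall>d\<in>A. compatible c d) \<longrightarrow> c \<in> A)"


section \<open>Tangent vectors\<close>

text \<open>
  A tangent vector at \<open>p\<close> assigns to every chart around \<open>p\<close> its components in that chart, which
  transform by the Jacobian matrix of the coordinate change. It is fixed to be \<open>0\<close> on all other
  arguments, so that equality of tangent vectors is equality of functions.
  A function on the tangent bundle takes a point and a tangent vector at that point; only its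
  values on actual tangent vectors matter.
\<close>

type_synonym ('m, 'n) tvec = "('m, 'n) chart \<Rightarrow> real ^ 'n"
type_synonym ('m, 'n) tfun = "'m \<Rightarrow> ('m, 'n) tvec \<Rightarrow> real"

definition tangent_space ::
  "('m, 'n::finite) chart set \<Rightarrow> 'm \<Rightarrow> ('m, 'n) tvec set" where
  "tangent_space A p = {w.
     (\<forall>c\<in>A. \<forall>d\<in>A. p \<in> chart_dom c \<and> p \<in> chart_dom d \<longrightarrow>
        w d = jacobian (coord_expr c d (\<lambda>q. q)) (at (coord c p)) *v w c) \<and>
     (\<forall>c. \<not> (c \<in> A \<and> p \<in> chart_dom c) \<longrightarrow> w c = 0)}"

text \<open>The tangent vector at \<open>p\<close> with components \<open>y\<close> in the chart \<open>c\<close>.\<close>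

definition tangent ::
  "('m, 'n::finite) chart set \<Rightarrow> ('m, 'n) chart \<Rightarrow> 'm \<Rightarrow> real ^ 'n \<Rightarrow> ('m, 'n) tvec" where
  "tangent A c p y = (\<lambda>d. if d \<in> A \<and> p \<in> chart_dom d
     then jacobian (coord_expr c d (\<lambda>q. q)) (at (coord c p)) *v y else 0)"

text \<open>The expression \<open>F(x, y)\<close> of a function on the tangent bundle in the chart \<open>c\<close>.\<close>

definition loc ::
  "('m, 'n::finite) chart set \<Rightarrow> ('m, 'n) tfun \<Rightarrow> ('m, 'n) chart
    \<Rightarrow> real ^ 'n \<Rightarrow> real ^ 'n \<Rightarrow> real" where
  "loc A F c x y = F (point c x) (tangent A c (point c x) y)"

text \<open>
  The differential of \<open>f\<close> at \<open>p\<close>; it does not depend on the chart \<open>c\<close> around \<open>p\<close> in which the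
  components of the argument are taken.
\<close>

definition pushforward ::
  "('h, 'k::finite) chart set \<Rightarrow> ('m, 'n::finite) chart set \<Rightarrow> ('h \<Rightarrow> 'm) \<Rightarrow> 'h
    \<Rightarrow> ('h, 'k) tvec \<Rightarrow> ('m, 'n) tvec" where
  "pushforward B A f p w =
     (let c = (SOME c. c \<in> B \<and> p \<in> chart_dom c) in
      (\<lambda>d. if d \<in> A \<and> f p \<in> chart_dom d
        then jacobian (coord_expr c d f) (at (coord c p)) *v w c else 0))"

definition smooth_scalar :: "('m, 'n::finite) chart set \<Rightarrow> ('m \<Rightarrow> real) \<Rightarrow> bool" where
  "smooth_scalar A f \<longleftrightarrow> (\<forall>c\<in>A. smooth_on (chart_img c) (f \<circ> point c))"

definition one_form :: "('m, 'n::finite) chart set \<Rightarrow> ('m, 'n) tfun \<Rightarrow> bool" where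
  "one_form A \<beta> \<longleftrightarrow>
     (\<forall>c\<in>A. \<exists>b :: real ^ 'n \<Rightarrow> real ^ 'n. smooth_on (chart_img c) b \<and>
        (\<forall>x\<in>chart_img c. \<forall>y. loc A \<beta> c x y = (\<Sum>i\<in>UNIV. b x $ i * y $ i)))"


section \<open>Finsler spaces\<close>

definition fundamental_tensor ::
  "(real ^ 'n \<Rightarrow> real ^ 'n \<Rightarrow> real) \<Rightarrow> real ^ 'n \<Rightarrow> real ^ 'n \<Rightarrow> real ^ 'n ^ 'n::finite" where
  "fundamental_tensor F x y =
     (\<chi> i j. 1/2 * partial i (\<lambda>y. partial j (\<lambda>y. (F x y)\<^sup>2) y) y)"

definition finsler :: "('m, 'n::finite) chart set \<Rightarrow> ('m, 'n) tfun \<Rightarrow> bool" where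
  "finsler A L \<longleftrightarrow> (\<forall>c\<in>A.
     smooth_on (chart_img c \<times> (- {0})) (\<lambda>(x, y). loc A L c x y) \<and>
     (\<forall>x\<in>chart_img c. \<forall>y. y \<noteq> 0 \<longrightarrow>
        loc A L c x y > 0 \<and>
        (\<forall>r>0. loc A L c x (r *\<^sub>R y) = r * loc A L c x y) \<and>
        (\<forall>z. z \<noteq> 0 \<longrightarrow>
          (\<Sum>i\<in>UNIV. \<Sum>j\<in>UNIV. fundamental_tensor (loc A L c) x y $ i $ j * z $ i * z $ j) > 0)))"

text \<open>
  A geodesic is defined on a nonempty open interval, is smooth and regular, and satisfies the
  Euler-Lagrange equations in every chart.
\<close>

definition geodesic ::
  "('m::topological_space, 'n::finite) chart set \<Rightarrow> ('m, 'n) tfun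
    \<Rightarrow> real set \<Rightarrow> (real \<Rightarrow> 'm) \<Rightarrow> bool" where
  "geodesic A L I \<gamma> \<longleftrightarrow>
     open I \<and> is_interval I \<and> I \<noteq> {} \<and> continuous_on I \<gamma> \<and>
     (\<forall>c\<in>A. let J = I \<inter> \<gamma> -` chart_dom c; x = coord c \<circ> \<gamma>;
                x' = (\<lambda>t. vector_derivative x (at t)) in
        smooth_on J x \<and>
        (\<forall>t\<in>J. x' t \<noteq> 0 \<and>
          (\<forall>i. ((\<lambda>s. partial i (\<lambda>y. loc A L c (x s) y) (x' s))
             has_real_derivative partial i (\<lambda>\<xi>. loc A L c \<xi> (x' t)) (x t)) (at t))))"

definition projective_change ::
  "('m::topological_space, 'n::finite) chart set \<Rightarrow> ('m, 'n) tfun \<Rightarrow> ('m, 'n) tfun \<Rightarrow> bool" where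
  "projective_change A L L' \<longleftrightarrow> (\<forall>I \<gamma>. geodesic A L I \<gamma> \<longleftrightarrow> geodesic A L' I \<gamma>)"

definition locally_minkowski :: "('m, 'n::finite) chart set \<Rightarrow> ('m, 'n) tfun \<Rightarrow> bool" where
  "locally_minkowski A L \<longleftrightarrow> finsler A L \<and>
     (\<forall>p. \<exists>c\<in>A. p \<in> chart_dom c \<and>
        (\<forall>x\<in>chart_img c. \<forall>x'\<in>chart_img c. \<forall>y. y \<noteq> 0 \<longrightarrow> loc A L c x y = loc A L c x' y))"

definition projectively_flat ::
  "('m::topological_space, 'n::finite) chart set \<Rightarrow> ('m, 'n) tfun \<Rightarrow> bool" where
  "projectively_flat A L \<longleftrightarrow> finsler A L \<and>
     (\<exists>L'. projective_change A L L' \<and> locally_minkowski A L')"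

definition randers_conformal_change ::
  "('m, 'n::finite) chart set \<Rightarrow> ('m \<Rightarrow> real) \<Rightarrow> ('m, 'n) tfun
    \<Rightarrow> ('m, 'n) tfun \<Rightarrow> ('m, 'n) tfun \<Rightarrow> bool" where
  "randers_conformal_change A \<sigma> \<beta> L L' \<longleftrightarrow> smooth_scalar A \<sigma> \<and> one_form A \<beta> \<and>
     (\<forall>p. \<forall>w\<in>tangent_space A p - {\<lambda>_. 0}. L' p w = exp (\<sigma> p) * L p w + \<beta> p w)"


section \<open>Hypersurfaces\<close>

text \<open>
  A hypersurface is given by a parametrization \<open>\<iota>\<close> of maximal rank; it need not be injective.
\<close>

definition hypersurface ::
  "('h::topological_space, 'k::finite) chart set \<Rightarrow> ('m::topological_space, 'n::finite) chart set
    \<Rightarrow> ('h \<Rightarrow> 'm) \<Rightarrow> bool" where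
  "hypersurface B A \<iota> \<longleftrightarrow> CARD('n) = CARD('k) + 1 \<and> smooth_map B A \<iota> \<and>
     (\<forall>c\<in>B. \<forall>d\<in>A. \<forall>p\<in>chart_dom c. \<iota> p \<in> chart_dom d \<longrightarrow>
        rank (jacobian (coord_expr c d \<iota>) (at (coord c p))) = CARD('k))"

definition induced ::
  "('h, 'k::finite) chart set \<Rightarrow> ('m, 'n::finite) chart set \<Rightarrow> ('h \<Rightarrow> 'm)
    \<Rightarrow> ('m, 'n) tfun \<Rightarrow> ('h, 'k) tfun" where
  "induced B A \<iota> L p w = L (\<iota> p) (pushforward B A \<iota> p w)"

definition totally_geodesic ::
  "('h::topological_space, 'k::finite) chart set \<Rightarrow> ('m::topological_space, 'n::finite) chart set
    \<Rightarrow> ('h \<Rightarrow> 'm) \<Rightarrow> ('m, 'n) tfun \<Rightarrow> bool" where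
  "totally_geodesic B A \<iota> L \<longleftrightarrow>
     (\<forall>I \<gamma>. geodesic B (induced B A \<iota> L) I \<gamma> \<longrightarrow> geodesic A L I (\<iota> \<circ> \<gamma>))"

end

theory Submission
  imports Defs
begin

text \<open>
  Let \<open>L'\<close> be the locally Minkowski metric that is projectively related to \<open>L\<close>. In a chart in which \<open>L'\<close> does not
  depend on the position, the Euler-Lagrange equations say that the vertical Hessian of \<open>L'\<close> annihilates the
  acceleration. By positive definiteness of the fundamental tensor its kernel is spanned by the velocity
  (\<open>finsler_vhess_kernel\<close>). Hence the geodesics of \<open>L\<close>, \<open>Ls\<close> and \<open>L'\<close> are all the straight lines of this chart, in
  arbitrary regular parametrizations.

  Around a point of the hypersurface, coordinates can be chosen in which the parametrization \<open>f\<close> has a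
  linear left inverse \<open>P\<close> (\<open>graph_chart\<close>). A geodesic \<open>u\<close> of the metric induced by \<open>L\<close> is a geodesic of \<open>L\<close>, so \<open>f \<circ> u\<close>
  is straight; applying \<open>P\<close>, so is \<open>u\<close>. Comparing accelerations, the second derivative of \<open>f\<close> vanishes on the
  velocity of \<open>u\<close>. Induced geodesics exist in every direction (\<open>finsler_geodesic_exists\<close>), which needs the
  local existence theorem for ordinary differential equations. Consequently the second derivative of \<open>f\<close> is
  zero (\<open>second_derivative_zero\<close>): the hypersurface is a piece of a hyperplane, and the metric
  induced by \<open>L'\<close> is independent of the position in these coordinates.

  The metric induced by \<open>L'\<close> is thus locally Minkowski, and it remains to see that it has the same geodesics as the
  metric induced by \<open>Ls\<close>. Straight lines of the hypersurface are straight lines of the ambient chart, hence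
  geodesics of \<open>Ls\<close> and \<open>L'\<close>, and an ambient geodesic that lies in the hypersurface is a geodesic of the induced
  metric (\<open>euler_lagrange_pullback\<close>). So straight lines are geodesics of both induced metrics. There are no others: the
  acceleration enters the Euler-Lagrange equations only through the vertical Hessian, so two solutions with the same
  position and velocity have accelerations that differ by a multiple of the velocity
  (\<open>euler_straight_iff\<close>).
\<close>

section \<open>Calculus of smooth functions\<close>

abbreviation fderiv :: "('a::real_normed_vector \<Rightarrow> 'b::real_normed_vector) \<Rightarrow> 'a \<Rightarrow> 'a \<Rightarrow> 'b" where
  "fderiv f x \<equiv> frechet_derivative f (at x)"

lemma has_derivative_fderiv: "f differentiable at x \<Longrightarrow> (f has_derivative fderiv f x) (at x)"
  by (simp add: frechet_derivative_works)

lemma fderiv_eq: "(f has_derivative f') (at x) \<Longrightarrow> fderiv f x = f'"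
  by (metis frechet_derivative_at)

lemma linear_fderiv: "f differentiable at x \<Longrightarrow> linear (fderiv f x)"
  by (simp add: linear_frechet_derivative)

lemma has_derivative_compose_fderiv:
  assumes "f differentiable at x" "g differentiable at (f x)"
  shows "((\<lambda>x. g (f x)) has_derivative (\<lambda>v. fderiv g (f x) (fderiv f x v))) (at x)"
  using has_derivative_compose[OF has_derivative_fderiv[OF assms(1)] has_derivative_fderiv[OF assms(2)]] .

lemma fderiv_cong_open:
  assumes "open S" "x \<in> S" "\<And>y. y \<in> S \<Longrightarrow> f y = g y" "f differentiable at x"
  shows "g differentiable at x" "fderiv g x = fderiv f x"
proof -
  have "(g has_derivative fderiv f x) (at x)"
    using has_derivative_transform_within_open[OF has_derivative_fderiv[OF assms(4)] assms(1,2)] assms(3) by auto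
  then show "g differentiable at x" "fderiv g x = fderiv f x"
    by (auto simp: differentiable_def fderiv_eq)
qed

lemma Ck_on_cong:
  assumes "open S" "\<And>x. x \<in> S \<Longrightarrow> f x = g x" "Ck_on k S f"
  shows "Ck_on k S g"
  using assms(2,3)
proof (induction k arbitrary: f g)
  case 0
  then show ?case by (simp cong: continuous_on_cong)
next
  case (Suc k)
  have *: "g differentiable at x" "fderiv g x = fderiv f x" if "x \<in> S" for x
    using fderiv_cong_open[OF assms(1) that, of f g] Suc.prems that by auto
  have "Ck_on k S (\<lambda>x. fderiv g x v)" for v
    by (rule Suc.IH[where f = "\<lambda>x. fderiv f x v"]) (use Suc.prems * in auto)
  with * show ?case by auto
qed

text \<open>Being of class \<open>C\<^sup>k\<close> is a local property, as derivatives at a point only see a neighbourhood. This is what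
allows smoothness on a manifold to be checked in whichever charts are convenient.\<close>

lemma Ck_on_local:
  assumes "\<And>x. x \<in> S \<Longrightarrow> \<exists>T. open T \<and> x \<in> T \<and> Ck_on k T f"
  shows "Ck_on k S f"
  using assms
proof (induction k arbitrary: f)
  case 0
  show ?case unfolding Ck_on.simps
  proof (rule continuous_at_imp_continuous_on, rule ballI)
    fix x assume "x \<in> S"
    then obtain T where "open T" "x \<in> T" "continuous_on T f" using 0 by auto
    then show "isCont f x" by (simp add: continuous_on_eq_continuous_at)
  qed
next
  case (Suc k)
  have *: "f differentiable at x \<and> (\<exists>T. open T \<and> x \<in> T \<and> Ck_on k T (\<lambda>x. fderiv f x v))" if x: "x \<in> S" for x v
  proof -
    obtain T where "open T" "x \<in> T" "Ck_on (Suc k) T f" using Suc.prems[OF x] by blast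
    then show ?thesis by auto
  qed
  have "Ck_on k S (\<lambda>x. fderiv f x v)" for v
    by (rule Suc.IH) (use * in blast)
  with * show ?case by auto
qed

lemma Ck_on_subset: "Ck_on k S f \<Longrightarrow> T \<subseteq> S \<Longrightarrow> Ck_on k T f"
  by (induction k arbitrary: f) (auto intro: continuous_on_subset)

lemma Ck_on_Suc_imp: "Ck_on (Suc k) S f \<Longrightarrow> Ck_on k S f"
proof (induction k arbitrary: f)
  case 0
  then show ?case
    by (auto intro!: continuous_at_imp_continuous_on differentiable_imp_continuous_within)
qed auto

text \<open>Closure properties are proved by induction on the order of differentiability, for which it suffices to
exhibit some derivative; \<open>fderiv\<close> then agrees with it on the open set.\<close>

lemma Ck_on_SucI:
  assumes "open S" "\<And>x. x \<in> S \<Longrightarrow> (f has_derivative f' x) (at x)" "\<And>v. Ck_on k S (\<lambda>x. f' x v)"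
  shows "Ck_on (Suc k) S f"
proof -
  have "Ck_on k S (\<lambda>x. fderiv f x v)" for v
    by (rule Ck_on_cong[OF assms(1) _ assms(3)[of v]]) (simp add: assms(2)[THEN fderiv_eq])
  with assms(2) show ?thesis by (auto simp: differentiable_def)
qed

lemma Ck_on_const: "Ck_on k S (\<lambda>x. c)"
  by (induction k arbitrary: c) (auto simp: frechet_derivative_const)

lemma Ck_on_bounded_linear:
  assumes "open S" "bounded_linear h" "Ck_on k S f"
  shows "Ck_on k S (\<lambda>x. h (f x))"
  using assms(3)
proof (induction k arbitrary: f)
  case 0
  then show ?case using assms(2) bounded_linear.continuous_on by auto
next
  case (Suc k)
  show ?case
    by (rule Ck_on_SucI[OF assms(1), where f' = "\<lambda>x v. h (fderiv f x v)"])
      (use Suc in \<open>auto intro!: bounded_linear.has_derivative[OF assms(2)] has_derivative_fderiv\<close>)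
qed

lemma Ck_on_id: "open S \<Longrightarrow> Ck_on k S (\<lambda>x. x)"
proof (cases k)
  case (Suc n)
  assume "open S"
  then show ?thesis unfolding Suc
    by (intro Ck_on_SucI[where f' = "\<lambda>x v. v"]) (auto intro: Ck_on_const)
qed simp

lemma Ck_on_add:
  assumes "open S" "Ck_on k S f" "Ck_on k S g"
  shows "Ck_on k S (\<lambda>x. f x + g x)"
  using assms(2,3)
proof (induction k arbitrary: f g)
  case 0
  then show ?case by (auto intro: continuous_intros)
next
  case (Suc k)
  show ?case
    by (rule Ck_on_SucI[OF assms(1), where f' = "\<lambda>x v. fderiv f x v + fderiv g x v"])
      (use Suc in \<open>auto intro!: has_derivative_add has_derivative_fderiv\<close>)
qed

lemma Ck_on_bounded_bilinear:
  assumes "open S" "bounded_bilinear h" "Ck_on k S f" "Ck_on k S g"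
  shows "Ck_on k S (\<lambda>x. h (f x) (g x))"
  using assms(3,4)
proof (induction k arbitrary: f g)
  case 0
  then show ?case using bounded_bilinear.continuous_on[OF assms(2)] by auto
next
  case (Suc k)
  show ?case
  proof (rule Ck_on_SucI[OF assms(1), where f' = "\<lambda>x v. h (f x) (fderiv g x v) + h (fderiv f x v) (g x)"])
    fix x assume "x \<in> S"
    with Suc.prems show "((\<lambda>x. h (f x) (g x)) has_derivative (\<lambda>v. h (f x) (fderiv g x v) + h (fderiv f x v) (g x))) (at x)"
      by (intro bounded_bilinear.FDERIV[OF assms(2)] has_derivative_fderiv) auto
  next
    fix v show "Ck_on k S (\<lambda>x. h (f x) (fderiv g x v) + h (fderiv f x v) (g x))"
      using Suc.prems Suc.prems[THEN Ck_on_Suc_imp] by (intro Ck_on_add[OF assms(1)] Suc.IH) auto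
  qed
qed

lemma Ck_on_sum:
  assumes "open S" "\<And>i. i \<in> I \<Longrightarrow> Ck_on k S (f i)"
  shows "Ck_on k S (\<lambda>x. \<Sum>i\<in>I. f i x)"
  using assms(2) by (induction I rule: infinite_finite_induct) (auto intro!: Ck_on_const Ck_on_add[OF assms(1)])

lemma fderiv_basis:
  fixes f :: "'a::euclidean_space \<Rightarrow> 'b::real_normed_vector"
  assumes "f differentiable at x"
  shows "fderiv f x v = (\<Sum>b\<in>Basis. (v \<bullet> b) *\<^sub>R fderiv f x b)"
proof -
  have "linear (fderiv f x)"
    using assms by (rule linear_fderiv)
  then have "(\<Sum>b\<in>Basis. (v \<bullet> b) *\<^sub>R fderiv f x b) = fderiv f x (\<Sum>b\<in>Basis. (v \<bullet> b) *\<^sub>R b)"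
    by (simp add: linear_sum linear_cmul)
  then show ?thesis by (simp add: euclidean_representation)
qed

text \<open>The chain rule evaluates the derivative of \<open>g\<close> in a direction that moves with the point. Expanding this
direction in a basis leaves a sum of products of maps \<open>x \<mapsto> fderiv g (f x) b\<close> with \<open>b\<close> fixed, which are
compositions of lower order.\<close>

lemma Ck_on_compose:
  fixes g :: "'b::euclidean_space \<Rightarrow> 'c::real_normed_vector"
  assumes "open S" "open T" "Ck_on k T g" "Ck_on k S f" "f ` S \<subseteq> T"
  shows "Ck_on k S (\<lambda>x. g (f x))"
  using assms(3,4)
proof (induction k arbitrary: g)
  case 0
  then show ?case using continuous_on_compose2 assms(5) by auto
next
  case (Suc k)
  have *: "fderiv g (f x) w = (\<Sum>b\<in>Basis. (w \<bullet> b) *\<^sub>R fderiv g (f x) b)" if "x \<in> S" for x w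
    using Suc.prems that assms(5) by (intro fderiv_basis) auto
  show ?case
  proof (rule Ck_on_SucI[OF assms(1), where f' = "\<lambda>x v. \<Sum>b\<in>Basis. (fderiv f x v \<bullet> b) *\<^sub>R fderiv g (f x) b"])
    fix x assume x: "x \<in> S"
    have "((\<lambda>x. g (f x)) has_derivative (\<lambda>v. fderiv g (f x) (fderiv f x v))) (at x)"
      using Suc.prems x assms(5) by (intro has_derivative_compose_fderiv) auto
    moreover have "(\<lambda>v. fderiv g (f x) (fderiv f x v)) = (\<lambda>v. \<Sum>b\<in>Basis. (fderiv f x v \<bullet> b) *\<^sub>R fderiv g (f x) b)"
      by (rule ext) (rule *[OF x])
    ultimately show "((\<lambda>x. g (f x)) has_derivative (\<lambda>v. \<Sum>b\<in>Basis. (fderiv f x v \<bullet> b) *\<^sub>R fderiv g (f x) b)) (at x)"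
      by (rule subst[rotated])
  next
    fix v
    show "Ck_on k S (\<lambda>x. \<Sum>b\<in>Basis. (fderiv f x v \<bullet> b) *\<^sub>R fderiv g (f x) b)"
      using Suc.prems Suc.prems(2)[THEN Ck_on_Suc_imp]
      by (intro Ck_on_sum[OF assms(1)] Ck_on_bounded_bilinear[OF assms(1) bounded_bilinear_scaleR]
          Ck_on_bounded_linear[OF assms(1) bounded_linear_inner_left] Suc.IH) auto
  qed
qed

lemma Ck_on_inverse:
  fixes f :: "'a::real_normed_vector \<Rightarrow> real"
  assumes "open S" "\<And>x. x \<in> S \<Longrightarrow> f x \<noteq> 0" "Ck_on k S f"
  shows "Ck_on k S (\<lambda>x. inverse (f x))"
  using assms(3)
proof (induction k)
  case 0
  then show ?case using assms(2) by (auto intro: continuous_intros)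
next
  case (Suc k)
  then have *: "Ck_on k S (\<lambda>x. inverse (f x))" using Ck_on_Suc_imp by blast
  show ?case
  proof (rule Ck_on_SucI[OF assms(1), where f' = "\<lambda>x v. - (inverse (f x) * fderiv f x v * inverse (f x))"])
    fix x assume "x \<in> S"
    with Suc.prems assms(2) show "((\<lambda>x. inverse (f x)) has_derivative (\<lambda>v. - (inverse (f x) * fderiv f x v * inverse (f x)))) (at x)"
      by (intro Deriv.has_derivative_inverse has_derivative_fderiv) auto
  next
    fix v show "Ck_on k S (\<lambda>x. - (inverse (f x) * fderiv f x v * inverse (f x)))"
      using Suc.prems *
      by (intro Ck_on_bounded_linear[OF assms(1) bounded_linear_minus[OF bounded_linear_ident]] 
           Ck_on_bounded_bilinear[OF assms(1) bounded_bilinear_mult]) auto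
  qed
qed

lemma Ck_on_prod:
  fixes f :: "'i \<Rightarrow> 'a::real_normed_vector \<Rightarrow> real"
  assumes "open S" "\<And>i. i \<in> I \<Longrightarrow> Ck_on k S (f i)"
  shows "Ck_on k S (\<lambda>x. \<Prod>i\<in>I. f i x)"
  using assms(2) by (induction I rule: infinite_finite_induct)
    (auto intro!: Ck_on_const Ck_on_bounded_bilinear[OF assms(1) bounded_bilinear_mult])

lemma Ck_on_det:
  fixes M :: "'a::real_normed_vector \<Rightarrow> real^'n^'n"
  assumes "open S" "\<And>i j. Ck_on k S (\<lambda>x. M x $ i $ j)"
  shows "Ck_on k S (\<lambda>x. det (M x))"
  unfolding det_def using assms
  by (intro Ck_on_sum[OF assms(1)] Ck_on_bounded_bilinear[OF assms(1) bounded_bilinear_mult] 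
        Ck_on_const Ck_on_prod) auto

lemma Ck_on_vec:
  fixes f :: "'a::real_normed_vector \<Rightarrow> real^'n"
  assumes "open S" "\<And>i. Ck_on k S (\<lambda>x. f x $ i)"
  shows "Ck_on k S f"
proof -
  have *: "f = (\<lambda>x. \<Sum>i\<in>UNIV. (f x $ i) *\<^sub>R axis i 1)"
    using basis_expansion[of "f _"] by (simp add: scalar_mult_eq_scaleR)
  show ?thesis
    by (subst *, intro Ck_on_sum[OF assms(1)] Ck_on_bounded_bilinear[OF assms(1) bounded_bilinear_scaleR] 
          Ck_on_const assms(2))
qed

text \<open>By Cramer's rule the solution of a linear system is a rational function of the data. It is used
for the derivative of an inverse function and for the accelerations of geodesics.\<close>

lemma Ck_on_linear_solution:
  fixes M :: "'a::real_normed_vector \<Rightarrow> real^'n^'n"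
  assumes "open S" "\<And>i j. Ck_on k S (\<lambda>x. M x $ i $ j)" "\<And>i. Ck_on k S (\<lambda>x. b x $ i)"
    and "\<And>x. x \<in> S \<Longrightarrow> det (M x) \<noteq> 0" "\<And>x. x \<in> S \<Longrightarrow> M x *v y x = b x"
  shows "Ck_on k S y"
proof -
  have *: "(\<chi> m. det (\<chi> i j. if j = m then b x $ i else M x $ i $ j) * inverse (det (M x))) = y x" if "x \<in> S" for x
    using cramer[of "M x" "y x" "b x"] assms(4,5) that by (simp add: divide_inverse)
  show ?thesis
  proof (rule Ck_on_cong[OF assms(1) *], assumption)
    show "Ck_on k S (\<lambda>x. \<chi> m. det (\<chi> i j. if j = m then b x $ i else M x $ i $ j) * inverse (det (M x)))"
    proof (rule Ck_on_vec[OF assms(1)])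
      fix m
      have "Ck_on k S (\<lambda>x. if j = m then b x $ i else M x $ i $ j)" for i j
        using assms(2,3) by (cases "j = m") auto
      then have "Ck_on k S (\<lambda>x. det (\<chi> i j. if j = m then b x $ i else M x $ i $ j))"
        by (intro Ck_on_det[OF assms(1)]) simp
      then show "Ck_on k S (\<lambda>x. (\<chi> m. det (\<chi> i j. if j = m then b x $ i else M x $ i $ j) * inverse (det (M x))) $ m)"
        using assms(2,4) by (auto intro!: Ck_on_bounded_bilinear[OF assms(1) bounded_bilinear_mult] 
             Ck_on_inverse[OF assms(1)] Ck_on_det[OF assms(1)])
    qed
  qed
qed

lemma smooth_on_cong:
  "open S \<Longrightarrow> (\<And>x. x \<in> S \<Longrightarrow> f x = g x) \<Longrightarrow> smooth_on S f \<Longrightarrow> smooth_on S g"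
  unfolding smooth_on_def using Ck_on_cong by blast

lemma smooth_on_subset: "smooth_on S f \<Longrightarrow> T \<subseteq> S \<Longrightarrow> smooth_on T f"
  unfolding smooth_on_def using Ck_on_subset by blast

lemma smooth_on_local:
  assumes "\<And>x. x \<in> S \<Longrightarrow> \<exists>T. open T \<and> x \<in> T \<and> smooth_on T f"
  shows "smooth_on S f"
  unfolding smooth_on_def
proof
  fix k show "Ck_on k S f"
    by (rule Ck_on_local) (use assms in \<open>auto simp: smooth_on_def\<close>)
qed

lemma smooth_on_const: "smooth_on S (\<lambda>x. c)"
  by (simp add: smooth_on_def Ck_on_const)

lemma smooth_on_id: "open S \<Longrightarrow> smooth_on S (\<lambda>x. x)"
  by (simp add: smooth_on_def Ck_on_id)

lemma smooth_on_bounded_linear: "open S \<Longrightarrow> bounded_linear h \<Longrightarrow> smooth_on S f \<Longrightarrow> smooth_on S (\<lambda>x. h (f x))"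
  by (simp add: smooth_on_def Ck_on_bounded_linear)

lemma smooth_on_add: "open S \<Longrightarrow> smooth_on S f \<Longrightarrow> smooth_on S g \<Longrightarrow> smooth_on S (\<lambda>x. f x + g x)"
  by (simp add: smooth_on_def Ck_on_add)

lemma smooth_on_bounded_bilinear:
  "open S \<Longrightarrow> bounded_bilinear h \<Longrightarrow> smooth_on S f \<Longrightarrow> smooth_on S g \<Longrightarrow> smooth_on S (\<lambda>x. h (f x) (g x))"
  by (simp add: smooth_on_def Ck_on_bounded_bilinear)

lemmas smooth_on_mult = smooth_on_bounded_bilinear[OF _ bounded_bilinear_mult]
lemmas smooth_on_scaleR = smooth_on_bounded_bilinear[OF _ bounded_bilinear_scaleR]

lemma smooth_on_sum: "open S \<Longrightarrow> (\<And>i. i \<in> I \<Longrightarrow> smooth_on S (f i)) \<Longrightarrow> smooth_on S (\<lambda>x. \<Sum>i\<in>I. f i x)"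
  by (simp add: smooth_on_def Ck_on_sum)

lemma smooth_on_compose:
  fixes g :: "'b::euclidean_space \<Rightarrow> 'c::real_normed_vector"
  assumes "open S" "open T" "smooth_on T g" "smooth_on S f" "f ` S \<subseteq> T"
  shows "smooth_on S (\<lambda>x. g (f x))"
  using Ck_on_compose[OF assms(1,2) _ _ assms(5)] assms(3,4) unfolding smooth_on_def by blast

lemma smooth_on_Pair:
  assumes "open S" "smooth_on S f" "smooth_on S g"
  shows "smooth_on S (\<lambda>x. (f x, g x))"
proof -
  have "smooth_on S (\<lambda>x. (f x, 0) + (0, g x))"
    using assms by (intro smooth_on_add smooth_on_bounded_linear[where h = "\<lambda>x. (x, 0)"]
        smooth_on_bounded_linear[where h = "\<lambda>x. (0, x)"] bounded_linear_Pair
        bounded_linear_ident bounded_linear_zero)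
  then show ?thesis by simp
qed

lemma smooth_on_fst: "open S \<Longrightarrow> smooth_on S fst"
  using smooth_on_bounded_linear[OF _ bounded_linear_fst smooth_on_id] by auto

lemma smooth_on_snd: "open S \<Longrightarrow> smooth_on S snd"
  using smooth_on_bounded_linear[OF _ bounded_linear_snd smooth_on_id] by auto

lemma smooth_on_linear_solution:
  fixes M :: "'a::real_normed_vector \<Rightarrow> real^'n^'n"
  assumes "open S" "\<And>i j. smooth_on S (\<lambda>x. M x $ i $ j)" "\<And>i. smooth_on S (\<lambda>x. b x $ i)"
    and "\<And>x. x \<in> S \<Longrightarrow> det (M x) \<noteq> 0" "\<And>x. x \<in> S \<Longrightarrow> M x *v y x = b x"
  shows "smooth_on S y"
  unfolding smooth_on_def
proof
  fix k show "Ck_on k S y"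
    by (rule Ck_on_linear_solution[OF assms(1) _ _ assms(4,5)])
      (use assms(2,3) in \<open>auto simp: smooth_on_def\<close>)
qed

lemma smooth_on_fderiv: "smooth_on S f \<Longrightarrow> smooth_on S (\<lambda>x. fderiv f x v)"
  unfolding smooth_on_def using Ck_on.simps(2) by blast

lemma smooth_on_differentiable: "smooth_on S f \<Longrightarrow> x \<in> S \<Longrightarrow> f differentiable at x"
  unfolding smooth_on_def using Ck_on.simps(2) by blast

lemmas smooth_on_has_derivative = has_derivative_fderiv[OF smooth_on_differentiable]

lemma smooth_on_continuous_on: "smooth_on S f \<Longrightarrow> continuous_on S f"
  unfolding smooth_on_def using Ck_on.simps(1) by blast

lemma smooth_on_fderiv_apply:
  fixes g :: "'b::euclidean_space \<Rightarrow> 'c::real_normed_vector"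
  assumes "open S" "open T" "smooth_on T g" "smooth_on S f" "f ` S \<subseteq> T" "smooth_on S c"
  shows "smooth_on S (\<lambda>x. fderiv g (f x) (c x))"
proof (rule smooth_on_cong[OF assms(1)])
  show "smooth_on S (\<lambda>x. \<Sum>b\<in>Basis. (c x \<bullet> b) *\<^sub>R fderiv g (f x) b)"
    by (intro smooth_on_sum[OF assms(1)] smooth_on_scaleR[OF assms(1)]
        smooth_on_bounded_linear[OF assms(1) bounded_linear_inner_left assms(6)]
        smooth_on_compose[OF assms(1,2) smooth_on_fderiv[OF assms(3)] assms(4,5)])
next
  fix x assume "x \<in> S"
  with assms have "g differentiable at (f x)" using smooth_on_differentiable by blast
  from fderiv_basis[OF this, of "c x"]
  show "(\<Sum>b\<in>Basis. (c x \<bullet> b) *\<^sub>R fderiv g (f x) b) = fderiv g (f x) (c x)" by simp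
qed

text \<open>The product rule for a derivative whose base point and direction both vary. All second order computations
below, such as accelerations of composed curves and derivatives of induced metrics, are instances of it.\<close>

lemma has_derivative_fderiv_apply:
  fixes g :: "'b::euclidean_space \<Rightarrow> 'c::real_normed_vector"
  assumes "open T" "smooth_on T g" "f x \<in> T" "(f has_derivative f') (at x)" "(c has_derivative c') (at x)"
  shows "((\<lambda>x. fderiv g (f x) (c x)) has_derivative
      (\<lambda>h. fderiv (\<lambda>p. fderiv g p (c x)) (f x) (f' h) + fderiv g (f x) (c' h))) (at x)"
proof -
  let ?g = "\<lambda>b p. fderiv g p b"
  have g: "g differentiable at p" if "p \<in> T" for p using assms(2) that by (rule smooth_on_differentiable)
  have sg: "smooth_on T (?g b)" for b using assms(2) by (rule smooth_on_fderiv)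
  have gd: "(?g b has_derivative fderiv (?g b) p) (at p)" if "p \<in> T" for p b
    using sg that by (rule smooth_on_has_derivative)
  have comp: "((\<lambda>x. ?g b (f x)) has_derivative (\<lambda>h. fderiv (?g b) (f x) (f' h))) (at x)" for b
    using has_derivative_compose[OF assms(4) gd[OF assms(3)]] .
  have D: "((\<lambda>x. \<Sum>b\<in>Basis. (c x \<bullet> b) *\<^sub>R ?g b (f x)) has_derivative
     (\<lambda>h. \<Sum>b\<in>Basis. (c x \<bullet> b) *\<^sub>R fderiv (?g b) (f x) (f' h) + (c' h \<bullet> b) *\<^sub>R ?g b (f x))) (at x)"
    by (intro has_derivative_sum has_derivative_scaleR comp has_derivative_inner_left assms(5))
  have "((\<lambda>p. \<Sum>b\<in>Basis. (c x \<bullet> b) *\<^sub>R ?g b p) has_derivative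
      (\<lambda>h. \<Sum>b\<in>Basis. (c x \<bullet> b) *\<^sub>R fderiv (?g b) (f x) h)) (at (f x))"
    by (intro has_derivative_sum has_derivative_scaleR_right gd assms(3))
  then have "((\<lambda>p. ?g (c x) p) has_derivative
      (\<lambda>h. \<Sum>b\<in>Basis. (c x \<bullet> b) *\<^sub>R fderiv (?g b) (f x) h)) (at (f x))"
    by (rule has_derivative_transform_within_open[OF _ assms(1,3)]) (simp add: fderiv_basis[OF g, symmetric])
  note e1 = fderiv_eq[OF this]
  have e2: "(\<Sum>b\<in>Basis. (c x \<bullet> b) *\<^sub>R fderiv (?g b) (f x) (f' h) + (c' h \<bullet> b) *\<^sub>R ?g b (f x))
     = fderiv (\<lambda>p. fderiv g p (c x)) (f x) (f' h) + fderiv g (f x) (c' h)" for h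
    by (simp add: sum.distrib e1 fderiv_basis[OF g[OF assms(3)], symmetric])
  have "isCont f x" using assms(4) has_derivative_continuous by blast
  then have "\<forall>\<^sub>F y in at x. f y \<in> T"
    using assms(1,3) by (simp add: continuous_at topological_tendstoD)
  then have ev: "\<forall>\<^sub>F y in at x. (\<Sum>b\<in>Basis. (c y \<bullet> b) *\<^sub>R ?g b (f y)) = fderiv g (f y) (c y)"
    by eventually_elim (simp add: fderiv_basis[OF g, symmetric])
  show ?thesis
    using has_derivative_transform_eventually[OF D ev] fderiv_basis[OF g[OF assms(3)], of "c x"] e2 by simp
qed

section \<open>Symmetry of the second derivative\<close>

text \<open>The mean value theorem is applied to the second difference first along \<open>v\<close>, then along \<open>w\<close>.
The difference is symmetric in \<open>v\<close> and \<open>w\<close>, the resulting derivative is a priori not; letting \<open>h\<close> tend to \<open>0\<close>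
gives the symmetry of the second derivative.\<close>

lemma second_difference_mean_value:
  fixes f :: "'a::real_normed_vector \<Rightarrow> real"
  assumes f: "smooth_on S f" and S: "ball x r \<subseteq> S" and h: "0 < h" "h * (norm v + norm w) < r"
  shows "\<exists>p. dist x p \<le> h * (norm v + norm w) \<and>
    f (x + h *\<^sub>R v + h *\<^sub>R w) - f (x + h *\<^sub>R v) - f (x + h *\<^sub>R w) + f x = h\<^sup>2 * fderiv (\<lambda>y. fderiv f y v) p w"
proof -
  have le: "norm (s *\<^sub>R v + q *\<^sub>R w) \<le> h * (norm v + norm w)" if "0 \<le> s" "s \<le> h" "0 \<le> q" "q \<le> h" for s q
  proof -
    have "norm (s *\<^sub>R v + q *\<^sub>R w) \<le> s * norm v + q * norm w"
      using that norm_triangle_ineq[of "s *\<^sub>R v" "q *\<^sub>R w"] by simp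
    also have "\<dots> \<le> h * norm v + h * norm w" using that by (intro add_mono mult_right_mono) auto
    finally show ?thesis by (simp add: distrib_left)
  qed
  have mem: "x + s *\<^sub>R v + q *\<^sub>R w \<in> S" if "0 \<le> s" "s \<le> h" "0 \<le> q" "q \<le> h" for s q
  proof -
    have "dist x (x + s *\<^sub>R v + q *\<^sub>R w) = norm (s *\<^sub>R v + q *\<^sub>R w)"
      by (simp add: dist_norm norm_minus_commute algebra_simps)
    then show ?thesis using le[OF that] h S by auto
  qed
  have along: "DERIV (\<lambda>s. g (a + s *\<^sub>R u)) s :> fderiv g (a + s *\<^sub>R u) u"
    if "smooth_on S g" "a + s *\<^sub>R u \<in> S" for g :: "'a \<Rightarrow> real" and a s u
  proof -
    have "((\<lambda>s. g (a + s *\<^sub>R u)) has_derivative (\<lambda>k. fderiv g (a + s *\<^sub>R u) (k *\<^sub>R u))) (at s)"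
      by (rule has_derivative_compose[where f = "\<lambda>s. a + s *\<^sub>R u", OF _ smooth_on_has_derivative[OF that]])
        (auto intro!: derivative_eq_intros)
    moreover have "fderiv g (a + s *\<^sub>R u) (k *\<^sub>R u) = fderiv g (a + s *\<^sub>R u) u * k" for k
      using linear_cmul[OF linear_fderiv[OF smooth_on_differentiable[OF that]]] by simp
    ultimately show ?thesis by (simp add: has_field_derivative_def)
  qed
  let ?\<phi>' = "\<lambda>s. fderiv f (x + h *\<^sub>R w + s *\<^sub>R v) v - fderiv f (x + s *\<^sub>R v) v"
  have "\<exists>s>0. s < h \<and> (f (x + h *\<^sub>R w + h *\<^sub>R v) - f (x + h *\<^sub>R v)) - (f (x + h *\<^sub>R w + 0 *\<^sub>R v) - f (x + 0 *\<^sub>R v)) = (h - 0) * ?\<phi>' s"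
  proof (rule MVT2[OF h(1)])
    fix s assume s: "0 \<le> s" "s \<le> h"
    show "DERIV (\<lambda>s. f (x + h *\<^sub>R w + s *\<^sub>R v) - f (x + s *\<^sub>R v)) s :> ?\<phi>' s"
      using mem[of s h] mem[of s 0] s h
      by (intro DERIV_diff along f) (auto simp: algebra_simps)
  qed
  then obtain s where s: "0 < s" "s < h"
    "(f (x + h *\<^sub>R w + h *\<^sub>R v) - f (x + h *\<^sub>R v)) - (f (x + h *\<^sub>R w) - f x) = h * ?\<phi>' s" by auto
  let ?g = "\<lambda>y. fderiv f y v"
  have "\<exists>q>0. q < h \<and> ?g (x + s *\<^sub>R v + h *\<^sub>R w) - ?g (x + s *\<^sub>R v + 0 *\<^sub>R w) = (h - 0) * fderiv ?g (x + s *\<^sub>R v + q *\<^sub>R w) w"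
  proof (rule MVT2[OF h(1)])
    fix q assume q: "0 \<le> q" "q \<le> h"
    show "DERIV (\<lambda>q. ?g (x + s *\<^sub>R v + q *\<^sub>R w)) q :> fderiv ?g (x + s *\<^sub>R v + q *\<^sub>R w) w"
      using mem[of s q] s q h by (intro along smooth_on_fderiv f) auto
  qed
  then obtain q where q: "0 < q" "q < h"
    "?g (x + s *\<^sub>R v + h *\<^sub>R w) - ?g (x + s *\<^sub>R v) = h * fderiv ?g (x + s *\<^sub>R v + q *\<^sub>R w) w" by auto
  show ?thesis
  proof (intro exI[of _ "x + s *\<^sub>R v + q *\<^sub>R w"] conjI)
    show "dist x (x + s *\<^sub>R v + q *\<^sub>R w) \<le> h * (norm v + norm w)"
      using le[of s q] s q by (simp add: dist_norm norm_minus_commute algebra_simps)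
    have "f (x + h *\<^sub>R v + h *\<^sub>R w) - f (x + h *\<^sub>R v) - f (x + h *\<^sub>R w) + f x = h * ?\<phi>' s"
      using s(3) by (simp add: algebra_simps)
    also have "\<dots> = h * (h * fderiv ?g (x + s *\<^sub>R v + q *\<^sub>R w) w)"
      using q(3) by (simp add: algebra_simps)
    finally show "f (x + h *\<^sub>R v + h *\<^sub>R w) - f (x + h *\<^sub>R v) - f (x + h *\<^sub>R w) + f x
        = h\<^sup>2 * fderiv ?g (x + s *\<^sub>R v + q *\<^sub>R w) w"
      by (simp add: power2_eq_square)
  qed
qed

lemma fderiv_commute_real:
  fixes f :: "'a::real_normed_vector \<Rightarrow> real"
  assumes S: "open S" and f: "smooth_on S f" and x: "x \<in> S"
  shows "fderiv (\<lambda>y. fderiv f y v) x w = fderiv (\<lambda>y. fderiv f y w) x v"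
proof (rule ccontr)
  let ?A = "\<lambda>p. fderiv (\<lambda>y. fderiv f y v) p w" and ?B = "\<lambda>p. fderiv (\<lambda>y. fderiv f y w) p v"
  assume ne: "?A x \<noteq> ?B x"
  define e where "e = \<bar>?A x - ?B x\<bar> / 2"
  have "e > 0" using ne by (simp add: e_def)
  have cont: "isCont ?A x" "isCont ?B x"
    using smooth_on_continuous_on[OF smooth_on_fderiv[OF smooth_on_fderiv[OF f]]] S x
    by (auto simp: continuous_on_eq_continuous_at)
  obtain r where r: "r > 0" "ball x r \<subseteq> S" using S x openE by blast
  obtain d1 where d1: "d1 > 0" "\<And>p. dist p x < d1 \<Longrightarrow> dist (?A p) (?A x) < e"
    using cont(1) \<open>e > 0\<close> unfolding continuous_at_eps_delta by blast
  obtain d2 where d2: "d2 > 0" "\<And>p. dist p x < d2 \<Longrightarrow> dist (?B p) (?B x) < e"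
    using cont(2) \<open>e > 0\<close> unfolding continuous_at_eps_delta by blast
  \<comment> \<open>\<open>h\<close> is so small that both intermediate points lie within \<open>r\<close>, \<open>d1\<close> and \<open>d2\<close> of \<open>x\<close>; the summand \<open>1\<close> avoids division
    by zero.\<close>
  define m where "m = min r (min d1 d2)"
  define h where "h = m / (norm v + norm w + 1)"
  have m: "m > 0" using r d1 d2 by (simp add: m_def)
  have pos: "norm v + norm w + 1 > 0" by (smt (verit) norm_ge_zero)
  have h: "h > 0" using m pos by (simp add: h_def)
  have "h * (norm v + norm w) < h * (norm v + norm w + 1)" using h by simp
  also have "\<dots> = m" using pos by (simp add: h_def)
  finally have hm: "h * (norm v + norm w) < m" .
  obtain p where p: "dist x p \<le> h * (norm v + norm w)"
    "f (x + h *\<^sub>R v + h *\<^sub>R w) - f (x + h *\<^sub>R v) - f (x + h *\<^sub>R w) + f x = h\<^sup>2 * ?A p"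
    using second_difference_mean_value[OF f r(2) h, of v w] hm by (auto simp: m_def)
  obtain q where q: "dist x q \<le> h * (norm w + norm v)"
    "f (x + h *\<^sub>R w + h *\<^sub>R v) - f (x + h *\<^sub>R w) - f (x + h *\<^sub>R v) + f x = h\<^sup>2 * ?B q"
    using second_difference_mean_value[OF f r(2) h, of w v] hm by (auto simp: m_def add.commute)
  have "h\<^sup>2 * ?A p = h\<^sup>2 * ?B q" using p(2) q(2) by (simp add: algebra_simps)
  then have "?A p = ?B q" using h by simp
  moreover have "dist (?A p) (?A x) < e" using p(1) hm by (intro d1(2)) (simp add: dist_commute m_def)
  moreover have "dist (?B q) (?B x) < e" using q(1) hm by (intro d2(2)) (simp add: dist_commute m_def add.commute)
  ultimately show False unfolding dist_real_def e_def by (simp add: abs_if split: if_splits)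
qed

lemma fderiv_bounded_linear:
  assumes "bounded_linear h" "f differentiable at x"
  shows "fderiv (\<lambda>y. h (f y)) x v = h (fderiv f x v)"
  using fderiv_eq[OF bounded_linear.has_derivative[OF assms(1) has_derivative_fderiv[OF assms(2)]]] by simp

lemma fderiv_commute:
  fixes f :: "'a::real_normed_vector \<Rightarrow> 'b::euclidean_space"
  assumes S: "open S" and f: "smooth_on S f" and x: "x \<in> S"
  shows "fderiv (\<lambda>y. fderiv f y v) x w = fderiv (\<lambda>y. fderiv f y w) x v"
proof (rule euclidean_eqI)
  fix b :: 'b assume "b \<in> Basis"
  have *: "fderiv (\<lambda>y. fderiv f y v) x w \<bullet> b = fderiv (\<lambda>y. fderiv (\<lambda>z. f z \<bullet> b) y v) x w" for v w
  proof -
    have "fderiv (\<lambda>y. fderiv f y v) x w \<bullet> b = fderiv (\<lambda>y. fderiv f y v \<bullet> b) x w"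
      by (rule fderiv_bounded_linear[OF bounded_linear_inner_left, symmetric])
        (use smooth_on_differentiable[OF smooth_on_fderiv[OF f] x] in simp)
    also have "\<dots> = fderiv (\<lambda>y. fderiv (\<lambda>z. f z \<bullet> b) y v) x w"
    proof (rule fun_cong[OF fderiv_cong_open(2)[OF S x]])
      show "fderiv (\<lambda>z. f z \<bullet> b) y v = fderiv f y v \<bullet> b" if "y \<in> S" for y
        using fderiv_bounded_linear[OF bounded_linear_inner_left smooth_on_differentiable[OF f that]] .
      show "(\<lambda>y. fderiv (\<lambda>z. f z \<bullet> b) y v) differentiable at x"
        using smooth_on_differentiable[OF smooth_on_fderiv[OF smooth_on_bounded_linear[OF S bounded_linear_inner_left f]] x] .
    qed
    finally show ?thesis .
  qed
  show "fderiv (\<lambda>y. fderiv f y v) x w \<bullet> b = fderiv (\<lambda>y. fderiv f y w) x v \<bullet> b"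
    unfolding * by (rule fderiv_commute_real[OF S smooth_on_bounded_linear[OF S bounded_linear_inner_left f] x])
qed

section \<open>Ordinary differential equations\<close>

lemma smooth_on_lipschitz_cball:
  fixes A :: "'a::euclidean_space \<Rightarrow> 'b::euclidean_space"
  assumes A: "smooth_on W A" and r: "cball w0 r \<subseteq> W"
  obtains K where "0 < K" "\<And>x y. x \<in> cball w0 r \<Longrightarrow> y \<in> cball w0 r \<Longrightarrow> norm (A x - A y) \<le> K * norm (x - y)"
proof -
  have "compact ((\<lambda>x. \<Sum>b\<in>Basis. norm (fderiv A x b)) ` cball w0 r)"
    using smooth_on_continuous_on[OF smooth_on_fderiv[OF A]] r
    by (intro compact_continuous_image compact_cball continuous_on_sum continuous_on_norm)
      (meson continuous_on_subset)
  from compact_imp_bounded[OF this] obtain K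
    where K: "K > 0" "\<And>x. x \<in> cball w0 r \<Longrightarrow> norm (\<Sum>b\<in>Basis. norm (fderiv A x b)) \<le> K"
    unfolding bounded_pos by auto
  have on: "onorm (fderiv A x) \<le> K" if x: "x \<in> cball w0 r" for x
  proof (rule onorm_le)
    fix v
    have "A differentiable at x" using A r x by (meson smooth_on_differentiable subsetD)
    then have "norm (fderiv A x v) = norm (\<Sum>b\<in>Basis. (v \<bullet> b) *\<^sub>R fderiv A x b)"
      using fderiv_basis by metis
    also have "\<dots> \<le> (\<Sum>b\<in>Basis. norm v * norm (fderiv A x b))"
      by (rule sum_norm_le) (simp add: mult_right_mono Basis_le_norm)
    also have "\<dots> = norm v * (\<Sum>b\<in>Basis. norm (fderiv A x b))" by (simp add: sum_distrib_left)
    also have "\<dots> \<le> norm v * K" using K(2)[OF x] by (intro mult_left_mono) auto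
    finally show "norm (fderiv A x v) \<le> K * norm v" by (simp add: mult.commute)
  qed
  show thesis
  proof (rule that[OF K(1)])
    fix x y assume xy: "x \<in> cball w0 r" "y \<in> cball w0 r"
    show "norm (A x - A y) \<le> K * norm (x - y)"
    proof (rule differentiable_bound[OF convex_cball _ on xy])
      fix z assume "z \<in> cball w0 r"
      then show "(A has_derivative fderiv A z) (at z within cball w0 r)"
        using A r by (meson has_derivative_at_withinI smooth_on_has_derivative subsetD)
    qed
  qed
qed

text \<open>The Picard operator is a contraction on bounded continuous curves once the vector field is
globally Lipschitz and bounded. Curves are defined on the whole line, with time clamped to a short interval, so
that the complete type of bounded continuous functions can be used. Integrals start at \<open>-a\<close> and the
integral up to \<open>0\<close> is subtracted; bounding the two parts separately gives the factor \<open>3\<close>.\<close>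

lemma picard_lindelof_global:
  fixes g :: "'a::euclidean_space \<Rightarrow> 'a"
  assumes K: "0 < K" "\<And>x y. norm (g x - g y) \<le> K * norm (x - y)"
    and M: "0 < M" "\<And>x. norm (g x) \<le> M"
    and a: "0 < a" "3 * a * K \<le> 1 / 2"
  obtains w where "w 0 = w0" "\<And>t. norm (w t - w0) \<le> 3 * a * M"
    "\<And>t. t \<in> {-a<..<a} \<Longrightarrow> (w has_vector_derivative g (w t)) (at t)"
proof -
  define cl where "cl t = max (-a) (min a t)" for t :: real
  have cl: "cl t \<in> {-a..a}" for t using a by (auto simp: cl_def)
  have cl_id: "cl t = t" if "t \<in> {-a..a}" for t using that by (auto simp: cl_def)
  have contg: "continuous_on UNIV g"
  proof (rule continuous_at_imp_continuous_on, rule ballI)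
    fix x
    show "isCont g x" unfolding continuous_at_eps_delta
    proof (intro allI impI)
      fix e :: real assume "e > 0"
      show "\<exists>d>0. \<forall>x'. dist x' x < d \<longrightarrow> dist (g x') (g x) < e"
      proof (intro exI[of _ "e / K"] conjI allI impI)
        show "e / K > 0" using \<open>e > 0\<close> K by simp
        fix x' assume "dist x' x < e / K"
        then have "K * norm (x' - x) < e" using K(1) by (simp add: dist_norm field_simps)
        then show "dist (g x') (g x) < e" using K(2)[of x' x] by (simp add: dist_norm)
      qed
    qed
  qed
  define I where "I \<phi> s = integral {-a..s} (\<lambda>t. g (\<phi> t)) - integral {-a..0} (\<lambda>t. g (\<phi> t))"
    for \<phi> :: "real \<Rightarrow> 'a" and s
  have contc: "continuous_on S (\<lambda>t. g (\<phi> t))" if "continuous_on UNIV \<phi>" for \<phi> :: "real \<Rightarrow> 'a" and S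
    using continuous_on_compose2[OF contg that] continuous_on_subset by blast
  have integ: "(\<lambda>t. g (\<phi> t)) integrable_on {-a..s}" if "continuous_on UNIV \<phi>" for \<phi> s
    by (rule integrable_continuous_real[OF contc[OF that]])
  have contI: "continuous_on {-a..a} (I \<phi>)" if "continuous_on UNIV \<phi>" for \<phi>
    unfolding I_def by (intro continuous_on_diff indefinite_integral_continuous_1 integ[OF that] continuous_on_const)
  have boundI: "norm (I \<phi> s) \<le> 3 * a * M" if \<phi>: "continuous_on UNIV \<phi>" and s: "s \<in> {-a..a}" for \<phi> s
  proof -
    have "norm (integral {-a..u} (\<lambda>t. g (\<phi> t))) \<le> M * (u - (-a))" if "u \<in> {-a..a}" for u
      using that M by (intro integral_bound contc[OF \<phi>]) auto
    from this[OF s] this[of 0] a have "norm (I \<phi> s) \<le> M * (s + a) + M * a"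
      unfolding I_def by (intro norm_triangle_le_diff) (auto intro: add_mono)
    also have "\<dots> = M * (s + 2 * a)" by (simp add: algebra_simps)
    also have "\<dots> \<le> M * (3 * a)" using M s by (intro mult_left_mono) auto
    finally show ?thesis by (simp add: mult.commute)
  qed
  have lipI: "norm (I \<phi> s - I \<psi> s) \<le> 1 / 2 * d"
    if \<phi>: "continuous_on UNIV \<phi>" and \<psi>: "continuous_on UNIV \<psi>" and s: "s \<in> {-a..a}" 
      and d: "\<And>t. norm (\<phi> t - \<psi> t) \<le> d" for \<phi> \<psi> s d
  proof -
    have d0: "d \<ge> 0" using d[of 0] norm_ge_zero order_trans by blast
    have b: "norm (integral {-a..u} (\<lambda>t. g (\<phi> t) - g (\<psi> t))) \<le> (K * d) * (u - (-a))" if "u \<in> {-a..a}" for u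
    proof (intro integral_bound continuous_on_diff contc \<phi> \<psi>)
      fix t show "norm (g (\<phi> t) - g (\<psi> t)) \<le> K * d"
        using K(2)[of "\<phi> t" "\<psi> t"] mult_left_mono[OF d[of t], of K] K(1) by linarith
    qed (use that in auto)
    have "I \<phi> s - I \<psi> s = integral {-a..s} (\<lambda>t. g (\<phi> t) - g (\<psi> t)) - integral {-a..0} (\<lambda>t. g (\<phi> t) - g (\<psi> t))"
      unfolding I_def by (simp add: integral_diff[OF integ[OF \<phi>] integ[OF \<psi>]])
    also have "norm \<dots> \<le> (K * d) * (s + a) + (K * d) * a"
      using b[OF s] b[of 0] a by (intro norm_triangle_le_diff) (auto intro: add_mono)
    also have "\<dots> = (K * d) * (s + 2 * a)" by (simp add: algebra_simps)
    also have "\<dots> \<le> (K * d) * (3 * a)" using K s d0 by (intro mult_left_mono) auto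
    also have "\<dots> = (3 * a * K) * d" by simp
    also have "\<dots> \<le> 1 / 2 * d" using a(2) d0 by (rule mult_right_mono)
    finally show ?thesis .
  qed
  define T where "T \<phi> = Bcontfun (\<lambda>t. w0 + I (apply_bcontfun \<phi>) (cl t))" for \<phi> :: "real \<Rightarrow>\<^sub>C 'a"
  have contap: "continuous_on UNIV (apply_bcontfun \<phi>)" for \<phi> :: "real \<Rightarrow>\<^sub>C 'a"
    using apply_bcontfun[of \<phi>] by (simp add: bcontfun_def)
  have "(\<lambda>t. w0 + I (apply_bcontfun \<phi>) (cl t)) \<in> bcontfun" for \<phi>
  proof (rule bcontfun_normI)
    have "continuous_on UNIV cl" unfolding cl_def by (intro continuous_intros)
    then show "continuous_on UNIV (\<lambda>t. w0 + I (apply_bcontfun \<phi>) (cl t))"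
      using cl by (intro continuous_on_add continuous_on_const continuous_on_compose2[OF contI[OF contap]]) auto
    show "norm (w0 + I (apply_bcontfun \<phi>) (cl t)) \<le> norm w0 + 3 * a * M" for t
      using boundI[OF contap cl] by (intro norm_triangle_le add_left_mono)
  qed
  then have T: "apply_bcontfun (T \<phi>) t = w0 + I (apply_bcontfun \<phi>) (cl t)" for \<phi> t
    by (simp add: T_def Bcontfun_inverse)
  have "\<exists>!\<phi>. T \<phi> = \<phi>"
  proof (rule banach_fix_type[of "1/2"])
    show "\<forall>\<phi> \<psi>. dist (T \<phi>) (T \<psi>) \<le> 1 / 2 * dist \<phi> \<psi>"
    proof (intro allI dist_bound)
      fix \<phi> \<psi> :: "real \<Rightarrow>\<^sub>C 'a" and t
      have "norm (I (apply_bcontfun \<phi>) (cl t) - I (apply_bcontfun \<psi>) (cl t)) \<le> 1 / 2 * dist \<phi> \<psi>"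
        by (rule lipI[OF contap contap cl]) (use dist_bounded[of \<phi> _ \<psi>] in \<open>simp add: dist_norm\<close>)
      then show "dist (apply_bcontfun (T \<phi>) t) (apply_bcontfun (T \<psi>) t) \<le> 1 / 2 * dist \<phi> \<psi>"
        by (simp add: T dist_norm)
    qed
  qed auto
  then obtain \<phi> where "T \<phi> = \<phi>" by blast
  define w where "w = apply_bcontfun \<phi>"
  have w: "w t = w0 + I w (cl t)" for t unfolding w_def using T[of \<phi> t] \<open>T \<phi> = \<phi>\<close> by simp
  have wc: "continuous_on UNIV w" unfolding w_def by (rule contap)
  show thesis
  proof (rule that)
    show "w 0 = w0" using w[of 0] cl_id[of 0] a by (simp add: I_def)
    show "norm (w t - w0) \<le> 3 * a * M" for t using w[of t] boundI[OF wc cl] by simp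
    fix t assume t: "t \<in> {-a<..<a}"
    have "((\<lambda>s. integral {-a..s} (\<lambda>t. g (w t))) has_vector_derivative g (w t)) (at t within {-a..a})"
      by (rule integral_has_vector_derivative[OF contc[OF wc]]) (use t in auto)
    then have "((\<lambda>s. w0 + I w s) has_vector_derivative g (w t)) (at t within {-a..a})"
      unfolding I_def by (auto intro!: derivative_eq_intros)
    then have "((\<lambda>s. w0 + I w s) has_vector_derivative g (w t)) (at t within {-a<..<a})"
      by (rule has_vector_derivative_within_subset) auto
    then have "((\<lambda>s. w0 + I w s) has_vector_derivative g (w t)) (at t)"
      by (simp only: at_within_open[OF t open_greaterThanLessThan])
    then show "(w has_vector_derivative g (w t)) (at t)"
      by (rule has_vector_derivative_transform_within_open[where S = "{-a<..<a}"])
        (use t w cl_id in auto)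
  qed
qed

text \<open>The vector field is made global by composing it with the nearest point projection to a closed ball, which
is Lipschitz with constant \<open>1\<close>. The solution stays in the ball for the time considered, where nothing
was changed.\<close>

lemma ode_local_solution:
  fixes A :: "'a::euclidean_space \<Rightarrow> 'a"
  assumes W: "open W" and A: "smooth_on W A" and w0: "w0 \<in> W"
  obtains e w where "0 < e" "w 0 = w0"
    "\<And>t. t \<in> {-e<..<e} \<Longrightarrow> w t \<in> W \<and> (w has_vector_derivative A (w t)) (at t)"
proof -
  obtain r where r: "r > 0" "cball w0 r \<subseteq> W" using W w0 open_contains_cball by blast
  let ?c = "closest_point (cball w0 r)"
  have ne: "cball w0 r \<noteq> {}" using r by simp
  obtain K where K: "0 < K" "\<And>x y. x \<in> cball w0 r \<Longrightarrow> y \<in> cball w0 r \<Longrightarrow> norm (A x - A y) \<le> K * norm (x - y)"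
    using smooth_on_lipschitz_cball[OF A r(2)] by blast
  have "compact (A ` cball w0 r)"
    using smooth_on_continuous_on[OF A] r(2) by (intro compact_continuous_image compact_cball) (meson continuous_on_subset)
  from compact_imp_bounded[OF this] obtain M
    where M: "M > 0" "\<And>x. x \<in> cball w0 r \<Longrightarrow> norm (A x) \<le> M"
    unfolding bounded_pos by auto
  have c: "?c x \<in> cball w0 r" for x using closest_point_in_set[OF closed_cball ne] .
  define a where "a = min (1 / (6 * K)) (r / (3 * M))"
  have a: "0 < a" "3 * a * K \<le> 1 / 2" "3 * a * M \<le> r"
  proof -
    show "0 < a" using K M r by (simp add: a_def)
    have "a * (6 * K) \<le> 1" using K by (simp add: a_def min_def field_simps)
    then show "3 * a * K \<le> 1 / 2" by simp
    have "a * (3 * M) \<le> r" using M by (simp add: a_def min_def field_simps)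
    then show "3 * a * M \<le> r" by simp
  qed
  have lip: "norm (A (?c x) - A (?c y)) \<le> K * norm (x - y)" for x y
  proof -
    have "norm (A (?c x) - A (?c y)) \<le> K * norm (?c x - ?c y)" using K(2)[OF c c] .
    also have "\<dots> \<le> K * norm (x - y)"
      using closest_point_lipschitz[OF convex_cball closed_cball ne, of x y] K(1) by (simp add: dist_norm)
    finally show ?thesis .
  qed
  obtain w where w: "w 0 = w0" "\<And>t. norm (w t - w0) \<le> 3 * a * M"
    "\<And>t. t \<in> {-a<..<a} \<Longrightarrow> (w has_vector_derivative A (?c (w t))) (at t)"
    using picard_lindelof_global[OF K(1) lip M(1) M(2)[OF c] a(1,2)] by blast
  have mem: "w t \<in> cball w0 r" for t using w(2)[of t] a(3) by (simp add: dist_norm norm_minus_commute)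
  show thesis
    by (rule that[where w = w, OF a(1) w(1)]) (use w(3) mem r(2) closest_point_self[OF mem] in auto)
qed

text \<open>Bootstrapping: the derivative of a solution is a smooth function of the solution, so each order
of differentiability yields the next.\<close>

lemma ode_solution_smooth:
  fixes A :: "'a::euclidean_space \<Rightarrow> 'a"
  assumes J: "open J" and W: "open W" and A: "smooth_on W A"
    and w: "\<And>t. t \<in> J \<Longrightarrow> w t \<in> W \<and> (w has_vector_derivative A (w t)) (at t)"
  shows "smooth_on J w"
  unfolding smooth_on_def
proof
  fix k show "Ck_on k J w"
  proof (induction k)
    case 0
    show ?case unfolding Ck_on.simps
      by (meson continuous_at_imp_continuous_on has_vector_derivative_continuous w)
  next
    case (Suc k)
    have "Ck_on k J (\<lambda>t. A (w t))"
      using Ck_on_compose[OF J W _ Suc] A w by (auto simp: smooth_on_def)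
    then have "Ck_on k J (\<lambda>t. v *\<^sub>R A (w t))" for v
      by (rule Ck_on_bounded_linear[OF J bounded_linear_scaleR_right])
    then show ?case
      by (rule Ck_on_SucI[OF J, where f' = "\<lambda>t v. v *\<^sub>R A (w t)", rotated])
        (use w in \<open>simp add: has_vector_derivative_def\<close>)
  qed
qed

section \<open>Smooth inverse functions\<close>

lemma smooth_inverse_function:
  fixes f :: "real^'k \<Rightarrow> real^'k"
  assumes U: "open U" and f: "smooth_on U f" and x0: "x0 \<in> U" and inj: "inj (fderiv f x0)"
  obtains U' V g where "open U'" "U' \<subseteq> U" "x0 \<in> U'" "open V" "homeomorphism U' V f g" "smooth_on V g"
proof -
  have fd: "(f has_derivative fderiv f x) (at x)" if "x \<in> U" for x
    using f that by (rule smooth_on_has_derivative)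
  have bl: "bounded_linear (fderiv f x)" if "x \<in> U" for x
    using fd[OF that] by (rule has_derivative_bounded_linear)
  let ?f' = "\<lambda>x. Blinfun (fderiv f x)"
  have app: "blinfun_apply (?f' x) = fderiv f x" if "x \<in> U" for x
    using bl[OF that] by (rule bounded_linear_Blinfun_apply)
  have fd': "(f has_derivative blinfun_apply (?f' x)) (at x)" if "x \<in> U" for x
    using fd[OF that] app[OF that] by simp
  have cont: "continuous_on U ?f'"
  proof (rule continuous_on_blinfun_componentwise)
    fix i :: "real^'k"
    have "continuous_on U (\<lambda>x. fderiv f x i)" by (rule smooth_on_continuous_on[OF smooth_on_fderiv[OF f]])
    then show "continuous_on U (\<lambda>x. blinfun_apply (?f' x) i)"
      by (simp add: app cong: continuous_on_cong_simp)
  qed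
  obtain h where h: "linear h" "h \<circ> fderiv f x0 = id"
    using linear_injective_left_inverse[OF bounded_linear.linear[OF bl[OF x0]] inj] by blast
  have inv: "Blinfun h o\<^sub>L ?f' x0 = id_blinfun"
  proof (rule blinfun_eqI)
    fix i show "blinfun_apply (Blinfun h o\<^sub>L ?f' x0) i = blinfun_apply id_blinfun i"
      using h by (simp add: app[OF x0] bounded_linear_Blinfun_apply linear_conv_bounded_linear pointfree_idE)
  qed
  obtain U' V g g' where *: "open U'" "U' \<subseteq> U" "x0 \<in> U'" "open V" "homeomorphism U' V f g"
    "\<And>y. y \<in> V \<Longrightarrow> (g has_derivative (g' y)) (at y)"
    "\<And>y. y \<in> V \<Longrightarrow> g' y = inv (blinfun_apply (?f' (g y)))"
    "\<And>y. y \<in> V \<Longrightarrow> bij (blinfun_apply (?f' (g y)))"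
    by (rule inverse_function_theorem[OF U fd' cont x0 inv]) (assumption, erule that)
  have gU: "g y \<in> U" if "y \<in> V" for y using *(2,5) that by (auto simp: homeomorphism_def)
  have bij: "bij (fderiv f (g y))" if "y \<in> V" for y using *(8)[OF that] app[OF gU[OF that]] by simp
  have right: "fderiv f (g y) (g' y v) = v" if "y \<in> V" for y v
    using *(7)[OF that] app[OF gU[OF that]] bij[OF that] by (simp add: bij_is_surj surj_f_inv_f)
  \<comment> \<open>The derivative of the inverse solves a linear system whose coefficients are as regular as
    the inverse itself, which therefore gains one derivative at every step.\<close>
  have "Ck_on k V g" for k
  proof (induction k)
    case 0
    then show ?case using *(5) by (auto simp: homeomorphism_def)
  next
    case (Suc k)
    show ?case
    proof (rule Ck_on_SucI[OF *(4,6)])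
      fix v
      show "Ck_on k V (\<lambda>y. g' y v)"
      proof (rule Ck_on_linear_solution[OF *(4), where M = "\<lambda>y. matrix (fderiv f (g y))" and b = "\<lambda>y. v"])
        fix i j
        have "Ck_on k V (\<lambda>y. fderiv f (g y) (axis j 1))"
          using smooth_on_fderiv[OF f, of "axis j 1"] gU
          by (intro Ck_on_compose[OF *(4) U _ Suc]) (auto simp: smooth_on_def)
        then show "Ck_on k V (\<lambda>y. matrix (fderiv f (g y)) $ i $ j)"
          unfolding matrix_def using Ck_on_bounded_linear[OF *(4) bounded_linear_vec_nth] by simp
      next
        fix y assume y: "y \<in> V"
        have lin: "linear (fderiv f (g y))" using bl[OF gU[OF y]] by (rule bounded_linear.linear)
        show "det (matrix (fderiv f (g y))) \<noteq> 0" using bij[OF y] lin by (simp add: det_nz_iff_inj bij_is_inj)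
        show "matrix (fderiv f (g y)) *v g' y v = v" using right[OF y] lin by (simp add: matrix_works)
      qed (rule Ck_on_const)
    qed
  qed
  then show thesis using that[OF *(1-5)] by (simp add: smooth_on_def)
qed

section \<open>Curves\<close>

abbreviation velocity :: "(real \<Rightarrow> 'a::real_normed_vector) \<Rightarrow> real \<Rightarrow> 'a" where
  "velocity x s \<equiv> vector_derivative x (at s)"

abbreviation acceleration :: "(real \<Rightarrow> 'a::real_normed_vector) \<Rightarrow> real \<Rightarrow> 'a" where
  "acceleration x \<equiv> velocity (velocity x)"

lemma smooth_curve_has_velocity:
  "smooth_on J x \<Longrightarrow> s \<in> J \<Longrightarrow> (x has_vector_derivative velocity x s) (at s)"
  by (simp add: smooth_on_differentiable vector_derivative_works[symmetric])

lemma smooth_on_velocity: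
  assumes "open J" "smooth_on J x"
  shows "smooth_on J (velocity x)"
proof (rule smooth_on_cong[OF assms(1) _ smooth_on_fderiv[OF assms(2), of 1]])
  fix s assume "s \<in> J"
  then show "fderiv x s 1 = velocity x s"
    using frechet_derivative_eq_vector_derivative[OF smooth_on_differentiable[OF assms(2)]] by simp
qed

lemma has_vector_derivative_compose_fderiv:
  assumes "(x has_vector_derivative v) (at t)" "g differentiable at (x t)"
  shows "((\<lambda>s. g (x s)) has_vector_derivative fderiv g (x t) v) (at t)"
proof -
  have "((\<lambda>s. g (x s)) has_derivative (\<lambda>h. fderiv g (x t) (h *\<^sub>R v))) (at t)"
    by (rule has_derivative_compose[OF assms(1)[unfolded has_vector_derivative_def] has_derivative_fderiv[OF assms(2)]])
  then show ?thesis
    unfolding has_vector_derivative_def by (simp add: linear_cmul[OF linear_fderiv[OF assms(2)]])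
qed

lemma velocity_compose:
  fixes f :: "'a::euclidean_space \<Rightarrow> 'b::real_normed_vector"
  assumes "open U" "smooth_on U f" "open J" "smooth_on J u" "u ` J \<subseteq> U" "t \<in> J"
  shows "velocity (\<lambda>s. f (u s)) t = fderiv f (u t) (velocity u t)"
  using has_vector_derivative_compose_fderiv[OF smooth_curve_has_velocity[OF assms(4,6)]]
    smooth_on_differentiable[OF assms(2)] assms(5,6) by (auto intro!: vector_derivative_at)

lemma has_vector_derivative_cong_open:
  assumes "open J" "t \<in> J" "\<And>s. s \<in> J \<Longrightarrow> f s = g s"
  shows "(f has_vector_derivative d) (at t) \<longleftrightarrow> (g has_vector_derivative d) (at t)"
  using has_vector_derivative_transform_within_open[OF _ assms(1,2)] assms(3) by metis

lemma velocity_cong_open: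
  assumes "open J" "t \<in> J" "\<And>s. s \<in> J \<Longrightarrow> f s = g s"
  shows "velocity f t = velocity g t"
  unfolding vector_derivative_def by (simp only: has_vector_derivative_cong_open[OF assms])

text \<open>The term quadratic in the velocity is what distinguishes the acceleration of \<open>f \<circ> u\<close> from the image of the
acceleration of \<open>u\<close>; for a hypersurface it carries the second fundamental form.\<close>

lemma acceleration_compose:
  fixes f :: "'a::euclidean_space \<Rightarrow> 'b::real_normed_vector"
  assumes U: "open U" and f: "smooth_on U f" and J: "open J" and u: "smooth_on J u"
    and uU: "u ` J \<subseteq> U" and t: "t \<in> J"
  shows "acceleration (\<lambda>s. f (u s)) t =
    fderiv (\<lambda>p. fderiv f p (velocity u t)) (u t) (velocity u t) + fderiv f (u t) (acceleration u t)"
proof -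
  have "((\<lambda>s. fderiv f (u s) (velocity u s)) has_derivative
     (\<lambda>h. fderiv (\<lambda>p. fderiv f p (velocity u t)) (u t) (h *\<^sub>R velocity u t) + fderiv f (u t) (h *\<^sub>R acceleration u t))) (at t)"
    using uU t
    by (intro has_derivative_fderiv_apply[OF U f]
        smooth_curve_has_velocity[OF u t, unfolded has_vector_derivative_def]
        smooth_curve_has_velocity[OF smooth_on_velocity[OF J u] t, unfolded has_vector_derivative_def]) auto
  moreover have "f differentiable at (u t)" "(\<lambda>p. fderiv f p (velocity u t)) differentiable at (u t)"
    using uU t by (auto intro!: smooth_on_differentiable[OF f] smooth_on_differentiable[OF smooth_on_fderiv[OF f]])
  ultimately have "((\<lambda>s. fderiv f (u s) (velocity u s)) has_vector_derivative
     fderiv (\<lambda>p. fderiv f p (velocity u t)) (u t) (velocity u t) + fderiv f (u t) (acceleration u t)) (at t)"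
    unfolding has_vector_derivative_def by (simp add: linear_cmul[OF linear_fderiv] scaleR_add_right)
  then have "((velocity (\<lambda>s. f (u s))) has_vector_derivative
     fderiv (\<lambda>p. fderiv f p (velocity u t)) (u t) (velocity u t) + fderiv f (u t) (acceleration u t)) (at t)"
    by (rule has_vector_derivative_transform_within_open[OF _ J t])
      (simp add: velocity_compose[OF U f J u uU])
  then show ?thesis by (rule vector_derivative_at)
qed

section \<open>The Euler-Lagrange expression\<close>

lemma linear_fderiv_fderiv:
  assumes "open T" "smooth_on T g" "x \<in> T"
  shows "linear (\<lambda>b. fderiv (\<lambda>p. fderiv g p b) x h)"
proof -
  have g: "linear (fderiv g p)" if "p \<in> T" for p
    using linear_fderiv[OF smooth_on_differentiable[OF assms(2) that]] .
  have d: "((\<lambda>p. fderiv g p b) has_derivative fderiv (\<lambda>p. fderiv g p b) x) (at x)" for b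
    using smooth_on_has_derivative[OF smooth_on_fderiv[OF assms(2)] assms(3)] .
  show ?thesis
  proof (rule linearI)
    fix b c
    have "((\<lambda>p. fderiv g p (b + c)) has_derivative
        (\<lambda>h. fderiv (\<lambda>p. fderiv g p b) x h + fderiv (\<lambda>p. fderiv g p c) x h)) (at x)"
      by (rule has_derivative_transform_within_open[OF has_derivative_add[OF d[of b] d[of c]] assms(1,3)])
        (simp add: linear_add[OF g])
    from fderiv_eq[OF this] show "fderiv (\<lambda>p. fderiv g p (b + c)) x h
      = fderiv (\<lambda>p. fderiv g p b) x h + fderiv (\<lambda>p. fderiv g p c) x h" by simp
  next
    fix r b
    have "((\<lambda>p. fderiv g p (r *\<^sub>R b)) has_derivative (\<lambda>h. r *\<^sub>R fderiv (\<lambda>p. fderiv g p b) x h)) (at x)"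
      by (rule has_derivative_transform_within_open[OF has_derivative_scaleR_right[OF d[of b]] assms(1,3)])
        (simp add: linear_cmul[OF g])
    from fderiv_eq[OF this] show "fderiv (\<lambda>p. fderiv g p (r *\<^sub>R b)) x h = r *\<^sub>R fderiv (\<lambda>p. fderiv g p b) x h" by simp
  qed
qed

lemma linear_axis_expansion:
  fixes h :: "real^'n \<Rightarrow> 'b::real_vector"
  assumes "linear h"
  shows "h w = (\<Sum>i\<in>UNIV. (w $ i) *\<^sub>R h (axis i 1))"
proof -
  have "h w = h (\<Sum>i\<in>UNIV. (w $ i) *\<^sub>R axis i 1)"
    using basis_expansion[of w] by (simp add: scalar_mult_eq_scaleR)
  then show ?thesis by (simp add: linear_sum[OF assms] linear_cmul[OF assms])
qed

text \<open>The tangent bundle without its zero section, where Finsler metrics are smooth.\<close>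

abbreviation slit :: "(real^'n) set \<Rightarrow> ((real^'n) \<times> (real^'n)) set" where
  "slit X \<equiv> X \<times> (- {0})"

lemma open_slit: "open X \<Longrightarrow> open (slit X)"
  by (intro open_Times open_Compl) auto

text \<open>The Euler-Lagrange expression of a curve with position \<open>x\<close>, velocity \<open>y\<close> and acceleration \<open>a\<close>, tested
against the variation \<open>w\<close>: the time derivative of the derivative of \<open>F\<close> in the fibre direction \<open>w\<close>, minus the
derivative of \<open>F\<close> in the base direction \<open>w\<close>. As an expression in \<open>x\<close>, \<open>y\<close>, \<open>a\<close> it makes
sense without a curve, so that different curves with the same velocity can be compared.\<close>

definition euler :: "(real^'n \<Rightarrow> real^'n \<Rightarrow> real) \<Rightarrow> real^'n \<Rightarrow> real^'n \<Rightarrow> real^'n \<Rightarrow> real^'n \<Rightarrow> real" where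
  "euler F x y a w = fderiv (\<lambda>q. fderiv (case_prod F) q (0, w)) (x, y) (y, a) - fderiv (case_prod F) (x, y) (w, 0)"

definition euler_lagrange :: "(real^'n \<Rightarrow> real^'n \<Rightarrow> real) \<Rightarrow> (real \<Rightarrow> real^'n) \<Rightarrow> real \<Rightarrow> bool" where
  "euler_lagrange F x t \<longleftrightarrow> (\<forall>i. ((\<lambda>s. partial i (\<lambda>y. F (x s) y) (velocity x s))
     has_real_derivative partial i (\<lambda>\<xi>. F \<xi> (velocity x t)) (x t)) (at t))"

lemma fderiv_case_prod:
  assumes "case_prod F differentiable at (x, y)"
  shows "fderiv (\<lambda>y. F x y) y w = fderiv (case_prod F) (x, y) (0, w)"
    and "fderiv (\<lambda>x. F x y) x w = fderiv (case_prod F) (x, y) (w, 0)"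
proof -
  have 1: "((\<lambda>y. (x, y)) has_derivative (\<lambda>w. (0, w))) (at y)"
    and 2: "((\<lambda>x. (x, y)) has_derivative (\<lambda>w. (w, 0))) (at x)"
    by (auto intro!: derivative_eq_intros)
  show "fderiv (\<lambda>y. F x y) y w = fderiv (case_prod F) (x, y) (0, w)"
    using fderiv_eq[OF has_derivative_compose[OF 1 has_derivative_fderiv[OF assms]]] by simp
  show "fderiv (\<lambda>x. F x y) x w = fderiv (case_prod F) (x, y) (w, 0)"
    using fderiv_eq[OF has_derivative_compose[OF 2 has_derivative_fderiv[OF assms]]] by simp
qed

lemma linear_euler:
  assumes X: "open X" and F: "smooth_on (slit X) (case_prod F)" and xy: "x \<in> X" "y \<noteq> 0"
  shows "linear (euler F x y a)"
proof -
  have mem: "(x, y) \<in> slit X" using xy by simp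
  have *: "linear (\<lambda>w. fderiv (\<lambda>q. fderiv (case_prod F) q (0, w)) (x, y) (y, a))"
  proof -
    have "linear (\<lambda>w. (0 :: real^'n, w :: real^'n))" by (rule linearI) auto
    from linear_compose[OF this linear_fderiv_fderiv[OF open_slit[OF X] F mem]]
    show ?thesis by (simp add: o_def)
  qed
  have **: "linear (\<lambda>w. fderiv (case_prod F) (x, y) (w, 0))"
  proof -
    have "linear (\<lambda>w. (w :: real^'n, 0 :: real^'n))" by (rule linearI) auto
    from linear_compose[OF this linear_fderiv[OF smooth_on_differentiable[OF F mem]]]
    show ?thesis by (simp add: o_def)
  qed
  show ?thesis unfolding euler_def using * ** by (rule linear_compose_sub)
qed

lemma euler_lagrange_iff:
  assumes X: "open X" and F: "smooth_on (slit X) (case_prod F)"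
    and J: "open J" and x: "smooth_on J x" and xX: "\<And>s. s \<in> J \<Longrightarrow> x s \<in> X \<and> velocity x s \<noteq> 0" and t: "t \<in> J"
  shows "euler_lagrange F x t \<longleftrightarrow> (\<forall>w. euler F (x t) (velocity x t) (acceleration x t) w = 0)"
proof -
  let ?q = "\<lambda>s. (x s, velocity x s)"
  have mem: "?q s \<in> slit X" if "s \<in> J" for s using xX[OF that] by simp
  have dF: "case_prod F differentiable at (?q s)" if "s \<in> J" for s
    using F mem[OF that] by (rule smooth_on_differentiable)
  have q: "(?q has_vector_derivative (velocity x t, acceleration x t)) (at t)"
    using smooth_curve_has_velocity[OF x t] smooth_curve_has_velocity[OF smooth_on_velocity[OF J x] t]
    by (rule has_vector_derivative_Pair)
  have "((\<lambda>s. partial i (\<lambda>y. F (x s) y) (velocity x s)) has_real_derivative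
      fderiv (\<lambda>q. fderiv (case_prod F) q (0, axis i 1)) (?q t) (velocity x t, acceleration x t)) (at t)" for i
  proof -
    have "((\<lambda>s. fderiv (case_prod F) (?q s) (0, axis i 1)) has_vector_derivative
      fderiv (\<lambda>q. fderiv (case_prod F) q (0, axis i 1)) (?q t) (velocity x t, acceleration x t)) (at t)"
      by (rule has_vector_derivative_compose_fderiv[OF q smooth_on_differentiable[OF smooth_on_fderiv[OF F] mem[OF t]]])
    then have "((\<lambda>s. partial i (\<lambda>y. F (x s) y) (velocity x s)) has_vector_derivative
      fderiv (\<lambda>q. fderiv (case_prod F) q (0, axis i 1)) (?q t) (velocity x t, acceleration x t)) (at t)"
      by (rule has_vector_derivative_transform_within_open[OF _ J t])
        (simp add: partial_def fderiv_case_prod(1)[OF dF])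
    then show ?thesis by (simp add: has_real_derivative_iff_has_vector_derivative)
  qed
  note D = this
  have "euler_lagrange F x t \<longleftrightarrow> (\<forall>i. euler F (x t) (velocity x t) (acceleration x t) (axis i 1) = 0)"
    unfolding euler_lagrange_def
  proof (intro iff_allI)
    fix i
    have p: "partial i (\<lambda>\<xi>. F \<xi> (velocity x t)) (x t) = fderiv (case_prod F) (?q t) (axis i 1, 0)"
      by (simp add: partial_def fderiv_case_prod(2)[OF dF[OF t]])
    show "((\<lambda>s. partial i (\<lambda>y. F (x s) y) (velocity x s))
        has_real_derivative partial i (\<lambda>\<xi>. F \<xi> (velocity x t)) (x t)) (at t)
      \<longleftrightarrow> euler F (x t) (velocity x t) (acceleration x t) (axis i 1) = 0"
      using D[of i] DERIV_unique unfolding p euler_def by force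
  qed
  also have "\<dots> \<longleftrightarrow> (\<forall>w. euler F (x t) (velocity x t) (acceleration x t) w = 0)"
  proof safe
    fix w
    assume "\<forall>i. euler F (x t) (velocity x t) (acceleration x t) (axis i 1) = 0"
    then show "euler F (x t) (velocity x t) (acceleration x t) w = 0"
      using linear_axis_expansion[OF linear_euler[OF X F], of "x t" "velocity x t" "acceleration x t" w] xX[OF t] by simp
  qed auto
  finally show ?thesis .
qed

section \<open>Pullback along immersions\<close>

text \<open>In coordinates, a change of charts and the parametrization of a hypersurface are both immersions. One
computation therefore gives the invariance of geodesics under changes of charts and the fact that an ambient
geodesic lying in a hypersurface is a geodesic of the induced metric.\<close>

definition immersion_on :: "(real^'k) set \<Rightarrow> (real^'n) set \<Rightarrow> (real^'k \<Rightarrow> real^'n) \<Rightarrow> bool" where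
  "immersion_on U X f \<longleftrightarrow> open U \<and> open X \<and> smooth_on U f \<and> f ` U \<subseteq> X \<and>
     (\<forall>u\<in>U. \<forall>v. v \<noteq> 0 \<longrightarrow> fderiv f u v \<noteq> 0)"

text \<open>\<open>G\<close> is the Lagrangian induced from \<open>F\<close> by \<open>f\<close>. Nothing is said about \<open>G u 0\<close>, since homogeneous
Lagrangians are considered only outside the zero section.\<close>

definition pulls_back :: "(real^'k) set \<Rightarrow> (real^'k \<Rightarrow> real^'n) \<Rightarrow> (real^'n \<Rightarrow> real^'n \<Rightarrow> real)
    \<Rightarrow> (real^'k \<Rightarrow> real^'k \<Rightarrow> real) \<Rightarrow> bool" where
  "pulls_back U f F G \<longleftrightarrow> (\<forall>u\<in>U. \<forall>v. v \<noteq> 0 \<longrightarrow> G u v = F (f u) (fderiv f u v))"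

lemma tangent_map_derivative:
  fixes f :: "real^'k \<Rightarrow> real^'n"
  assumes "open U" "smooth_on U f" "u \<in> U"
  shows "((\<lambda>q. (f (fst q), fderiv f (fst q) (snd q))) has_derivative
    (\<lambda>h. (fderiv f u (fst h), fderiv (\<lambda>p. fderiv f p v) u (fst h) + fderiv f u (snd h)))) (at (u, v))"
proof -
  have fst: "(fst has_derivative fst) (at (u, v))" and snd: "(snd has_derivative snd) (at (u, v))"
    by (rule bounded_linear_imp_has_derivative bounded_linear_fst bounded_linear_snd)+
  have "((\<lambda>q. f (fst q)) has_derivative (\<lambda>h. fderiv f u (fst h))) (at (u, v))"
    by (rule has_derivative_compose[OF fst]) (simp add: smooth_on_has_derivative[OF assms(2,3)])
  moreover have "((\<lambda>q. fderiv f (fst q) (snd q)) has_derivative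
      (\<lambda>h. fderiv (\<lambda>p. fderiv f p (snd (u, v))) (fst (u, v)) (fst h) + fderiv f (fst (u, v)) (snd h))) (at (u, v))"
    by (rule has_derivative_fderiv_apply[OF assms(1,2) _ fst snd]) (use assms(3) in simp)
  ultimately show ?thesis using has_derivative_Pair by fastforce
qed

lemma pullback_smooth:
  assumes f: "immersion_on U X f" and F: "smooth_on (slit X) (case_prod F)" and G: "pulls_back U f F G"
  shows "smooth_on (slit U) (case_prod G)"
proof -
  have U: "open U" "open X" "smooth_on U f" using f by (auto simp: immersion_on_def)
  have fs: "smooth_on (slit U) (\<lambda>q. f (fst q))"
    by (rule smooth_on_compose[OF open_slit[OF U(1)] U(1,3) smooth_on_fst[OF open_slit[OF U(1)]]]) auto
  have "smooth_on (slit U) (\<lambda>q. case_prod F (f (fst q), fderiv f (fst q) (snd q)))"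
  proof (rule smooth_on_compose[OF open_slit[OF U(1)] open_slit[OF U(2)] F])
    show "smooth_on (slit U) (\<lambda>q. (f (fst q), fderiv f (fst q) (snd q)))"
      by (intro smooth_on_Pair[OF open_slit[OF U(1)] fs] smooth_on_fderiv_apply[OF open_slit[OF U(1)] U(1,3)]
        smooth_on_fst smooth_on_snd open_slit[OF U(1)]) auto
    show "(\<lambda>q. (f (fst q), fderiv f (fst q) (snd q))) ` slit U \<subseteq> slit X"
      using f by (auto simp: immersion_on_def)
  qed
  then show ?thesis
    by (rule smooth_on_cong[OF open_slit[OF U(1)], rotated]) (use G in \<open>fastforce simp: pulls_back_def\<close>)
qed

lemma pullback_fderiv:
  assumes f: "immersion_on U X f" and F: "smooth_on (slit X) (case_prod F)" and G: "pulls_back U f F G"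
    and u: "u \<in> U" and v: "v \<noteq> 0"
  shows "fderiv (case_prod G) (u, v) (w, b) = fderiv (case_prod F) (f u, fderiv f u v)
    (fderiv f u w, fderiv (\<lambda>p. fderiv f p v) u w + fderiv f u b)"
proof -
  have U: "open U" "open X" "smooth_on U f" using f by (auto simp: immersion_on_def)
  have mem: "(f u, fderiv f u v) \<in> slit X" using f u v by (auto simp: immersion_on_def)
  have "((\<lambda>q. case_prod F (f (fst q), fderiv f (fst q) (snd q))) has_derivative
    (\<lambda>h. fderiv (case_prod F) (f u, fderiv f u v) (fderiv f u (fst h), fderiv (\<lambda>p. fderiv f p v) u (fst h) + fderiv f u (snd h)))) (at (u, v))"
    by (rule has_derivative_compose[OF tangent_map_derivative[OF U(1,3) u]])
      (use smooth_on_has_derivative[OF F mem] in simp)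
  then have "(case_prod G has_derivative
    (\<lambda>h. fderiv (case_prod F) (f u, fderiv f u v) (fderiv f u (fst h), fderiv (\<lambda>p. fderiv f p v) u (fst h) + fderiv f u (snd h)))) (at (u, v))"
    by (rule has_derivative_transform_within_open[OF _ open_slit[OF U(1)]]) 
      (use G u v in \<open>fastforce simp: pulls_back_def\<close>)+
  from fderiv_eq[OF this] show ?thesis by simp
qed

lemma pullback_fderiv_vertical:
  assumes f: "immersion_on U X f" and F: "smooth_on (slit X) (case_prod F)" and G: "pulls_back U f F G"
    and u: "u \<in> U" and v: "v \<noteq> 0"
  shows "fderiv (\<lambda>q. fderiv (case_prod G) q (0, w)) (u, v) (b, a) =
    fderiv (\<lambda>q. fderiv (case_prod F) q (0, fderiv f u w)) (f u, fderiv f u v)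
       (fderiv f u b, fderiv (\<lambda>p. fderiv f p v) u b + fderiv f u a)
    + fderiv (case_prod F) (f u, fderiv f u v) (0, fderiv (\<lambda>p. fderiv f p w) u b)"
proof -
  have U: "open U" "open X" "smooth_on U f" using f by (auto simp: immersion_on_def)
  have mem: "(f u, fderiv f u v) \<in> slit X" using f u v by (auto simp: immersion_on_def)
  have lin: "linear (fderiv (\<lambda>p. fderiv f p v) u)" if "u \<in> U" for u v
    using linear_fderiv[OF smooth_on_differentiable[OF smooth_on_fderiv[OF U(3)] that]] .
  let ?\<Phi> = "\<lambda>q. (f (fst q), fderiv f (fst q) (snd q))"
  have c: "((\<lambda>q. (0, fderiv f (fst q) w)) has_derivative (\<lambda>h. (0, fderiv (\<lambda>p. fderiv f p w) u (fst h)))) (at (u, v))"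
    by (intro has_derivative_Pair has_derivative_const
        has_derivative_compose[OF bounded_linear_imp_has_derivative[OF bounded_linear_fst]])
      (simp add: smooth_on_has_derivative[OF smooth_on_fderiv[OF U(3)] u])
  have "((\<lambda>q. fderiv (case_prod F) (?\<Phi> q) (0, fderiv f (fst q) w)) has_derivative
    (\<lambda>h. fderiv (\<lambda>p. fderiv (case_prod F) p (0, fderiv f (fst (u, v)) w)) (?\<Phi> (u, v))
        (fderiv f u (fst h), fderiv (\<lambda>p. fderiv f p v) u (fst h) + fderiv f u (snd h))
      + fderiv (case_prod F) (?\<Phi> (u, v)) (0, fderiv (\<lambda>p. fderiv f p w) u (fst h)))) (at (u, v))"
    by (rule has_derivative_fderiv_apply[OF open_slit[OF U(2)] F _ tangent_map_derivative[OF U(1,3) u] c])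
      (use mem in simp)
  then have "((\<lambda>q. fderiv (case_prod G) q (0, w)) has_derivative
    (\<lambda>h. fderiv (\<lambda>p. fderiv (case_prod F) p (0, fderiv f (fst (u, v)) w)) (?\<Phi> (u, v))
        (fderiv f u (fst h), fderiv (\<lambda>p. fderiv f p v) u (fst h) + fderiv f u (snd h))
      + fderiv (case_prod F) (?\<Phi> (u, v)) (0, fderiv (\<lambda>p. fderiv f p w) u (fst h)))) (at (u, v))"
  proof (rule has_derivative_transform_within_open[OF _ open_slit[OF U(1)]])
    fix q assume "q \<in> slit U"
    then obtain x y where q: "q = (x, y)" "x \<in> U" "y \<noteq> 0" by auto
    have "linear (fderiv f x)"
      using linear_fderiv[OF smooth_on_differentiable[OF U(3) q(2)]] .
    then show "fderiv (case_prod F) (?\<Phi> q) (0, fderiv f (fst q) w) = fderiv (case_prod G) q (0, w)"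
      using pullback_fderiv[OF f F G q(2,3), of 0 w] lin[OF q(2), of y] by (simp add: linear_0 q(1))
  qed (use u v in auto)
  from fderiv_eq[OF this] show ?thesis by simp
qed

text \<open>Naturality of the Euler-Lagrange expression. Moving \<open>u\<close> in the direction \<open>w\<close> changes the induced velocity
by the second derivative of \<open>f\<close> at \<open>(v, w)\<close>, and the time derivative of the direction \<open>fderiv f u w\<close> is
the same term with \<open>v\<close> and \<open>w\<close> interchanged. By symmetry the two contributions cancel.\<close>

lemma euler_pullback:
  assumes f: "immersion_on U X f" and F: "smooth_on (slit X) (case_prod F)" and G: "pulls_back U f F G"
    and u: "u \<in> U" and v: "v \<noteq> 0"
  shows "euler G u v a w = euler F (f u) (fderiv f u v)
    (fderiv (\<lambda>p. fderiv f p v) u v + fderiv f u a) (fderiv f u w)"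
proof -
  have U: "open U" "open X" "smooth_on U f" using f by (auto simp: immersion_on_def)
  have mem: "(f u, fderiv f u v) \<in> slit X" using f u v by (auto simp: immersion_on_def)
  have l0: "fderiv f u 0 = 0"
    using linear_0[OF linear_fderiv[OF smooth_on_differentiable[OF U(3) u]]] .
  have lF: "linear (fderiv (case_prod F) (f u, fderiv f u v))"
    using linear_fderiv[OF smooth_on_differentiable[OF F mem]] .
  have "fderiv (case_prod F) (f u, fderiv f u v) (fderiv f u w, fderiv (\<lambda>p. fderiv f p v) u w)
    = fderiv (case_prod F) (f u, fderiv f u v) (fderiv f u w, 0) + fderiv (case_prod F) (f u, fderiv f u v) (0, fderiv (\<lambda>p. fderiv f p v) u w)"
    by (simp add: linear_add[OF lF, symmetric])
  then show ?thesis
    unfolding euler_def pullback_fderiv[OF f F G u v] pullback_fderiv_vertical[OF f F G u v]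
    using fderiv_commute[OF U(1,3) u, of w v] by (simp add: l0)
qed

text \<open>A variation inside the source of an immersion is in particular a variation in the target, hence the
Euler-Lagrange equations of \<open>F\<close> imply those of the induced Lagrangian.\<close>

lemma euler_lagrange_pullback:
  assumes f: "immersion_on U X f" and F: "smooth_on (slit X) (case_prod F)" and G: "pulls_back U f F G"
    and J: "open J" and u: "smooth_on J u" and uU: "\<And>s. s \<in> J \<Longrightarrow> u s \<in> U \<and> velocity u s \<noteq> 0" and t: "t \<in> J"
    and EL: "euler_lagrange F (\<lambda>s. f (u s)) t"
  shows "euler_lagrange G u t"
proof -
  have U: "open U" "open X" "smooth_on U f" "f ` U \<subseteq> X" using f by (auto simp: immersion_on_def)
  have im: "u ` J \<subseteq> U" using uU by auto
  have x: "smooth_on J (\<lambda>s. f (u s))" by (rule smooth_on_compose[OF J U(1,3) u im])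
  have "f (u s) \<in> X \<and> velocity (\<lambda>s. f (u s)) s \<noteq> 0" if "s \<in> J" for s
    using f that uU[OF that] velocity_compose[OF U(1,3) J u im that] by (auto simp: immersion_on_def)
  then have *: "euler F (f (u t)) (velocity (\<lambda>s. f (u s)) t) (acceleration (\<lambda>s. f (u s)) t) w = 0" for w
    using euler_lagrange_iff[OF U(2) F J x _ t] EL by blast
  have "euler G (u t) (velocity u t) (acceleration u t) w = 0" for w
    using euler_pullback[OF f F G, of "u t" "velocity u t"] uU[OF t] *
    by (simp add: velocity_compose[OF U(1,3) J u im t] acceleration_compose[OF U(1,3) J u im t])
  then show ?thesis
    using euler_lagrange_iff[OF U(1) pullback_smooth[OF f F G] J u uU t] by blast
qed

section \<open>Local Finsler metrics\<close>

definition finsler_on :: "(real^'n) set \<Rightarrow> (real^'n \<Rightarrow> real^'n \<Rightarrow> real) \<Rightarrow> bool" where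
  "finsler_on X F \<longleftrightarrow> smooth_on (slit X) (case_prod F) \<and>
     (\<forall>x\<in>X. \<forall>y. y \<noteq> 0 \<longrightarrow> F x y > 0 \<and> (\<forall>r>0. F x (r *\<^sub>R y) = r * F x y) \<and>
        (\<forall>z. z \<noteq> 0 \<longrightarrow> (\<Sum>i\<in>UNIV. \<Sum>j\<in>UNIV. fundamental_tensor F x y $ i $ j * z $ i * z $ j) > 0))"

text \<open>The second derivative of \<open>F x\<close> at \<open>y\<close>, first in the direction \<open>w\<close> and then in the direction \<open>a\<close>. It is
written with the uncurried \<open>F\<close> because it is the part of \<open>euler\<close> that depends on the acceleration.\<close>

definition vhess :: "(real^'n \<Rightarrow> real^'n \<Rightarrow> real) \<Rightarrow> real^'n \<Rightarrow> real^'n \<Rightarrow> real^'n \<Rightarrow> real^'n \<Rightarrow> real" where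
  "vhess F x y a w = fderiv (\<lambda>q. fderiv (case_prod F) q (0, w)) (x, y) (0, a)"

lemma linear_Pair_right: "linear (\<lambda>w. (0, w))"
  by (auto intro!: linearI)

context
  fixes X :: "(real^'n) set" and F :: "real^'n \<Rightarrow> real^'n \<Rightarrow> real" and x y :: "real^'n"
  assumes X: "open X" and sm: "smooth_on (slit X) (case_prod F)" and x: "x \<in> X" and y: "y \<noteq> 0"
begin

lemma slit_mem: "(x, y) \<in> slit X" using x y by simp

lemma linear_vertical: "linear (\<lambda>w. fderiv (case_prod F) (x, y) (0, w))"
  using linear_compose[OF linear_Pair_right linear_fderiv[OF smooth_on_differentiable[OF sm slit_mem]]]
  by (simp add: o_def)

lemma linear_vhess_left: "linear (\<lambda>a. vhess F x y a w)"
  unfolding vhess_def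
  using linear_compose[OF linear_Pair_right linear_fderiv[OF smooth_on_differentiable[OF smooth_on_fderiv[OF sm] slit_mem]]]
  by (simp add: o_def)

lemma linear_vhess_right: "linear (\<lambda>w. vhess F x y a w)"
  unfolding vhess_def
  using linear_compose[OF linear_Pair_right linear_fderiv_fderiv[OF open_slit[OF X] sm slit_mem]]
  by (simp add: o_def)

lemma euler_vhess: "euler F x y a w = euler F x y 0 w + vhess F x y a w"
proof -
  have "linear (fderiv (\<lambda>q. fderiv (case_prod F) q (0, w)) (x, y))"
    using linear_fderiv[OF smooth_on_differentiable[OF smooth_on_fderiv[OF sm] slit_mem]] .
  from linear_add[OF this, of "(y, 0)" "(0, a)"] show ?thesis
    by (simp add: euler_def vhess_def)
qed

text \<open>The product rule for half the second derivative of the square of \<open>F\<close>. It converts positive definiteness of the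
fundamental tensor into information on the degenerate vertical Hessian of \<open>F\<close> itself.\<close>

lemma fundamental_tensor_eq:
  "fundamental_tensor F x y $ i $ j = F x y * vhess F x y (axis i 1) (axis j 1)
    + fderiv (case_prod F) (x, y) (0, axis i 1) * fderiv (case_prod F) (x, y) (0, axis j 1)"
proof -
  let ?D = "\<lambda>y. fderiv (case_prod F) (x, y)"
  have F1: "((\<lambda>y. F x y) has_derivative (\<lambda>h. ?D y (0, h))) (at y)" if "y \<noteq> 0" for y
  proof -
    have "(x, y) \<in> slit X" using x that by simp
    from has_derivative_compose[OF has_derivative_Pair[OF has_derivative_const has_derivative_ident]
        smooth_on_has_derivative[OF sm this]]
    show ?thesis by simp
  qed
  have D: "((\<lambda>y. ?D y (0, w)) has_derivative (\<lambda>a. vhess F x y a w)) (at y)" for w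
    using has_derivative_compose[OF has_derivative_Pair[OF has_derivative_const has_derivative_ident]
        smooth_on_has_derivative[OF smooth_on_fderiv[OF sm] slit_mem]]
    by (simp add: vhess_def)
  have 1: "partial j (\<lambda>y. (F x y)\<^sup>2) y = 2 * F x y * ?D y (0, axis j 1)" if "y \<noteq> 0" for y
  proof -
    have "((\<lambda>y. (F x y)\<^sup>2) has_derivative (\<lambda>h. 2 * F x y * ?D y (0, h))) (at y)"
      by (rule derivative_eq_intros F1[OF that])+ (auto simp: algebra_simps)
    from fderiv_eq[OF this] show ?thesis by (simp add: partial_def)
  qed
  have "((\<lambda>y. 2 * F x y * ?D y (0, axis j 1)) has_derivative
     (\<lambda>h. 2 * F x y * vhess F x y h (axis j 1) + 2 * ?D y (0, h) * ?D y (0, axis j 1))) (at y)"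
    by (rule has_derivative_eq_rhs[OF has_derivative_mult[OF has_derivative_mult_right[OF F1[OF y]] D]])
      (auto simp: algebra_simps)
  then have "((\<lambda>y. partial j (\<lambda>y. (F x y)\<^sup>2) y) has_derivative
     (\<lambda>h. 2 * F x y * vhess F x y h (axis j 1) + 2 * ?D y (0, h) * ?D y (0, axis j 1))) (at y)"
    by (rule has_derivative_transform_within_open[where s = "- {0}"]) (use y in \<open>auto simp: 1\<close>)
  from fderiv_eq[OF this]
  have "partial i (\<lambda>y. partial j (\<lambda>y. (F x y)\<^sup>2) y) y =
     2 * F x y * vhess F x y (axis i 1) (axis j 1) + 2 * ?D y (0, axis i 1) * ?D y (0, axis j 1)"
    by (simp add: partial_def)
  then show ?thesis by (simp add: fundamental_tensor_def)
qed

lemma fundamental_tensor_left: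
  "(\<Sum>i\<in>UNIV. fundamental_tensor F x y $ i $ j * a $ i) = F x y * vhess F x y a (axis j 1)
    + fderiv (case_prod F) (x, y) (0, a) * fderiv (case_prod F) (x, y) (0, axis j 1)"
proof -
  let ?V = "\<lambda>w. fderiv (case_prod F) (x, y) (0, w)"
  have "(\<Sum>i\<in>UNIV. fundamental_tensor F x y $ i $ j * a $ i)
     = F x y * (\<Sum>i\<in>UNIV. a $ i *\<^sub>R vhess F x y (axis i 1) (axis j 1)) + (\<Sum>i\<in>UNIV. a $ i *\<^sub>R ?V (axis i 1)) * ?V (axis j 1)"
    by (simp add: fundamental_tensor_eq sum_distrib_left sum_distrib_right sum.distrib algebra_simps)
  then show ?thesis
    by (simp only: linear_axis_expansion[OF linear_vhess_left, of a, symmetric]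
        linear_axis_expansion[OF linear_vertical, of a, symmetric])
qed

lemma fundamental_tensor_quadratic:
  "(\<Sum>i\<in>UNIV. \<Sum>j\<in>UNIV. fundamental_tensor F x y $ i $ j * a $ i * w $ j) = F x y * vhess F x y a w
    + fderiv (case_prod F) (x, y) (0, a) * fderiv (case_prod F) (x, y) (0, w)"
proof -
  let ?V = "\<lambda>w. fderiv (case_prod F) (x, y) (0, w)"
  have "(\<Sum>i\<in>UNIV. \<Sum>j\<in>UNIV. fundamental_tensor F x y $ i $ j * a $ i * w $ j)
    = (\<Sum>j\<in>UNIV. (\<Sum>i\<in>UNIV. fundamental_tensor F x y $ i $ j * a $ i) * w $ j)"
    by (subst sum.swap) (simp add: sum_distrib_right)
  also have "\<dots> = F x y * (\<Sum>j\<in>UNIV. w $ j *\<^sub>R vhess F x y a (axis j 1)) + ?V a * (\<Sum>j\<in>UNIV. w $ j *\<^sub>R ?V (axis j 1))"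
    unfolding fundamental_tensor_left by (simp add: sum_distrib_left sum.distrib algebra_simps)
  finally show ?thesis
    by (simp only: linear_axis_expansion[OF linear_vhess_right, of a w, symmetric]
        linear_axis_expansion[OF linear_vertical, of w, symmetric])
qed

end

context
  fixes X :: "(real^'n) set" and F :: "real^'n \<Rightarrow> real^'n \<Rightarrow> real"
  assumes X: "open X" and F: "finsler_on X F"
begin

lemma finsler_smooth: "smooth_on (slit X) (case_prod F)"
  using F by (simp add: finsler_on_def)

text \<open>Euler's relation for functions that are homogeneous of degree one.\<close>

lemma finsler_homogeneous_fderiv:
  assumes x: "x \<in> X" and y: "y \<noteq> 0"
  shows "fderiv (case_prod F) (x, y) (0, y) = F x y"
proof -
  have mem: "(x, y) \<in> slit X" using x y by simp
  have "((\<lambda>r. (x, r *\<^sub>R y)) has_derivative (\<lambda>h. (0, h *\<^sub>R y))) (at 1)"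
    by (auto intro!: derivative_eq_intros)
  from has_derivative_compose[OF this, of "case_prod F"] smooth_on_has_derivative[OF finsler_smooth mem]
  have "((\<lambda>r. F x (r *\<^sub>R y)) has_derivative (\<lambda>h. fderiv (case_prod F) (x, y) (0, h *\<^sub>R y))) (at 1)"
    by simp
  then have "((\<lambda>r. r * F x y) has_derivative (\<lambda>h. fderiv (case_prod F) (x, y) (0, h *\<^sub>R y))) (at (1::real))"
    by (rule has_derivative_transform_within_open[where s = "{0<..}"])
      (use F x y in \<open>auto simp: finsler_on_def\<close>)
  moreover have "((\<lambda>r. r * F x y) has_derivative (\<lambda>h. h * F x y)) (at (1::real))"
    by (auto intro!: derivative_eq_intros)
  ultimately have "(\<lambda>h. fderiv (case_prod F) (x, y) (0, h *\<^sub>R y)) = (\<lambda>h. h * F x y)"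
    by (rule has_derivative_unique)
  from fun_cong[OF this, of 1] show ?thesis by simp
qed

text \<open>Differentiating Euler's relation in the direction \<open>(b, a)\<close>: the terms in \<open>a\<close> cancel. With \<open>b = 0\<close> this says that
the vertical Hessian annihilates the radial direction, with \<open>b = y\<close> that the Euler-Lagrange expression does. The
latter reflects invariance under reparametrization.\<close>

lemma finsler_differentiated_homogeneity:
  assumes x: "x \<in> X" and y: "y \<noteq> 0"
  shows "fderiv (\<lambda>q. fderiv (case_prod F) q (0, y)) (x, y) (b, a) = fderiv (case_prod F) (x, y) (b, 0)"
proof -
  have mem: "(x, y) \<in> slit X" using x y by simp
  have lin: "linear (fderiv (case_prod F) (x, y))"
    using linear_fderiv[OF smooth_on_differentiable[OF finsler_smooth mem]] .
  have c: "((\<lambda>q::(real^'n) \<times> (real^'n). (0::real^'n, snd q)) has_derivative (\<lambda>h. (0, snd h))) (at (x, y))"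
    by (intro has_derivative_Pair has_derivative_const bounded_linear_imp_has_derivative[OF bounded_linear_snd])
  have "((\<lambda>q. fderiv (case_prod F) q (0, snd q)) has_derivative
     (\<lambda>h. fderiv (\<lambda>p. fderiv (case_prod F) p (0, snd (x, y))) (x, y) h + fderiv (case_prod F) (x, y) (0, snd h))) (at (x, y))"
    by (rule has_derivative_fderiv_apply[OF open_slit[OF X] finsler_smooth mem has_derivative_ident c])
  then have "(case_prod F has_derivative
     (\<lambda>h. fderiv (\<lambda>p. fderiv (case_prod F) p (0, snd (x, y))) (x, y) h + fderiv (case_prod F) (x, y) (0, snd h))) (at (x, y))"
  proof (rule has_derivative_transform_within_open[OF _ open_slit[OF X] mem])
    fix q assume "q \<in> slit X"
    then show "fderiv (case_prod F) q (0, snd q) = case_prod F q"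
      using finsler_homogeneous_fderiv[of "fst q" "snd q"] by (cases q) simp
  qed
  from fun_cong[OF fderiv_eq[OF this], of "(b, a)"] linear_add[OF lin, of "(b, 0)" "(0, a)"]
  show ?thesis by simp
qed

lemma finsler_vhess_right_radial: "x \<in> X \<Longrightarrow> y \<noteq> 0 \<Longrightarrow> vhess F x y a y = 0"
  unfolding vhess_def using finsler_differentiated_homogeneity[of x y 0 a]
    linear_0[OF linear_fderiv[OF smooth_on_differentiable[OF finsler_smooth]], of "(x, y)"] 
  by (simp add: zero_prod_def)

lemma finsler_euler_radial: "x \<in> X \<Longrightarrow> y \<noteq> 0 \<Longrightarrow> euler F x y a y = 0"
  unfolding euler_def using finsler_differentiated_homogeneity[of x y y a] by simp

text \<open>The derivative of \<open>F\<close> in a fixed fibre direction is homogeneous of degree zero, so it is constant along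
rays.\<close>

lemma finsler_vhess_left_radial:
  assumes x: "x \<in> X" and y: "y \<noteq> 0"
  shows "vhess F x y y w = 0"
proof -
  have sm: "smooth_on (slit X) (case_prod F)" by (rule finsler_smooth)
  have mem: "(x, y) \<in> slit X" using x y by simp
  have zero: "fderiv (case_prod F) (x, r *\<^sub>R y) (0, w) = fderiv (case_prod F) (x, y) (0, w)" if r: "r > 0" for r
  proof -
    have memr: "(x, r *\<^sub>R y) \<in> slit X" using x y r by simp
    have "((\<lambda>y. (x, r *\<^sub>R y)) has_derivative (\<lambda>h. (0, r *\<^sub>R h))) (at y)"
      by (auto intro!: derivative_eq_intros)
    from has_derivative_compose[OF this, of "case_prod F"] smooth_on_has_derivative[OF sm memr]
    have 1: "((\<lambda>y. F x (r *\<^sub>R y)) has_derivative (\<lambda>h. fderiv (case_prod F) (x, r *\<^sub>R y) (0, r *\<^sub>R h))) (at y)"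
      by simp
    have "((\<lambda>y. (x, y)) has_derivative (\<lambda>h. (0, h))) (at y)"
      by (auto intro!: derivative_eq_intros)
    from has_derivative_compose[OF this, of "case_prod F"] smooth_on_has_derivative[OF sm mem]
    have "((\<lambda>y. F x y) has_derivative (\<lambda>h. fderiv (case_prod F) (x, y) (0, h))) (at y)" by simp
    then have "((\<lambda>y. r * F x y) has_derivative (\<lambda>h. r * fderiv (case_prod F) (x, y) (0, h))) (at y)"
      by (rule has_derivative_mult_right)
    then have 2: "((\<lambda>y. F x (r *\<^sub>R y)) has_derivative (\<lambda>h. r * fderiv (case_prod F) (x, y) (0, h))) (at y)"
      by (rule has_derivative_transform_within_open[where s = "- {0}"])
        (use F x y r in \<open>auto simp: finsler_on_def\<close>)
    have "linear (fderiv (case_prod F) (x, r *\<^sub>R y))"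
      using linear_fderiv[OF smooth_on_differentiable[OF sm memr]] .
    from linear_cmul[OF this, of r "(0, w)"] fun_cong[OF has_derivative_unique[OF 1 2], of w] r
    show ?thesis by simp
  qed
  have "((\<lambda>r. (x, r *\<^sub>R y)) has_derivative (\<lambda>h. (0, h *\<^sub>R y))) (at 1)"
    by (auto intro!: derivative_eq_intros)
  from has_derivative_compose[OF this, of "\<lambda>q. fderiv (case_prod F) q (0, w)"]
    smooth_on_has_derivative[OF smooth_on_fderiv[OF sm] mem]
  have "((\<lambda>r. fderiv (case_prod F) (x, r *\<^sub>R y) (0, w)) has_derivative (\<lambda>h. vhess F x y (h *\<^sub>R y) w)) (at 1)"
    by (simp add: vhess_def)
  then have "((\<lambda>r. fderiv (case_prod F) (x, y) (0, w)) has_derivative (\<lambda>h. vhess F x y (h *\<^sub>R y) w)) (at (1::real))"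
    by (rule has_derivative_transform_within_open[where s = "{0<..}"]) (auto simp: zero)
  from has_derivative_unique[OF this has_derivative_const]
  have "(\<lambda>h. vhess F x y (h *\<^sub>R y) w) = (\<lambda>h. 0)" .
  from fun_cong[OF this, of 1] show ?thesis by simp
qed

lemma finsler_positive: "x \<in> X \<Longrightarrow> y \<noteq> 0 \<Longrightarrow> F x y > 0"
  using F by (simp add: finsler_on_def)

lemma finsler_positive_definite:
  assumes "x \<in> X" "y \<noteq> 0" "a \<noteq> 0"
  shows "F x y * vhess F x y a a + (fderiv (case_prod F) (x, y) (0, a))\<^sup>2 > 0"
proof -
  have "(\<Sum>i\<in>UNIV. \<Sum>j\<in>UNIV. fundamental_tensor F x y $ i $ j * a $ i * a $ j) > 0"
    using F assms unfolding finsler_on_def by blast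
  then show ?thesis
    unfolding fundamental_tensor_quadratic[OF X finsler_smooth assms(1,2)] by (simp add: power2_eq_square)
qed

text \<open>A vector in the kernel may be corrected by a multiple of \<open>y\<close> so that \<open>F\<close> has no first order change along it.
On such a vector the fundamental tensor is \<open>F\<close> times the vertical Hessian, so it vanishes by
positive definiteness.\<close>

lemma finsler_vhess_kernel:
  assumes x: "x \<in> X" and y: "y \<noteq> 0"
  shows "(\<forall>w. vhess F x y a w = 0) \<longleftrightarrow> (\<exists>r. a = r *\<^sub>R y)"
proof
  assume a: "\<forall>w. vhess F x y a w = 0"
  let ?V = "\<lambda>w. fderiv (case_prod F) (x, y) (0, w)"
  let ?l = "?V a / F x y"
  let ?b = "a - ?l *\<^sub>R y"
  note lin = linear_vhess_left[OF X finsler_smooth x y] linear_vertical[OF X finsler_smooth x y]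
  have "?V ?b = 0"
    using finsler_homogeneous_fderiv[OF x y] finsler_positive[OF x y] linear_diff[OF lin(2)] linear_cmul[OF lin(2)]
    by simp
  moreover have "vhess F x y ?b w = 0" for w
    using a finsler_vhess_left_radial[OF x y] linear_diff[OF lin(1)] linear_cmul[OF lin(1)] by simp
  ultimately have "?b = 0" using finsler_positive_definite[OF x y, of ?b] by force
  then show "\<exists>r. a = r *\<^sub>R y" by auto
next
  assume "\<exists>r. a = r *\<^sub>R y"
  then show "\<forall>w. vhess F x y a w = 0"
    using finsler_vhess_left_radial[OF x y] linear_cmul[OF linear_vhess_left[OF X finsler_smooth x y]] by auto
qed

text \<open>The acceleration enters the Euler-Lagrange expression only through the vertical Hessian. If straight lines with
constant speed satisfy the equations, then the remaining solutions are their reparametrizations.\<close>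

lemma euler_straight_iff:
  assumes x: "x \<in> X" and y: "y \<noteq> 0" and straight: "\<And>w. euler F x y 0 w = 0"
  shows "(\<forall>w. euler F x y a w = 0) \<longleftrightarrow> (\<exists>r. a = r *\<^sub>R y)"
  unfolding finsler_vhess_kernel[OF x y, symmetric]
  using euler_vhess[OF X finsler_smooth x y, of a] straight by simp

text \<open>The Euler-Lagrange equations do not determine the acceleration, because the vertical Hessian is
degenerate. Replacing it by the invertible fundamental tensor selects one solution \<open>S (x, y)\<close>: testing
with the radial direction shows that \<open>F\<close> has no first order change along \<open>S (x, y)\<close>, and then the two bilinear
forms applied to \<open>S (x, y)\<close> agree up to the factor \<open>F\<close>.\<close>

lemma finsler_spray:
  obtains S where "smooth_on (slit X) S" "\<And>x y w. x \<in> X \<Longrightarrow> y \<noteq> 0 \<Longrightarrow> euler F x y (S (x, y)) w = 0"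
proof -
  let ?U = "slit X"
  note U = open_slit[OF X] and sm = finsler_smooth
  define M where "M q = transpose (fundamental_tensor F (fst q) (snd q))" for q
  define b where "b q = (\<chi> j. - (case_prod F q * euler F (fst q) (snd q) 0 (axis j 1)))" for q
  define S where "S q = matrix_inv (M q) *v b q" for q
  have Ms: "smooth_on ?U (\<lambda>q. M q $ i $ j)" for i j
  proof (rule smooth_on_cong[OF U])
    show "smooth_on ?U (\<lambda>q. case_prod F q * fderiv (\<lambda>p. fderiv (case_prod F) p (0, axis i 1)) q (0, axis j 1)
        + fderiv (case_prod F) q (0, axis j 1) * fderiv (case_prod F) q (0, axis i 1))"
      by (intro smooth_on_add smooth_on_mult smooth_on_fderiv sm U)
  next
    fix q assume "q \<in> ?U"
    then obtain x y where q: "q = (x, y)" "x \<in> X" "y \<noteq> 0" by auto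
    then show "case_prod F q * fderiv (\<lambda>p. fderiv (case_prod F) p (0, axis i 1)) q (0, axis j 1)
        + fderiv (case_prod F) q (0, axis j 1) * fderiv (case_prod F) q (0, axis i 1) = M q $ i $ j"
      by (simp add: M_def transpose_def fundamental_tensor_eq[OF X sm q(2,3)] vhess_def)
  qed
  have bs: "smooth_on ?U (\<lambda>q. b q $ j)" for j
  proof (rule smooth_on_cong[OF U])
    have c: "smooth_on ?U (\<lambda>q. (snd q, 0))"
      by (intro smooth_on_Pair smooth_on_snd smooth_on_const U)
    show "smooth_on ?U (\<lambda>q. - 1 * (case_prod F q * (fderiv (\<lambda>p. fderiv (case_prod F) p (0, axis j 1)) q (snd q, 0)
        + - 1 * fderiv (case_prod F) q (axis j 1, 0))))"
      by (intro smooth_on_add smooth_on_mult smooth_on_const smooth_on_fderiv sm U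
          smooth_on_fderiv_apply[where f = "\<lambda>q. q", OF U U smooth_on_fderiv[OF sm] smooth_on_id[OF U] _ c]) auto
  next
    fix q assume "q \<in> ?U"
    then show "- 1 * (case_prod F q * (fderiv (\<lambda>p. fderiv (case_prod F) p (0, axis j 1)) q (snd q, 0)
        + - 1 * fderiv (case_prod F) q (axis j 1, 0))) = b q $ j"
      by (simp add: b_def euler_def)
  qed
  have Mv: "(M (x, y) *v a) $ j = F x y * vhess F x y a (axis j 1)
    + fderiv (case_prod F) (x, y) (0, a) * fderiv (case_prod F) (x, y) (0, axis j 1)" if "x \<in> X" "y \<noteq> 0" for x y a j
    unfolding fundamental_tensor_left[OF X sm that, symmetric]
    by (simp add: M_def matrix_vector_mult_def transpose_def)
  have inv: "invertible (M (x, y))" if xy: "x \<in> X" "y \<noteq> 0" for x y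
  proof -
    have "a = 0" if a: "M (x, y) *v a = 0" for a
    proof (rule ccontr)
      assume "a \<noteq> 0"
      have "F x y * vhess F x y a w + fderiv (case_prod F) (x, y) (0, a) * fderiv (case_prod F) (x, y) (0, w) = 0" for w
      proof -
        have "linear (\<lambda>w. F x y * vhess F x y a w + fderiv (case_prod F) (x, y) (0, a) * fderiv (case_prod F) (x, y) (0, w))"
          using linear_add[OF linear_vhess_right[OF X sm xy]] linear_cmul[OF linear_vhess_right[OF X sm xy]]
            linear_add[OF linear_vertical[OF X sm xy]] linear_cmul[OF linear_vertical[OF X sm xy]]
          by (intro linearI) (simp_all add: algebra_simps)
        from linear_axis_expansion[OF this, of w] Mv[OF xy, of a] a show ?thesis by simp
      qed
      with finsler_positive_definite[OF xy \<open>a \<noteq> 0\<close>] show False by (simp add: power2_eq_square)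
    qed
    then show ?thesis
      using matrix_left_invertible_ker[of "M (x, y)"] invertible_left_inverse by blast
  qed
  have sol: "M q *v S q = b q" if "q \<in> ?U" for q
  proof -
    have "invertible (M q)" using inv that by auto
    then have "M q ** matrix_inv (M q) = mat 1"
      unfolding invertible_def matrix_inv_def by (rule someI_ex[THEN conjunct1])
    then show ?thesis by (simp add: S_def matrix_vector_mul_assoc)
  qed
  have "smooth_on ?U S"
    by (rule smooth_on_linear_solution[OF U Ms bs _ sol]) (use inv in \<open>auto simp: invertible_det_nz\<close>)
  moreover have "euler F x y (S (x, y)) w = 0" if xy: "x \<in> X" "y \<noteq> 0" for x y w
  proof -
    let ?a = "S (x, y)" and ?V = "\<lambda>w. fderiv (case_prod F) (x, y) (0, w)" and ?E = "euler F x y 0"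
    note lin = linear_vhess_right[OF X sm xy] linear_vertical[OF X sm xy] linear_euler[OF X sm xy]
    have *: "F x y * vhess F x y ?a w + ?V ?a * ?V w + F x y * ?E w = 0" for w
    proof -
      have "linear (\<lambda>w. F x y * vhess F x y ?a w + ?V ?a * ?V w + F x y * ?E w)"
        using linear_add[OF lin(1)] linear_cmul[OF lin(1)] linear_add[OF lin(2)] linear_cmul[OF lin(2)]
          linear_add[OF lin(3)] linear_cmul[OF lin(3)]
        by (intro linearI) (simp_all add: algebra_simps)
      moreover have "F x y * vhess F x y ?a (axis j 1) + ?V ?a * ?V (axis j 1) + F x y * ?E (axis j 1) = 0" for j
        unfolding Mv[OF xy, of ?a, symmetric] using sol[of "(x, y)"] xy by (simp add: b_def)
      ultimately show ?thesis by (subst linear_axis_expansion) simp_all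
    qed
    \<comment> \<open>Both the vertical Hessian and the Euler-Lagrange expression vanish in the radial direction.\<close>
    have "?V ?a * F x y = 0"
      using *[of y] finsler_vhess_right_radial[OF xy] finsler_euler_radial[OF xy] finsler_homogeneous_fderiv[OF xy] by simp
    with finsler_positive[OF xy] have "?V ?a = 0" by simp
    with *[of w] have "F x y * (vhess F x y ?a w + ?E w) = 0" by (simp add: algebra_simps)
    with finsler_positive[OF xy] show ?thesis unfolding euler_vhess[OF X sm xy, of ?a] by simp
  qed
  ultimately show thesis using that by blast
qed

text \<open>Geodesics with prescribed initial position and velocity are integral curves of the first order
system \<open>x' = y\<close>, \<open>y' = S (x, y)\<close>.\<close>

lemma finsler_geodesic_exists:
  assumes x0: "x0 \<in> X" and y0: "y0 \<noteq> 0"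
  obtains e x where "0 < e" "smooth_on {-e<..<e} x" "x 0 = x0" "velocity x 0 = y0"
    "\<And>t. t \<in> {-e<..<e} \<Longrightarrow> x t \<in> X \<and> velocity x t \<noteq> 0 \<and> euler_lagrange F x t"
proof -
  obtain S where S: "smooth_on (slit X) S" "\<And>x y w. x \<in> X \<Longrightarrow> y \<noteq> 0 \<Longrightarrow> euler F x y (S (x, y)) w = 0"
    using finsler_spray by blast
  note U = open_slit[OF X]
  have A: "smooth_on (slit X) (\<lambda>q. (snd q, S q))"
    by (intro smooth_on_Pair smooth_on_snd U S(1))
  obtain e q where q: "0 < e" "q 0 = (x0, y0)"
    "\<And>t. t \<in> {-e<..<e} \<Longrightarrow> q t \<in> slit X \<and> (q has_vector_derivative (snd (q t), S (q t))) (at t)"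
    using ode_local_solution[OF U A, of "(x0, y0)"] x0 y0 by auto
  let ?J = "{-e<..<e}"
  have J: "open ?J" by simp
  have qs: "smooth_on ?J q" by (rule ode_solution_smooth[OF J U A q(3)])
  define x where "x t = fst (q t)" for t
  have xs: "smooth_on ?J x"
    unfolding x_def by (rule smooth_on_bounded_linear[OF J bounded_linear_fst qs])
  have v: "velocity x t = snd (q t)" if "t \<in> ?J" for t
    using bounded_linear.has_vector_derivative[OF bounded_linear_fst conjunct2[OF q(3)[OF that]]]
    unfolding x_def by (intro vector_derivative_at) simp
  have a: "acceleration x t = S (q t)" if t: "t \<in> ?J" for t
  proof -
    have "((\<lambda>s. snd (q s)) has_vector_derivative S (q t)) (at t)"
      using bounded_linear.has_vector_derivative[OF bounded_linear_snd conjunct2[OF q(3)[OF t]]] by simp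
    then have "(velocity x has_vector_derivative S (q t)) (at t)"
      by (rule has_vector_derivative_transform_within_open[OF _ J t]) (simp add: v)
    then show ?thesis by (rule vector_derivative_at)
  qed
  have reg: "x t \<in> X \<and> velocity x t \<noteq> 0" if "t \<in> ?J" for t
    using q(3)[OF that] v[OF that] by (auto simp: x_def)
  have "euler_lagrange F x t" if t: "t \<in> ?J" for t
  proof (rule iffD2[OF euler_lagrange_iff[OF X finsler_smooth J xs reg t]])
    show "\<forall>w. euler F (x t) (velocity x t) (acceleration x t) w = 0"
      unfolding a[OF t] using S(2)[of "x t" "velocity x t"] reg[OF t] v[OF t] by (simp add: x_def)
  qed
  with reg have "\<And>t. t \<in> ?J \<Longrightarrow> x t \<in> X \<and> velocity x t \<noteq> 0 \<and> euler_lagrange F x t" by blast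
  moreover have "x 0 = x0" "velocity x 0 = y0" using v[of 0] q(1,2) by (auto simp: x_def)
  ultimately show thesis using that[OF q(1) xs] by blast
qed

end

text \<open>The first fibre derivative and the vertical Hessian of the induced Lagrangian are restrictions
of those of \<open>F\<close>, because an immersion acts linearly on the fibres. Hence so is the fundamental tensor.\<close>

lemma finsler_pullback:
  assumes f: "immersion_on U X f" and F: "finsler_on X F" and G: "pulls_back U f F G"
  shows "finsler_on U G"
proof -
  have U: "open U" "open X" "smooth_on U f" using f by (auto simp: immersion_on_def)
  have sF: "smooth_on (slit X) (case_prod F)" using F by (simp add: finsler_on_def)
  note sG = pullback_smooth[OF f sF G]
  have main: "G u v > 0 \<and> (\<forall>r>0. G u (r *\<^sub>R v) = r * G u v) \<and>
      (\<forall>z. z \<noteq> 0 \<longrightarrow> (\<Sum>i\<in>UNIV. \<Sum>j\<in>UNIV. fundamental_tensor G u v $ i $ j * z $ i * z $ j) > 0)"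
    if u: "u \<in> U" and v: "v \<noteq> 0" for u v
  proof (intro conjI allI impI)
    have fu: "f u \<in> X" "\<And>v. v \<noteq> 0 \<Longrightarrow> fderiv f u v \<noteq> 0" using f u by (auto simp: immersion_on_def)
    have Guv: "G u v = F (f u) (fderiv f u v)" using G u v by (auto simp: pulls_back_def)
    have lf: "linear (fderiv f u)" using linear_fderiv[OF smooth_on_differentiable[OF U(3) u]] .
    show "G u v > 0" using Guv finsler_positive[OF U(2) F fu(1) fu(2)[OF v]] by simp
    fix r :: real assume r: "r > 0"
    have "G u (r *\<^sub>R v) = F (f u) (r *\<^sub>R fderiv f u v)"
      using G u v r by (auto simp: pulls_back_def linear_cmul[OF lf])
    also have "\<dots> = r * G u v" using F fu(1) fu(2)[OF v] r Guv by (auto simp: finsler_on_def)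
    finally show "G u (r *\<^sub>R v) = r * G u v" .
  next
    fix z :: "real^'a" assume z: "z \<noteq> 0"
    have fu: "f u \<in> X" "\<And>v. v \<noteq> 0 \<Longrightarrow> fderiv f u v \<noteq> 0" using f u by (auto simp: immersion_on_def)
    have Guv: "G u v = F (f u) (fderiv f u v)" using G u v by (auto simp: pulls_back_def)
    have lf: "fderiv f u 0 = 0" using linear_0[OF linear_fderiv[OF smooth_on_differentiable[OF U(3) u]]] .
    have l2: "fderiv (\<lambda>p. fderiv f p v) u 0 = 0" for v
      using linear_0[OF linear_fderiv[OF smooth_on_differentiable[OF smooth_on_fderiv[OF U(3)] u]]] .
    have mem: "(f u, fderiv f u v) \<in> slit X" using fu v by simp
    have lF: "fderiv (case_prod F) (f u, fderiv f u v) (0, 0) = 0"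
      using linear_0[OF linear_fderiv[OF smooth_on_differentiable[OF sF mem]]] by (simp add: zero_prod_def)
    have "vhess G u v z z = vhess F (f u) (fderiv f u v) (fderiv f u z) (fderiv f u z)"
      unfolding vhess_def pullback_fderiv_vertical[OF f sF G u v] by (simp add: lf l2 lF)
    moreover have "fderiv (case_prod G) (u, v) (0, z) = fderiv (case_prod F) (f u, fderiv f u v) (0, fderiv f u z)"
      unfolding pullback_fderiv[OF f sF G u v] by (simp add: lf l2)
    ultimately show "(\<Sum>i\<in>UNIV. \<Sum>j\<in>UNIV. fundamental_tensor G u v $ i $ j * z $ i * z $ j) > 0"
      unfolding fundamental_tensor_quadratic[OF U(1) sG u v] Guv
      using finsler_positive_definite[OF U(2) F fu(1) fu(2)[OF v] fu(2)[OF z]]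
      by (simp add: power2_eq_square)
  qed
  with sG show ?thesis unfolding finsler_on_def by blast
qed

section \<open>Charts and tangent vectors\<close>

lemma chart_coord_point: "is_chart c \<Longrightarrow> x \<in> chart_img c \<Longrightarrow> coord c (point c x) = x"
  and chart_point_mem: "is_chart c \<Longrightarrow> x \<in> chart_img c \<Longrightarrow> point c x \<in> chart_dom c"
  and chart_point_coord: "is_chart c \<Longrightarrow> p \<in> chart_dom c \<Longrightarrow> point c (coord c p) = p"
  by (auto simp: is_chart_def homeomorphism_def)

lemma chart_coord_mem: "p \<in> chart_dom c \<Longrightarrow> coord c p \<in> chart_img c"
  by (simp add: chart_img_def)

lemma chart_image_eq:
  assumes "is_chart c"
  shows "coord c ` (chart_dom c \<inter> Q) = chart_img c \<inter> point c -` Q"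
proof (intro equalityI subsetI)
  fix x assume "x \<in> coord c ` (chart_dom c \<inter> Q)"
  then show "x \<in> chart_img c \<inter> point c -` Q"
    using chart_point_coord[OF assms] by (auto simp: chart_coord_mem)
next
  fix x assume x: "x \<in> chart_img c \<inter> point c -` Q"
  then show "x \<in> coord c ` (chart_dom c \<inter> Q)"
    using chart_coord_point[OF assms] chart_point_mem[OF assms] by (intro image_eqI[of _ _ "point c x"]) auto
qed

lemma chart_image_open:
  assumes "is_chart c" "open Q"
  shows "open (coord c ` (chart_dom c \<inter> Q))"
  unfolding chart_image_eq[OF assms(1)]
  using assms by (intro continuous_open_preimage) (auto simp: is_chart_def homeomorphism_def)

lemma manifold_chart: "smooth_manifold A \<Longrightarrow> c \<in> A \<Longrightarrow> is_chart c"
  by (simp add: smooth_manifold_def)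

lemma manifold_chart_img_open: "smooth_manifold A \<Longrightarrow> c \<in> A \<Longrightarrow> open (chart_img c)"
  by (simp add: smooth_manifold_def is_chart_def)

lemma manifold_chart_dom_open: "smooth_manifold A \<Longrightarrow> c \<in> A \<Longrightarrow> open (chart_dom c)"
  by (simp add: smooth_manifold_def is_chart_def)

lemma manifold_chart_ex:
  assumes "smooth_manifold A"
  obtains c where "c \<in> A" "p \<in> chart_dom c"
  using assms unfolding smooth_manifold_def by blast

lemma smooth_map_id: "smooth_manifold A \<Longrightarrow> smooth_map A A (\<lambda>p. p)"
  unfolding smooth_map_def smooth_manifold_def compatible_def by auto

definition expr_dom :: "('h, 'k) chart \<Rightarrow> ('m, 'n) chart \<Rightarrow> ('h \<Rightarrow> 'm) \<Rightarrow> (real ^ 'k) set" where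
  "expr_dom c d f = coord c ` (chart_dom c \<inter> f -` chart_dom d)"

lemma expr_dom_iff:
  "is_chart c \<Longrightarrow> u \<in> expr_dom c d f \<longleftrightarrow> u \<in> chart_img c \<and> f (point c u) \<in> chart_dom d"
  unfolding expr_dom_def by (simp add: chart_image_eq)

lemma expr_dom_coord: "p \<in> chart_dom c \<Longrightarrow> f p \<in> chart_dom d \<Longrightarrow> coord c p \<in> expr_dom c d f"
  by (auto simp: expr_dom_def)

lemma coord_expr_coord: "is_chart c \<Longrightarrow> p \<in> chart_dom c \<Longrightarrow> coord_expr c d f (coord c p) = coord d (f p)"
  by (simp add: coord_expr_def chart_point_coord)

lemma open_expr_dom:
  assumes "smooth_manifold B" "smooth_manifold A" "smooth_map B A f" "c \<in> B" "d \<in> A"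
  shows "open (expr_dom c d f)"
  unfolding expr_dom_def
proof (rule chart_image_open[OF manifold_chart[OF assms(1,4)]])
  show "open (f -` chart_dom d)"
    using assms(3) manifold_chart_dom_open[OF assms(2,5)] by (auto simp: smooth_map_def intro: open_vimage)
qed

lemma smooth_on_coord_expr:
  "smooth_map B A f \<Longrightarrow> c \<in> B \<Longrightarrow> d \<in> A \<Longrightarrow> smooth_on (expr_dom c d f) (coord_expr c d f)"
  by (simp add: smooth_map_def expr_dom_def)

lemma coord_expr_differentiable:
  assumes "smooth_map B A f" "c \<in> B" "d \<in> A" "p \<in> chart_dom c" "f p \<in> chart_dom d"
  shows "coord_expr c d f differentiable at (coord c p)"
  using smooth_on_differentiable[OF smooth_on_coord_expr[OF assms(1-3)] expr_dom_coord[where f = f, OF assms(4,5)]] .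

lemma jacobian_fderiv:
  fixes f :: "real^'k \<Rightarrow> real^'n"
  assumes "f differentiable at x"
  shows "jacobian f (at x) *v v = fderiv f x v"
  using fderiv_eq[OF iffD1[OF jacobian_works assms]] by simp

lemma coord_expr_image: "is_chart c \<Longrightarrow> coord_expr c d f ` expr_dom c d f \<subseteq> chart_img d"
  by (auto simp: expr_dom_iff coord_expr_def chart_coord_mem)

text \<open>The chain rule for maps of manifolds in coordinates. Applied with an identity on either side it gives the
transformation behaviour under changes of charts.\<close>

lemma fderiv_coord_expr_compose:
  assumes man: "smooth_manifold C" "smooth_manifold B" "smooth_manifold A"
    and g: "smooth_map C B g" and f: "smooth_map B A f"
    and c: "c \<in> C" and b: "b \<in> B" and a: "a \<in> A"
    and p: "p \<in> chart_dom c" "g p \<in> chart_dom b" "f (g p) \<in> chart_dom a"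
  shows "fderiv (coord_expr c a (\<lambda>q. f (g q))) (coord c p) v =
    fderiv (coord_expr b a f) (coord b (g p)) (fderiv (coord_expr c b g) (coord c p) v)"
proof -
  note ch = manifold_chart[OF man(1) c] manifold_chart[OF man(2) b]
  have "((\<lambda>u. coord_expr b a f (coord_expr c b g u)) has_derivative
     (\<lambda>v. fderiv (coord_expr b a f) (coord b (g p)) (fderiv (coord_expr c b g) (coord c p) v))) (at (coord c p))"
    using has_derivative_compose_fderiv[OF coord_expr_differentiable[OF g c b p(1,2)], of "coord_expr b a f"]
      coord_expr_differentiable[OF f b a p(2,3)] by (simp add: coord_expr_coord[OF ch(1) p(1)])
  then have "((\<lambda>u. coord_expr c a (\<lambda>q. f (g q)) u) has_derivative
     (\<lambda>v. fderiv (coord_expr b a f) (coord b (g p)) (fderiv (coord_expr c b g) (coord c p) v))) (at (coord c p))"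
  proof (rule has_derivative_transform_within_open[OF _ open_expr_dom[OF man(1,2) g c b] expr_dom_coord[of p c g b, OF p(1,2)]])
    fix u assume "u \<in> expr_dom c b g"
    then show "coord_expr b a f (coord_expr c b g u) = coord_expr c a (\<lambda>q. f (g q)) u"
      using ch by (auto simp: coord_expr_def expr_dom_iff chart_point_coord)
  qed
  from fderiv_eq[OF this] show ?thesis by simp
qed

lemma fderiv_coord_expr_id:
  assumes man: "smooth_manifold A" and c: "c \<in> A" and p: "p \<in> chart_dom c"
  shows "fderiv (coord_expr c c (\<lambda>q. q)) (coord c p) v = v"
proof -
  have "((\<lambda>u. u) has_derivative (\<lambda>v. v)) (at (coord c p))" by simp
  then have "(coord_expr c c (\<lambda>q. q) has_derivative (\<lambda>v. v)) (at (coord c p))"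
    by (rule has_derivative_transform_within_open[OF _ manifold_chart_img_open[OF man c] chart_coord_mem[OF p]])
      (simp add: coord_expr_def chart_coord_point[OF manifold_chart[OF man c]])
  from fderiv_eq[OF this] show ?thesis by simp
qed

lemma tangent_fderiv:
  assumes "smooth_manifold A" "c \<in> A" "p \<in> chart_dom c"
  shows "tangent A c p y = (\<lambda>d. if d \<in> A \<and> p \<in> chart_dom d
    then fderiv (coord_expr c d (\<lambda>q. q)) (coord c p) y else 0)"
  unfolding tangent_def
  using jacobian_fderiv[OF coord_expr_differentiable[OF smooth_map_id[OF assms(1)] assms(2) _ assms(3)]]
  by (auto simp: fun_eq_iff)

text \<open>The definition of the differential picks some chart; the chain rule removes the choice.\<close>

lemma pushforward_tangent:
  assumes man: "smooth_manifold B" "smooth_manifold A" and f: "smooth_map B A f"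
    and c: "c \<in> B" "p \<in> chart_dom c" and d: "d \<in> A" "f p \<in> chart_dom d"
  shows "pushforward B A f p (tangent B c p v) = tangent A d (f p) (fderiv (coord_expr c d f) (coord c p) v)"
proof
  fix e
  define b where "b = (SOME c. c \<in> B \<and> p \<in> chart_dom c)"
  have b: "b \<in> B" "p \<in> chart_dom b" using someI[of "\<lambda>c. c \<in> B \<and> p \<in> chart_dom c" c] c by (auto simp: b_def)
  note idB = smooth_map_id[OF man(1)] and idA = smooth_map_id[OF man(2)]
  have "jacobian (coord_expr b e f) (at (coord b p)) *v fderiv (coord_expr c b (\<lambda>q. q)) (coord c p) v
    = fderiv (coord_expr d e (\<lambda>q. q)) (coord d (f p)) (fderiv (coord_expr c d f) (coord c p) v)"
    if e: "e \<in> A" "f p \<in> chart_dom e"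
  proof -
    have "jacobian (coord_expr b e f) (at (coord b p)) *v fderiv (coord_expr c b (\<lambda>q. q)) (coord c p) v
      = fderiv (coord_expr b e f) (coord b p) (fderiv (coord_expr c b (\<lambda>q. q)) (coord c p) v)"
      by (rule jacobian_fderiv[OF coord_expr_differentiable[OF f b(1) e(1) b(2) e(2)]])
    also have "\<dots> = fderiv (coord_expr c e f) (coord c p) v"
      using fderiv_coord_expr_compose[OF man(1,1,2) idB f c(1) b(1) e(1) c(2) b(2) e(2)] by simp
    also have "\<dots> = fderiv (coord_expr d e (\<lambda>q. q)) (coord d (f p)) (fderiv (coord_expr c d f) (coord c p) v)"
      using fderiv_coord_expr_compose[OF man(1,2,2) f idA c(1) d(1) e(1) c(2) d(2) e(2)] by simp
    finally show ?thesis .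
  qed
  then show "pushforward B A f p (tangent B c p v) e = tangent A d (f p) (fderiv (coord_expr c d f) (coord c p) v) e"
    unfolding pushforward_def Let_def b_def[symmetric] tangent_fderiv[OF man(1) c] tangent_fderiv[OF man(2) d]
    using b by simp
qed

text \<open>With this formula induced metrics become pullbacks of local Lagrangians, to which the coordinate computations apply.\<close>

lemma loc_induced:
  assumes man: "smooth_manifold B" "smooth_manifold A" and f: "smooth_map B A f"
    and c: "c \<in> B" and d: "d \<in> A" and u: "u \<in> expr_dom c d f"
  shows "loc B (induced B A f L) c u v = loc A L d (coord_expr c d f u) (fderiv (coord_expr c d f) u v)"
proof -
  note ch = manifold_chart[OF man(1) c] manifold_chart[OF man(2) d]
  have p: "point c u \<in> chart_dom c" "f (point c u) \<in> chart_dom d" "u \<in> chart_img c"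
    using u ch by (auto simp: expr_dom_iff chart_point_mem)
  show ?thesis
    using pushforward_tangent[OF man f c p(1) d p(2), of v] ch p
    by (simp add: loc_def induced_def coord_expr_def chart_point_coord chart_coord_point o_def)
qed

lemma loc_change_chart:
  assumes man: "smooth_manifold A" and c: "c \<in> A" and d: "d \<in> A" and u: "u \<in> expr_dom c d (\<lambda>p. p)"
  shows "loc A L c u v = loc A L d (coord_expr c d (\<lambda>p. p) u) (fderiv (coord_expr c d (\<lambda>p. p)) u v)"
proof -
  note ch = manifold_chart[OF man c] manifold_chart[OF man d] and id = smooth_map_id[OF man]
  define p where "p = point c u"
  have p: "p \<in> chart_dom c" "p \<in> chart_dom d" "u \<in> chart_img c" "coord c p = u"
    using u ch by (auto simp: expr_dom_iff chart_point_mem p_def chart_coord_point)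
  have "tangent A c p v = tangent A d p (fderiv (coord_expr c d (\<lambda>p. p)) (coord c p) v)"
    unfolding tangent_fderiv[OF man c p(1)] tangent_fderiv[OF man d p(2)]
    using fderiv_coord_expr_compose[OF man man man id id c d _ p(1,2)] by (auto simp: fun_eq_iff)
  then show ?thesis
    using ch p by (simp add: loc_def p_def[symmetric] coord_expr_def chart_point_coord o_def)
qed

lemma immersion_on_coord_change:
  assumes man: "smooth_manifold A" and c: "c \<in> A" and d: "d \<in> A"
  shows "immersion_on (expr_dom c d (\<lambda>p. p)) (chart_img d) (coord_expr c d (\<lambda>p. p))"
proof -
  note ch = manifold_chart[OF man c] manifold_chart[OF man d] and id = smooth_map_id[OF man]
  have "fderiv (coord_expr c d (\<lambda>p. p)) u v \<noteq> 0" if u: "u \<in> expr_dom c d (\<lambda>p. p)" and v: "v \<noteq> 0" for u v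
  proof
    assume 0: "fderiv (coord_expr c d (\<lambda>p. p)) u v = 0"
    define p where "p = point c u"
    have p: "p \<in> chart_dom c" "p \<in> chart_dom d" "u \<in> chart_img c" "coord c p = u"
      using u ch by (auto simp: expr_dom_iff chart_point_mem p_def chart_coord_point)
    have "v = fderiv (coord_expr d c (\<lambda>p. p)) (coord d p) (fderiv (coord_expr c d (\<lambda>p. p)) u v)"
      using fderiv_coord_expr_compose[OF man man man id id c d c p(1,2,1), of v] fderiv_coord_expr_id[OF man c p(1), of v] p(4) by simp
    also have "\<dots> = 0"
      unfolding 0 by (rule linear_0[OF linear_fderiv[OF coord_expr_differentiable[OF id d c p(2,1)]]])
    finally show False using v by simp
  qed
  then show ?thesis
    unfolding immersion_on_def
    using open_expr_dom[OF man man id c d] manifold_chart_img_open[OF man d] smooth_on_coord_expr[OF id c d]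
      coord_expr_image[OF ch(1)] by blast
qed

lemma immersion_on_hypersurface:
  fixes A :: "('m::{t2_space,second_countable_topology}, 'n::finite) chart set"
    and B :: "('h::{t2_space,second_countable_topology}, 'k::finite) chart set"
  assumes man: "smooth_manifold B" "smooth_manifold A" and h: "hypersurface B A \<iota>"
    and c: "c \<in> B" and d: "d \<in> A"
  shows "immersion_on (expr_dom c d \<iota>) (chart_img d) (coord_expr c d \<iota>)"
proof -
  note ch = manifold_chart[OF man(1) c] manifold_chart[OF man(2) d]
  have sm: "smooth_map B A \<iota>" using h by (simp add: hypersurface_def)
  have "fderiv (coord_expr c d \<iota>) u v \<noteq> 0" if u: "u \<in> expr_dom c d \<iota>" and v: "v \<noteq> 0" for u v
  proof -
    define p where "p = point c u"
    have p: "p \<in> chart_dom c" "\<iota> p \<in> chart_dom d" "u \<in> chart_img c" "coord c p = u"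
      using u ch by (auto simp: expr_dom_iff chart_point_mem p_def chart_coord_point)
    have "rank (jacobian (coord_expr c d \<iota>) (at (coord c p))) = CARD('k)"
      using h c d p unfolding hypersurface_def by blast
    then have "inj ((*v) (jacobian (coord_expr c d \<iota>) (at (coord c p))))"
      by (simp add: full_rank_injective)
    then have "jacobian (coord_expr c d \<iota>) (at (coord c p)) *v v \<noteq> 0"
      using v by (metis injD matrix_vector_mult_0_right)
    then show ?thesis
      using jacobian_fderiv[OF coord_expr_differentiable[OF sm c d p(1,2)], of v] p(4) by simp
  qed
  then show ?thesis
    unfolding immersion_on_def
    using open_expr_dom[OF man sm c d] manifold_chart_img_open[OF man(2) d] smooth_on_coord_expr[OF sm c d]
      coord_expr_image[OF ch(1)] by blast
qed

lemma finsler_finsler_on: "finsler A L \<longleftrightarrow> (\<forall>c\<in>A. finsler_on (chart_img c) (loc A L c))"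
  by (simp add: finsler_def finsler_on_def)

lemma finsler_on_local:
  assumes "\<And>x. x \<in> X \<Longrightarrow> \<exists>X'. open X' \<and> x \<in> X' \<and> finsler_on X' F"
  shows "finsler_on X F"
proof -
  have "\<exists>T. open T \<and> q \<in> T \<and> smooth_on T (case_prod F)" if q: "q \<in> slit X" for q
  proof -
    have "fst q \<in> X" using q by auto
    then obtain X' where "open X'" "fst q \<in> X'" "finsler_on X' F" using assms by blast
    then show ?thesis using q by (intro exI[of _ "slit X'"]) (auto simp: finsler_on_def open_slit mem_Times_iff)
  qed
  then have "smooth_on (slit X) (case_prod F)" by (rule smooth_on_local)
  with assms show ?thesis unfolding finsler_on_def by blast
qed

lemma finsler_induced:
  fixes A :: "('m::{t2_space,second_countable_topology}, 'n::finite) chart set"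
    and B :: "('h::{t2_space,second_countable_topology}, 'k::finite) chart set"
  assumes man: "smooth_manifold B" "smooth_manifold A" and h: "hypersurface B A \<iota>" and L: "finsler A L"
  shows "finsler B (induced B A \<iota> L)"
  unfolding finsler_finsler_on
proof (intro ballI finsler_on_local)
  fix c u assume c: "c \<in> B" and u: "u \<in> chart_img c"
  have sm: "smooth_map B A \<iota>" using h by (simp add: hypersurface_def)
  obtain d where d: "d \<in> A" "\<iota> (point c u) \<in> chart_dom d" using manifold_chart_ex[OF man(2)] .
  have "finsler_on (expr_dom c d \<iota>) (loc B (induced B A \<iota> L) c)"
  proof (rule finsler_pullback[OF immersion_on_hypersurface[OF man h c d(1)]])
    show "finsler_on (chart_img d) (loc A L d)" using L d by (simp add: finsler_finsler_on)
    show "pulls_back (expr_dom c d \<iota>) (coord_expr c d \<iota>) (loc A L d) (loc B (induced B A \<iota> L) c)"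
      using loc_induced[OF man sm c d(1)] by (auto simp: pulls_back_def)
  qed
  then show "\<exists>X'. open X' \<and> u \<in> X' \<and> finsler_on X' (loc B (induced B A \<iota> L) c)"
    using open_expr_dom[OF man sm c d(1)] expr_dom_iff[OF manifold_chart[OF man(1) c]] u d(2) by blast
qed

section \<open>Geodesics in charts\<close>

lemma euler_lagrange_cong_open:
  assumes J: "open J" "t \<in> J" and eq: "\<And>s. s \<in> J \<Longrightarrow> x s = x' s"
  shows "euler_lagrange F x t \<longleftrightarrow> euler_lagrange F x' t"
proof -
  have *: "euler_lagrange F y t" if y: "euler_lagrange F x t" and eq: "\<And>s. s \<in> J \<Longrightarrow> x s = y s" for x y
    unfolding euler_lagrange_def
  proof
    fix i
    have v: "velocity x s = velocity y s" if "s \<in> J" for s using velocity_cong_open[OF J(1) that eq] .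
    have "((\<lambda>s. partial i (\<lambda>y. F (x s) y) (velocity x s))
       has_real_derivative partial i (\<lambda>\<xi>. F \<xi> (velocity x t)) (x t)) (at t)"
      using y by (simp add: euler_lagrange_def)
    then have "((\<lambda>s. partial i (\<lambda>z. F (y s) z) (velocity y s))
       has_real_derivative partial i (\<lambda>\<xi>. F \<xi> (velocity x t)) (x t)) (at t)"
      by (rule has_field_derivative_transform_within_open[OF _ J]) (simp add: eq v)
    then show "((\<lambda>s. partial i (\<lambda>z. F (y s) z) (velocity y s))
       has_real_derivative partial i (\<lambda>\<xi>. F \<xi> (velocity y t)) (y t)) (at t)"
      by (simp add: eq[OF J(2)] v[OF J(2)])
  qed
  show ?thesis using *[of x x'] *[of x' x] eq by metis
qed

definition regular_at :: "('m, 'n::finite) chart \<Rightarrow> (real \<Rightarrow> 'm) \<Rightarrow> real set \<Rightarrow> bool" where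
  "regular_at c \<gamma> J \<longleftrightarrow> open J \<and> \<gamma> ` J \<subseteq> chart_dom c \<and> smooth_on J (coord c \<circ> \<gamma>) \<and>
     (\<forall>s\<in>J. velocity (coord c \<circ> \<gamma>) s \<noteq> 0)"

text \<open>The conditions for a geodesic at one time and in one chart. They are independent of the chart, so each time may be
treated in a chart adapted to the problem.\<close>

definition local_geodesic ::
  "('m, 'n::finite) chart set \<Rightarrow> ('m, 'n) tfun \<Rightarrow> ('m, 'n) chart \<Rightarrow> (real \<Rightarrow> 'm) \<Rightarrow> real \<Rightarrow> bool" where
  "local_geodesic A L c \<gamma> t \<longleftrightarrow> (\<exists>J. t \<in> J \<and> regular_at c \<gamma> J) \<and> euler_lagrange (loc A L c) (coord c \<circ> \<gamma>) t"

text \<open>The set of times is reduced to those at which \<open>\<gamma>\<close> stays where the coordinate expression of \<open>f\<close> is defined. An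
immersion maps nonzero velocities to nonzero velocities.\<close>

lemma regular_at_compose:
  assumes c: "is_chart c" and im: "immersion_on (expr_dom c d f) (chart_img d) (coord_expr c d f)"
    and reg: "regular_at c \<gamma> J" and t: "t \<in> J" and d: "f (\<gamma> t) \<in> chart_dom d"
  obtains J' where "t \<in> J'" "J' \<subseteq> J" "regular_at c \<gamma> J'" "regular_at d (f \<circ> \<gamma>) J'"
    "\<And>s. s \<in> J' \<Longrightarrow> coord c (\<gamma> s) \<in> expr_dom c d f"
    "\<And>s. s \<in> J' \<Longrightarrow> (coord d \<circ> (f \<circ> \<gamma>)) s = coord_expr c d f ((coord c \<circ> \<gamma>) s)"
proof -
  let ?W = "expr_dom c d f" and ?x = "coord c \<circ> \<gamma>" and ?f = "coord_expr c d f"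
  have W: "open ?W" "smooth_on ?W ?f" "\<And>u v. u \<in> ?W \<Longrightarrow> v \<noteq> 0 \<Longrightarrow> fderiv ?f u v \<noteq> 0"
    using im by (auto simp: immersion_on_def)
  have J: "open J" "\<And>s. s \<in> J \<Longrightarrow> \<gamma> s \<in> chart_dom c" "smooth_on J ?x" "\<And>s. s \<in> J \<Longrightarrow> velocity ?x s \<noteq> 0"
    using reg by (auto simp: regular_at_def)
  let ?J = "J \<inter> ?x -` ?W"
  have J': "open ?J" by (rule continuous_open_preimage[OF smooth_on_continuous_on[OF J(3)] J(1) W(1)])
  have tJ: "t \<in> ?J" using t d J(2)[OF t] by (auto intro: expr_dom_coord)
  have xs: "smooth_on ?J ?x" using J(3) by (rule smooth_on_subset) auto
  have eq: "(coord d \<circ> (f \<circ> \<gamma>)) s = ?f (?x s)" if "s \<in> ?J" for s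
    using J(2)[of s] that by (simp add: coord_expr_coord[OF c])
  have xW: "?x ` ?J \<subseteq> ?W" by auto
  have reg': "regular_at c \<gamma> ?J" using J J' xs by (auto simp: regular_at_def)
  have "smooth_on ?J (\<lambda>s. ?f (?x s))" by (rule smooth_on_compose[OF J' W(1,2) xs xW])
  then have "smooth_on ?J (coord d \<circ> (f \<circ> \<gamma>))"
    by (rule smooth_on_cong[OF J', rotated]) (simp only: eq)
  moreover have "velocity (coord d \<circ> (f \<circ> \<gamma>)) s \<noteq> 0" if s: "s \<in> ?J" for s
  proof -
    have "velocity (coord d \<circ> (f \<circ> \<gamma>)) s = velocity (\<lambda>s. ?f (?x s)) s"
      by (rule velocity_cong_open[OF J' s eq])
    also have "\<dots> = fderiv ?f (?x s) (velocity ?x s)"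
      by (rule velocity_compose[OF W(1,2) J' xs xW s])
    finally show ?thesis using W(3)[of "?x s"] J(4) s by auto
  qed
  moreover have "f (\<gamma> s) \<in> chart_dom d" if "s \<in> ?J" for s
  proof -
    have "?x s \<in> ?W" "\<gamma> s \<in> chart_dom c" using that J(2) by auto
    then show ?thesis using c by (simp add: expr_dom_iff chart_point_coord)
  qed
  ultimately have "regular_at d (f \<circ> \<gamma>) ?J" using J' by (auto simp: regular_at_def)
  from that[OF tJ _ reg' this _ eq] show thesis by auto
qed

text \<open>The descent of the Euler-Lagrange equations along an immersion, for curves on manifolds. The coordinates of \<open>f \<circ> \<gamma>\<close>
are obtained from those of \<open>\<gamma>\<close> only near \<open>t\<close>, which suffices because the equations at \<open>t\<close> depend on the germ of the curve.\<close>

lemma euler_lagrange_coord_expr: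
  assumes man: "smooth_manifold A" and c: "is_chart c" and d: "d \<in> A"
    and im: "immersion_on (expr_dom c d f) (chart_img d) (coord_expr c d f)"
    and L: "finsler A L" and G: "pulls_back (expr_dom c d f) (coord_expr c d f) (loc A L d) G"
    and reg: "regular_at c \<gamma> J" and t: "t \<in> J" and ft: "f (\<gamma> t) \<in> chart_dom d"
    and EL: "euler_lagrange (loc A L d) (coord d \<circ> (f \<circ> \<gamma>)) t"
  shows "euler_lagrange G (coord c \<circ> \<gamma>) t"
proof -
  obtain J' where J': "t \<in> J'" "J' \<subseteq> J" "regular_at c \<gamma> J'" "regular_at d (f \<circ> \<gamma>) J'"
    "\<And>s. s \<in> J' \<Longrightarrow> coord c (\<gamma> s) \<in> expr_dom c d f"
    "\<And>s. s \<in> J' \<Longrightarrow> (coord d \<circ> (f \<circ> \<gamma>)) s = coord_expr c d f ((coord c \<circ> \<gamma>) s)"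
    by (rule regular_at_compose[OF c im reg t ft]) (rule that, auto)
  have op: "open J'" and sm: "smooth_on J' (coord c \<circ> \<gamma>)" using J'(3) by (auto simp: regular_at_def)
  have "smooth_on (slit (chart_img d)) (case_prod (loc A L d))"
    using L d by (simp add: finsler_finsler_on finsler_on_def)
  from euler_lagrange_pullback[OF im this G op sm _ J'(1)]
  show ?thesis
    using J'(3,5) EL euler_lagrange_cong_open[OF op J'(1,6)] by (auto simp: regular_at_def)
qed

text \<open>The metric in the new chart is the pullback of the metric in the old chart under the reverse
change of coordinates, to which the descent of the Euler-Lagrange equations applies.\<close>

lemma local_geodesic_change_chart:
  assumes man: "smooth_manifold A" and L: "finsler A L" and c: "c \<in> A" and d: "d \<in> A"
    and g: "local_geodesic A L c \<gamma> t" and t: "\<gamma> t \<in> chart_dom d"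
  shows "local_geodesic A L d \<gamma> t"
proof -
  note ch = manifold_chart[OF man c] manifold_chart[OF man d]
  obtain J where J: "t \<in> J" "regular_at c \<gamma> J" and EL: "euler_lagrange (loc A L c) (coord c \<circ> \<gamma>) t"
    using g by (auto simp: local_geodesic_def)
  have tc: "\<gamma> t \<in> chart_dom c" using J by (auto simp: regular_at_def)
  obtain J' where J': "t \<in> J'" "regular_at d \<gamma> J'"
    by (rule regular_at_compose[OF ch(1) immersion_on_coord_change[OF man c d] J(2,1) t])
      (rule that, auto simp: o_def)
  have pb: "pulls_back (expr_dom d c (\<lambda>p. p)) (coord_expr d c (\<lambda>p. p)) (loc A L c) (loc A L d)"
    using loc_change_chart[OF man d c] by (auto simp: pulls_back_def)
  have "euler_lagrange (loc A L d) (coord d \<circ> \<gamma>) t"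
    by (rule euler_lagrange_coord_expr[OF man ch(2) c immersion_on_coord_change[OF man d c] L pb J'(2,1) tc])
      (use EL in \<open>simp add: o_def\<close>)
  with J' show ?thesis by (auto simp: local_geodesic_def)
qed

lemma geodesic_local:
  assumes man: "smooth_manifold A" and g: "geodesic A L I \<gamma>" and t: "t \<in> I" and c: "c \<in> A" "\<gamma> t \<in> chart_dom c"
  shows "local_geodesic A L c \<gamma> t"
proof -
  let ?J = "I \<inter> \<gamma> -` chart_dom c"
  have "open ?J"
    using g manifold_chart_dom_open[OF man c(1)] by (auto simp: geodesic_def intro: continuous_open_preimage)
  then show ?thesis
    using g c t unfolding geodesic_def local_geodesic_def regular_at_def euler_lagrange_def Let_def
    by (intro conjI exI[of _ ?J]) auto
qed

text \<open>Smoothness and the Euler-Lagrange equations in all charts follow from those in one chart around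
each point of the curve; continuity follows from continuity of the coordinates.\<close>

lemma geodesic_iff_local:
  assumes man: "smooth_manifold A" and L: "finsler A L"
  shows "geodesic A L I \<gamma> \<longleftrightarrow> open I \<and> is_interval I \<and> I \<noteq> {} \<and> (\<forall>t\<in>I. \<exists>c\<in>A. local_geodesic A L c \<gamma> t)"
proof
  assume g: "geodesic A L I \<gamma>"
  have "\<exists>c\<in>A. local_geodesic A L c \<gamma> t" if "t \<in> I" for t
  proof -
    obtain c where "c \<in> A" "\<gamma> t \<in> chart_dom c" using manifold_chart_ex[OF man] .
    then show ?thesis using geodesic_local[OF man g that] by blast
  qed
  then show "open I \<and> is_interval I \<and> I \<noteq> {} \<and> (\<forall>t\<in>I. \<exists>c\<in>A. local_geodesic A L c \<gamma> t)"
    using g by (auto simp: geodesic_def)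
next
  assume I: "open I \<and> is_interval I \<and> I \<noteq> {} \<and> (\<forall>t\<in>I. \<exists>c\<in>A. local_geodesic A L c \<gamma> t)"
  have loc: "local_geodesic A L d \<gamma> t" if "t \<in> I" "d \<in> A" "\<gamma> t \<in> chart_dom d" for t d
    using I that local_geodesic_change_chart[OF man L] by blast
  have "isCont \<gamma> t" if t: "t \<in> I" for t
  proof -
    obtain c J where c: "c \<in> A" "t \<in> J" "regular_at c \<gamma> J"
      using I t unfolding local_geodesic_def by blast
    have ch: "continuous_on (chart_img c) (point c)"
      using manifold_chart[OF man c(1)] by (simp add: is_chart_def homeomorphism_def)
    have J: "open J" "\<And>s. s \<in> J \<Longrightarrow> \<gamma> s \<in> chart_dom c" "continuous_on J (coord c \<circ> \<gamma>)"
      using c(3) by (auto simp: regular_at_def simp del: o_apply intro: smooth_on_continuous_on)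
    have "continuous_on J (\<lambda>s. point c ((coord c \<circ> \<gamma>) s))"
      by (rule continuous_on_compose2[OF ch J(3)]) (auto intro: chart_coord_mem J(2))
    moreover have "point c ((coord c \<circ> \<gamma>) s) = \<gamma> s" if "s \<in> J" for s
      using chart_point_coord[OF manifold_chart[OF man c(1)] J(2)[OF that]] by simp
    ultimately have "continuous_on J \<gamma>" by (simp cong: continuous_on_cong_simp)
    then show ?thesis using J(1) c(2) by (simp add: continuous_on_eq_continuous_at)
  qed
  then have "continuous_on I \<gamma>" by (simp add: continuous_at_imp_continuous_on)
  moreover have "smooth_on (I \<inter> \<gamma> -` chart_dom d) (coord d \<circ> \<gamma>)" if d: "d \<in> A" for d
  proof (rule smooth_on_local)
    fix t assume "t \<in> I \<inter> \<gamma> -` chart_dom d"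
    then have "local_geodesic A L d \<gamma> t" using loc d by blast
    then show "\<exists>T. open T \<and> t \<in> T \<and> smooth_on T (coord d \<circ> \<gamma>)"
      unfolding local_geodesic_def regular_at_def by blast
  qed
  moreover have "velocity (coord d \<circ> \<gamma>) t \<noteq> 0 \<and> euler_lagrange (loc A L d) (coord d \<circ> \<gamma>) t"
    if "d \<in> A" "t \<in> I \<inter> \<gamma> -` chart_dom d" for d t
  proof -
    have "local_geodesic A L d \<gamma> t" using loc that by blast
    then show ?thesis unfolding local_geodesic_def regular_at_def by blast
  qed
  ultimately show "geodesic A L I \<gamma>"
    using I unfolding geodesic_def euler_lagrange_def Let_def by blast
qed

section \<open>Adapted charts of a hypersurface\<close>

lemma manifold_maximal:
  "smooth_manifold A \<Longrightarrow> is_chart c \<Longrightarrow> (\<And>d. d \<in> A \<Longrightarrow> compatible c d) \<Longrightarrow> c \<in> A"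
  unfolding smooth_manifold_def by blast

text \<open>A maximal atlas contains every chart that arises from one of its members by restriction and a
diffeomorphism of the coordinates.\<close>

lemma manifold_reparametrised_chart:
  fixes B :: "('h::{t2_space,second_countable_topology}, 'k::finite) chart set"
  assumes man: "smooth_manifold B" and c0: "c0 \<in> B"
    and U: "open U" "U \<subseteq> chart_img c0" and V: "open V"
    and hom: "homeomorphism U V h g" and h: "smooth_on U h" and g: "smooth_on V g"
  defines "c \<equiv> (chart_dom c0 \<inter> coord c0 -` U, h \<circ> coord c0)"
  shows "c \<in> B" "chart_img c = V" "\<And>y. y \<in> V \<Longrightarrow> point c y = point c0 (g y)"
proof -
  let ?D = "chart_dom c0 \<inter> coord c0 -` U"
  have ch: "is_chart c0" by (rule manifold_chart[OF man c0])
  have c_simps: "chart_dom c = ?D" "coord c = h \<circ> coord c0" by (simp_all add: c_def)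
  have gU: "g y \<in> U" "h (g y) = y" if "y \<in> V" for y using hom that by (auto simp: homeomorphism_def)
  have hV: "h x \<in> V" "g (h x) = x" if "x \<in> U" for x using hom that by (auto simp: homeomorphism_def)
  have cont: "continuous_on (chart_dom c0) (coord c0)" "continuous_on (chart_img c0) (point c0)"
    using ch by (auto simp: is_chart_def homeomorphism_def)
  have D: "open ?D"
    by (rule continuous_open_preimage[OF cont(1) manifold_chart_dom_open[OF man c0] U(1)])
  have gD: "point c0 (g y) \<in> ?D" "coord c0 (point c0 (g y)) = g y" if "y \<in> V" for y
    using gU[OF that] U(2) chart_coord_point[OF ch] chart_point_mem[OF ch] by auto
  show img: "chart_img c = V"
  proof (intro equalityI subsetI)
    fix y assume "y \<in> chart_img c"
    then show "y \<in> V" using hV by (auto simp: chart_img_def c_simps)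
  next
    fix y assume y: "y \<in> V"
    then show "y \<in> chart_img c"
      unfolding chart_img_def c_simps using gD[OF y] gU[OF y] by (intro image_eqI[of _ _ "point c0 (g y)"]) auto
  qed
  have inj: "inj_on (coord c) (chart_dom c)"
  proof (rule inj_onI)
    fix p q assume pq: "p \<in> chart_dom c" "q \<in> chart_dom c" "coord c p = coord c q"
    then have U: "coord c0 p \<in> U" "coord c0 q \<in> U" and dom: "p \<in> chart_dom c0" "q \<in> chart_dom c0"
      and eq: "h (coord c0 p) = h (coord c0 q)" unfolding c_simps by simp_all
    have "coord c0 p = coord c0 q" using hV(2)[OF U(1)] hV(2)[OF U(2)] unfolding eq by simp
    then show "p = q" using chart_point_coord[OF ch dom(1)] chart_point_coord[OF ch dom(2)] by argo
  qed
  show pt: "point c y = point c0 (g y)" if y: "y \<in> V" for y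
    unfolding point_def[of c] using gD[OF y] gU[OF y]
    by (intro inv_into_f_eq[OF inj]) (auto simp: c_simps)
  have "homeomorphism (chart_dom c) (chart_img c) (coord c) (point c)"
  proof (rule homeomorphismI)
    have hg: "continuous_on U h" "continuous_on V g" using hom by (auto simp: homeomorphism_def)
    have "continuous_on ?D (coord c0)" using cont(1) by (rule continuous_on_subset) simp
    then have "continuous_on ?D (\<lambda>p. h (coord c0 p))" by (rule continuous_on_compose2[OF hg(1)]) auto
    then show "continuous_on (chart_dom c) (coord c)" by (simp add: c_simps o_def)
    have "continuous_on V (\<lambda>y. point c0 (g y))"
      using U(2) gU(1) by (intro continuous_on_compose2[OF cont(2) hg(2)]) auto
    then show "continuous_on (chart_img c) (point c)" using img pt by (simp cong: continuous_on_cong_simp)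
    show "coord c ` chart_dom c \<subseteq> chart_img c" by (simp add: chart_img_def)
    show "point c ` chart_img c \<subseteq> chart_dom c" using img pt gD(1) by (auto simp: c_simps)
    show "point c (coord c p) = p" if "p \<in> chart_dom c" for p
      using inv_into_f_f[OF inj that] by (simp add: point_def)
    show "coord c (point c y) = y" if "y \<in> chart_img c" for y
      using that f_inv_into_f[of y "coord c" "chart_dom c"] by (simp add: point_def chart_img_def)
  qed
  then have chc: "is_chart c" unfolding is_chart_def using D inj img V by (simp add: c_simps)
  have "compatible c e" if e: "e \<in> B" for e
  proof -
    note id = smooth_map_id[OF man] and che = manifold_chart[OF man e]
    have "smooth_on (coord c ` (chart_dom c \<inter> chart_dom e)) (coord_expr c e (\<lambda>p. p))"
    proof -
      let ?S = "coord c ` (chart_dom c \<inter> chart_dom e)"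
      have S: "open ?S" by (rule chart_image_open[OF chc manifold_chart_dom_open[OF man e]])
      have SV: "?S \<subseteq> V" using img by (auto simp: chart_img_def)
      have "g ` ?S \<subseteq> expr_dom c0 e (\<lambda>p. p)" using hV(2) by (auto simp: c_simps expr_dom_def)
      from smooth_on_compose[OF S open_expr_dom[OF man man id c0 e] smooth_on_coord_expr[OF id c0 e] smooth_on_subset[OF g SV] this]
      have "smooth_on ?S (\<lambda>y. coord_expr c0 e (\<lambda>p. p) (g y))" .
      then show ?thesis
        by (rule smooth_on_cong[OF S, rotated]) (use SV pt in \<open>auto simp: coord_expr_def\<close>)
    qed
    moreover have "smooth_on (coord e ` (chart_dom c \<inter> chart_dom e)) (coord_expr e c (\<lambda>p. p))"
    proof -
      let ?S = "coord e ` (chart_dom c \<inter> chart_dom e)"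
      have "coord e ` (chart_dom e \<inter> chart_dom c) = ?S" by (simp add: Int_commute)
      then have S: "open ?S" using chart_image_open[OF che, of "chart_dom c"] D by (simp add: c_simps)
      have sub: "?S \<subseteq> expr_dom e c0 (\<lambda>p. p)" by (auto simp: expr_dom_def c_simps)
      have "coord_expr e c0 (\<lambda>p. p) ` ?S \<subseteq> U"
        using chart_point_coord[OF che] by (auto simp: coord_expr_def c_simps)
      from smooth_on_compose[OF S U(1) h smooth_on_subset[OF smooth_on_coord_expr[OF id e c0] sub] this]
      have "smooth_on ?S (\<lambda>x. h (coord_expr e c0 (\<lambda>p. p) x))" .
      then show ?thesis by (simp add: coord_expr_def c_simps o_def)
    qed
    ultimately show ?thesis by (simp add: compatible_def)
  qed
  then show "c \<in> B" using manifold_maximal[OF man chc] by blast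
qed

text \<open>At the coordinates of \<open>p\<close> the derivative of the parametrization is injective and has a linear left inverse \<open>P\<close>. Then \<open>P\<close>
composed with the parametrization has the identity as derivative there, so near \<open>p\<close> it is a system of
coordinates on the hypersurface. In these coordinates \<open>P\<close> is a left inverse of the
parametrization itself, which thereby becomes a graph over the range of \<open>P\<close>.\<close>

lemma graph_chart:
  fixes A :: "('m::{t2_space,second_countable_topology}, 'n::finite) chart set"
    and B :: "('h::{t2_space,second_countable_topology}, 'k::finite) chart set"
  assumes man: "smooth_manifold B" "smooth_manifold A" and h: "hypersurface B A \<iota>"
    and d: "d \<in> A" "\<iota> p \<in> chart_dom d"
  obtains c P where "c \<in> B" "p \<in> chart_dom c" "\<iota> ` chart_dom c \<subseteq> chart_dom d" "convex (chart_img c)"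
    "linear P" "\<And>u. u \<in> chart_img c \<Longrightarrow> P (coord_expr c d \<iota> u) = u"
proof -
  obtain c0 where c0: "c0 \<in> B" "p \<in> chart_dom c0" using manifold_chart_ex[OF man(1)] .
  have ch: "is_chart c0" by (rule manifold_chart[OF man(1) c0(1)])
  let ?W = "expr_dom c0 d \<iota>" and ?f = "coord_expr c0 d \<iota>"
  have im: "immersion_on ?W (chart_img d) ?f" by (rule immersion_on_hypersurface[OF man h c0(1) d(1)])
  then have W: "open ?W" "smooth_on ?W ?f" by (auto simp: immersion_on_def)
  define u0 where "u0 = coord c0 p"
  have u0: "u0 \<in> ?W" unfolding u0_def using c0 d by (intro expr_dom_coord)
  have lin: "linear (fderiv ?f u0)" using linear_fderiv[OF smooth_on_differentiable[OF W(2) u0]] .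
  have "inj (fderiv ?f u0)"
    unfolding linear_injective_0[OF lin] using im u0 unfolding immersion_on_def by blast
  then obtain P where P: "linear P" "P \<circ> fderiv ?f u0 = id" using linear_injective_left_inverse[OF lin] by blast
  have blP: "bounded_linear P" using P(1) by (simp add: linear_conv_bounded_linear)
  define H where "H u = P (?f u)" for u
  have H: "smooth_on ?W H" unfolding H_def by (rule smooth_on_bounded_linear[OF W(1) blP W(2)])
  have "fderiv H u0 v = v" for v
    unfolding H_def fderiv_bounded_linear[OF blP smooth_on_differentiable[OF W(2) u0]] using fun_cong[OF P(2), of v] by simp
  then have "inj (fderiv H u0)" by (simp add: inj_def)
  from smooth_inverse_function[OF W(1) H u0 this] obtain U' V g where
    *: "open U'" "U' \<subseteq> ?W" "u0 \<in> U'" "open V" "homeomorphism U' V H g" "smooth_on V g" by metis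
  have HV: "H u \<in> V" "g (H u) = u" if "u \<in> U'" for u using *(5) that by (auto simp: homeomorphism_def)
  have gU: "g y \<in> U'" "H (g y) = y" if "y \<in> V" for y using *(5) that by (auto simp: homeomorphism_def)
  obtain r where r: "r > 0" "ball (H u0) r \<subseteq> V" using HV(1)[OF *(3)] *(4) openE by blast
  \<comment> \<open>A ball is chosen as the image of the new chart so that it is convex.\<close>
  let ?V = "ball (H u0) r" and ?U = "U' \<inter> H -` ball (H u0) r"
  have hom: "homeomorphism ?U ?V H g"
  proof (rule homeomorphismI)
    show "continuous_on ?U H" "continuous_on ?V g"
      using *(5) r(2) by (auto simp: homeomorphism_def intro: continuous_on_subset)
    show "g ` ?V \<subseteq> ?U"
    proof
      fix x assume "x \<in> g ` ?V"
      then obtain y where "x = g y" "y \<in> ?V" by blast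
      then show "x \<in> ?U" using gU[of y] r(2) by auto
    qed
  qed (use HV(2) gU(2) r(2) in auto)
  have U: "open ?U"
    by (rule continuous_open_preimage[OF _ *(1) open_ball]) (use *(5) in \<open>auto simp: homeomorphism_def\<close>)
  have UW: "?U \<subseteq> ?W" using *(2) by auto
  have Uimg: "?U \<subseteq> chart_img c0" using UW expr_dom_iff[OF ch] by blast
  define c where "c = (chart_dom c0 \<inter> coord c0 -` ?U, H \<circ> coord c0)"
  note c = manifold_reparametrised_chart[OF man(1) c0(1) U Uimg open_ball hom smooth_on_subset[OF H UW]
      smooth_on_subset[OF *(6) r(2)], folded c_def]
  show thesis
  proof (rule that[OF c(1)])
    show "p \<in> chart_dom c" using c0 *(3) r(1) by (simp add: c_def u0_def)
    show "\<iota> ` chart_dom c \<subseteq> chart_dom d"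
    proof
      fix y assume "y \<in> \<iota> ` chart_dom c"
      then obtain q where q: "y = \<iota> q" "q \<in> chart_dom c0" "coord c0 q \<in> ?U" by (auto simp: c_def)
      then have "coord c0 q \<in> ?W" using UW by blast
      then show "y \<in> chart_dom d" using q(1,2) by (simp add: expr_dom_iff[OF ch] chart_point_coord[OF ch])
    qed
    show "convex (chart_img c)" unfolding c(2) by (rule convex_ball)
    show "linear P" by (rule P(1))
    show "P (coord_expr c d \<iota> u) = u" if u: "u \<in> chart_img c" for u
    proof -
      have "u \<in> ?V" using u c(2) by simp
      then show ?thesis using c(3)[of u] gU(2)[of u] r(2) by (auto simp: coord_expr_def H_def)
    qed
  qed
qed

section \<open>Totally geodesic hypersurfaces\<close>

lemma fderiv_locally_constant:
  assumes "open S" "x \<in> S" "\<And>y. y \<in> S \<Longrightarrow> f y = c"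
  shows "fderiv f x v = 0"
proof -
  have "(f has_derivative (\<lambda>v. 0)) (at x)"
    by (rule has_derivative_transform_within_open[OF has_derivative_const assms(1,2)]) (simp add: assms(3))
  from fderiv_eq[OF this] show ?thesis by simp
qed

text \<open>Both terms of the Euler-Lagrange expression at zero acceleration contain a derivative with respect to the
position, which the metric does not depend on.\<close>

lemma minkowski_straight:
  assumes X: "open X" and F: "smooth_on (slit X) (case_prod F)"
    and mink: "\<And>x x' y. x \<in> X \<Longrightarrow> x' \<in> X \<Longrightarrow> y \<noteq> 0 \<Longrightarrow> F x y = F x' y"
    and x: "x \<in> X" and y: "y \<noteq> 0"
  shows "euler F x y 0 w = 0"
proof -
  have dF: "case_prod F differentiable at (\<xi>, y)" if "\<xi> \<in> X" for \<xi>
    using smooth_on_differentiable[OF F] that y by auto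
  have "fderiv (case_prod F) (x, y) (w, 0) = 0"
    unfolding fderiv_case_prod(2)[OF dF[OF x], symmetric]
    using fderiv_locally_constant[OF X x, of "\<lambda>\<xi>. F \<xi> y" "F x y"] mink[OF _ x y] by blast
  moreover have "fderiv (\<lambda>q. fderiv (case_prod F) q (0, w)) (x, y) (y, 0) = 0"
  proof -
    let ?G = "\<lambda>\<xi> \<eta>. fderiv (case_prod F) (\<xi>, \<eta>) (0, w)"
    have G: "case_prod ?G = (\<lambda>q. fderiv (case_prod F) q (0, w))" by (auto simp: fun_eq_iff)
    have dG: "case_prod ?G differentiable at (x, y)"
      unfolding G using smooth_on_differentiable[OF smooth_on_fderiv[OF F]] x y by auto
    have "?G \<xi> y = ?G x y" if \<xi>: "\<xi> \<in> X" for \<xi>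
    proof -
      have "((\<lambda>\<eta>. (x, \<eta>)) has_derivative (\<lambda>w. (0, w))) (at y)" by (auto intro!: derivative_eq_intros)
      from has_derivative_compose[OF this has_derivative_fderiv[OF dF[OF x]]]
      have "F x differentiable at y" by (auto simp: differentiable_def)
      from fderiv_cong_open(2)[OF _ _ _ this, of "- {0}" "F \<xi>"]
      have "fderiv (F \<xi>) y = fderiv (F x) y" using mink[OF x \<xi>] y by auto
      then show ?thesis by (simp add: fderiv_case_prod(1)[OF dF, symmetric] x \<xi>)
    qed
    then have "fderiv (\<lambda>\<xi>. ?G \<xi> y) x y = 0" by (rule fderiv_locally_constant[OF X x])
    then show ?thesis unfolding G[symmetric] fderiv_case_prod(2)[OF dG] .
  qed
  ultimately show ?thesis by (simp add: euler_def)
qed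

text \<open>Polarization of the symmetric second derivative.\<close>

lemma quadratic_second_derivative_zero:
  fixes f :: "'a::euclidean_space \<Rightarrow> 'b::euclidean_space"
  assumes U: "open U" "smooth_on U f" "z \<in> U"
    and q: "\<And>v. fderiv (\<lambda>p. fderiv f p v) z v = 0"
  shows "fderiv (\<lambda>p. fderiv f p v) z w = 0"
proof -
  let ?B = "\<lambda>v w. fderiv (\<lambda>p. fderiv f p v) z w"
  have l1: "linear (\<lambda>v. ?B v w)" for w by (rule linear_fderiv_fderiv[OF U])
  have l2: "linear (?B v)" for v using linear_fderiv[OF smooth_on_differentiable[OF smooth_on_fderiv[OF U(2)] U(3)]] .
  have "0 = ?B (v + w) (v + w)" by (simp add: q)
  also have "\<dots> = ?B v w + ?B w v" by (simp add: linear_add[OF l1] linear_add[OF l2] q)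
  also have "\<dots> = 2 *\<^sub>R ?B v w" using fderiv_commute[OF U, of w v] by (simp add: scaleR_2)
  finally show ?thesis by simp
qed

context
  fixes A :: "('m::{t2_space,second_countable_topology}, 'n::finite) chart set"
    and B :: "('h::{t2_space,second_countable_topology}, 'k::finite) chart set"
    and \<iota> :: "'h \<Rightarrow> 'm" and c :: "('h, 'k) chart" and d :: "('m, 'n) chart"
  assumes man: "smooth_manifold B" "smooth_manifold A" and h: "hypersurface B A \<iota>"
    and c: "c \<in> B" and d: "d \<in> A" and cd: "\<iota> ` chart_dom c \<subseteq> chart_dom d"
begin

lemma immersed_smooth_map: "smooth_map B A \<iota>" using h by (simp add: hypersurface_def)

lemma expr_dom_total: "expr_dom c d \<iota> = chart_img c"
  using cd by (auto simp: expr_dom_def chart_img_def)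

lemma immersion_on_coord_expr: "immersion_on (chart_img c) (chart_img d) (coord_expr c d \<iota>)"
  using immersion_on_hypersurface[OF man h c d] by (simp add: expr_dom_total)

lemma coord_expr_facts: "open (chart_img c)" "open (chart_img d)" "smooth_on (chart_img c) (coord_expr c d \<iota>)"
  "\<And>u. u \<in> chart_img c \<Longrightarrow> coord_expr c d \<iota> u \<in> chart_img d" "\<And>u v. u \<in> chart_img c \<Longrightarrow> v \<noteq> 0 \<Longrightarrow> fderiv (coord_expr c d \<iota>) u v \<noteq> 0"
  using immersion_on_coord_expr by (auto simp: immersion_on_def)

lemma loc_induced_total: "u \<in> chart_img c \<Longrightarrow> loc B (induced B A \<iota> L) c u v = loc A L d (coord_expr c d \<iota> u) (fderiv (coord_expr c d \<iota>) u v)"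
  using loc_induced[OF man immersed_smooth_map c d] by (simp add: expr_dom_total)

lemma pulls_back_total: "pulls_back (chart_img c) (coord_expr c d \<iota>) (loc A L d) (loc B (induced B A \<iota> L) c)"
  by (simp add: pulls_back_def loc_induced_total)

lemma regular_at_point:
  assumes J: "open J" and u: "smooth_on J u" "\<forall>s\<in>J. u s \<in> chart_img c \<and> velocity u s \<noteq> 0"
  shows "regular_at c (\<lambda>s. point c (u s)) J" "\<And>s. s \<in> J \<Longrightarrow> (coord c \<circ> (\<lambda>s. point c (u s))) s = u s"
proof -
  have ch: "is_chart c" by (rule manifold_chart[OF man(1) c])
  show eq: "(coord c \<circ> (\<lambda>s. point c (u s))) s = u s" if "s \<in> J" for s
    using chart_coord_point[OF ch] u(2) that by simp
  have "smooth_on J (coord c \<circ> (\<lambda>s. point c (u s)))"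
    by (rule smooth_on_cong[OF J _ u(1)]) (simp only: eq)
  moreover have "velocity (coord c \<circ> (\<lambda>s. point c (u s))) s = velocity u s" if "s \<in> J" for s
    by (rule velocity_cong_open[OF J that eq])
  ultimately show "regular_at c (\<lambda>s. point c (u s)) J"
    using J u(2) chart_point_mem[OF ch] by (auto simp: regular_at_def simp del: o_apply)
qed

text \<open>Let \<open>u\<close> be a geodesic of the induced metric with initial velocity \<open>v\<close>, and let \<open>f\<close> be the coordinate expression of the
parametrization. As the hypersurface is totally geodesic, \<open>f \<circ> u\<close> is a geodesic of the Minkowski metric, so its
acceleration is a multiple of its velocity. Since \<open>P \<circ> f\<close> is the identity, \<open>P\<close> is a left inverse of the
derivative of \<open>f\<close> and kills the second derivative, so applying \<open>P\<close> shows that the acceleration of \<open>u\<close> is the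
same multiple of \<open>v\<close>. The formula for the acceleration of \<open>f \<circ> u\<close> leaves nothing for the second derivative of
\<open>f\<close> at \<open>(v, v)\<close>.\<close>

lemma second_derivative_zero:
  assumes L: "finsler A L" and L': "finsler A L'"
    and proj: "\<And>I \<gamma>. geodesic A L I \<gamma> \<Longrightarrow> geodesic A L' I \<gamma>"
    and tg: "totally_geodesic B A \<iota> L"
    and mink: "\<And>x x' y. x \<in> chart_img d \<Longrightarrow> x' \<in> chart_img d \<Longrightarrow> y \<noteq> 0 \<Longrightarrow> loc A L' d x y = loc A L' d x' y"
    and P: "linear P" "\<And>u. u \<in> chart_img c \<Longrightarrow> P (coord_expr c d \<iota> u) = u"
    and z: "z \<in> chart_img c"
  shows "fderiv (\<lambda>p. fderiv (coord_expr c d \<iota>) p v) z w = 0"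
proof (rule quadratic_second_derivative_zero[OF coord_expr_facts(1,3) z])
  fix v
  show "fderiv (\<lambda>p. fderiv (coord_expr c d \<iota>) p v) z v = 0"
  proof (cases "v = 0")
    case True
    then show ?thesis
      using linear_0[OF linear_fderiv[OF smooth_on_differentiable[OF smooth_on_fderiv[OF coord_expr_facts(3)] z]]] by simp
  next
    case v: False
    have finB: "finsler B (induced B A \<iota> L)" by (rule finsler_induced[OF man h L])
    then have fin: "finsler_on (chart_img c) (loc B (induced B A \<iota> L) c)" using c by (simp add: finsler_finsler_on)
    obtain e u where e: "0 < e" and u: "smooth_on {-e<..<e} u" "u 0 = z" "velocity u 0 = v"
      "\<And>t. t \<in> {-e<..<e} \<Longrightarrow> u t \<in> chart_img c \<and> velocity u t \<noteq> 0 \<and> euler_lagrange (loc B (induced B A \<iota> L) c) u t"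
      by (rule finsler_geodesic_exists[OF coord_expr_facts(1) fin z v]) (rule that, auto)
    let ?J = "{-e<..<e}" and ?\<eta> = "\<lambda>s. point c (u s)"
    have J: "open ?J" and 0: "0 \<in> ?J" using e by auto
    have u2: "\<And>s. s \<in> ?J \<Longrightarrow> u s \<in> chart_img c \<and> velocity u s \<noteq> 0" using u(4) by blast
    have "\<forall>s\<in>?J. u s \<in> chart_img c \<and> velocity u s \<noteq> 0" using u2 by blast
    note reg = regular_at_point[OF J u(1) this]
    have "local_geodesic B (induced B A \<iota> L) c ?\<eta> t" if t: "t \<in> ?J" for t
    proof -
      have "euler_lagrange F (coord c \<circ> ?\<eta>) t \<longleftrightarrow> euler_lagrange F u t" for F
        by (rule euler_lagrange_cong_open[OF J t reg(2)])
      then show ?thesis unfolding local_geodesic_def using reg(1) t u(4)[OF t] by blast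
    qed
    then have "geodesic B (induced B A \<iota> L) ?J ?\<eta>"
      unfolding geodesic_iff_local[OF man(1) finB] using c e by (intro conjI ballI bexI[of _ c]) (auto simp: is_interval_oo)
    then have geo: "geodesic A L' ?J (\<iota> \<circ> ?\<eta>)" using tg proj by (auto simp: totally_geodesic_def)
    have "?\<eta> 0 \<in> chart_dom c" using reg(1) 0 by (auto simp: regular_at_def)
    then have "(\<iota> \<circ> ?\<eta>) 0 \<in> chart_dom d" using cd by auto
    from geodesic_local[OF man(2) geo 0 d this]
    have "euler_lagrange (loc A L' d) (coord d \<circ> (\<iota> \<circ> ?\<eta>)) 0" unfolding local_geodesic_def by blast
    then have EL: "euler_lagrange (loc A L' d) (\<lambda>s. coord_expr c d \<iota> (u s)) 0" by (simp add: coord_expr_def o_def)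
    have uJ: "u ` ?J \<subseteq> chart_img c" using u2 by auto
    have xs: "smooth_on ?J (\<lambda>s. coord_expr c d \<iota> (u s))"
      by (rule smooth_on_compose[OF J coord_expr_facts(1,3) u(1) uJ])
    have vel: "velocity (\<lambda>s. coord_expr c d \<iota> (u s)) s = fderiv (coord_expr c d \<iota>) (u s) (velocity u s)" if "s \<in> ?J" for s
      by (rule velocity_compose[OF coord_expr_facts(1,3) J u(1) uJ that])
    have acc: "acceleration (\<lambda>s. coord_expr c d \<iota> (u s)) 0 = fderiv (\<lambda>p. fderiv (coord_expr c d \<iota>) p v) z v + fderiv (coord_expr c d \<iota>) z (acceleration u 0)"
      using acceleration_compose[OF coord_expr_facts(1,3) J u(1) uJ 0] by (simp add: u(2,3))
    have fin': "finsler_on (chart_img d) (loc A L' d)" using L' d by (simp add: finsler_finsler_on)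
    then have sm': "smooth_on (slit (chart_img d)) (case_prod (loc A L' d))" by (simp add: finsler_on_def)
    have fz: "coord_expr c d \<iota> z \<in> chart_img d" "fderiv (coord_expr c d \<iota>) z v \<noteq> 0" using coord_expr_facts(4,5) z v by auto
    have x2: "coord_expr c d \<iota> (u s) \<in> chart_img d \<and> velocity (\<lambda>s. coord_expr c d \<iota> (u s)) s \<noteq> 0" if "s \<in> ?J" for s
      using vel[OF that] u2[OF that] coord_expr_facts(4,5) by simp
    have "\<forall>w. euler (loc A L' d) (coord_expr c d \<iota> z) (fderiv (coord_expr c d \<iota>) z v) (acceleration (\<lambda>s. coord_expr c d \<iota> (u s)) 0) w = 0"
      using iffD1[OF euler_lagrange_iff[OF coord_expr_facts(2) sm' J xs x2 0] EL] vel[OF 0] by (simp add: u(2,3))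
    then obtain r where r: "acceleration (\<lambda>s. coord_expr c d \<iota> (u s)) 0 = r *\<^sub>R fderiv (coord_expr c d \<iota>) z v"
      using euler_straight_iff[OF coord_expr_facts(2) fin' fz minkowski_straight[OF coord_expr_facts(2) sm' mink fz]] by blast
    have blP: "bounded_linear P" using P(1) by (simp add: linear_conv_bounded_linear)
    have Pf: "P (fderiv (coord_expr c d \<iota>) p w) = w" if p: "p \<in> chart_img c" for p w
    proof -
      have "((\<lambda>p. P (coord_expr c d \<iota> p)) has_derivative (\<lambda>w. w)) (at p)"
        by (rule has_derivative_transform_within_open[OF has_derivative_ident coord_expr_facts(1) p]) (simp add: P(2))
      from fun_cong[OF fderiv_eq[OF this], of w] show ?thesis
        using fderiv_bounded_linear[OF blP smooth_on_differentiable[OF coord_expr_facts(3) p], of w] by simp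
    qed
    have "P (fderiv (\<lambda>p. fderiv (coord_expr c d \<iota>) p v) z v) = fderiv (\<lambda>p. P (fderiv (coord_expr c d \<iota>) p v)) z v"
      by (rule fderiv_bounded_linear[OF blP smooth_on_differentiable[OF smooth_on_fderiv[OF coord_expr_facts(3)] z], symmetric])
    also have "\<dots> = 0" by (rule fderiv_locally_constant[OF coord_expr_facts(1) z Pf])
    finally have "acceleration u 0 = r *\<^sub>R v"
      using arg_cong[OF acc, of P] Pf[OF z] by (simp add: r linear_add[OF P(1)] linear_cmul[OF P(1)])
    then show ?thesis
      using acc r linear_cmul[OF linear_fderiv[OF smooth_on_differentiable[OF coord_expr_facts(3) z]], of r v] by simp
  qed
qed

text \<open>Where the parametrization has vanishing second derivative, straight lines go to straight lines. These are geodesics of the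
Minkowski metric, hence of any metric that is projectively related to it. As they lie in the hypersurface, they
also satisfy the equations of the induced metric.\<close>

lemma induced_straight:
  assumes L': "finsler A L'" and L: "finsler A L"
    and proj: "\<And>I \<gamma>. geodesic A L' I \<gamma> \<Longrightarrow> geodesic A L I \<gamma>"
    and mink: "\<And>x x' y. x \<in> chart_img d \<Longrightarrow> x' \<in> chart_img d \<Longrightarrow> y \<noteq> 0 \<Longrightarrow> loc A L' d x y = loc A L' d x' y"
    and flat: "\<And>z v w. z \<in> chart_img c \<Longrightarrow> fderiv (\<lambda>p. fderiv (coord_expr c d \<iota>) p v) z w = 0"
    and z: "z \<in> chart_img c" and v: "v \<noteq> 0"
  shows "euler (loc B (induced B A \<iota> L) c) z v 0 w = 0"
proof -
  let ?u = "\<lambda>s. z + s *\<^sub>R v"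
  have cont: "continuous_on UNIV ?u" by (intro continuous_intros)
  have "open (?u -` chart_img c)" by (rule open_vimage[OF coord_expr_facts(1) cont])
  moreover have "0 \<in> ?u -` chart_img c" using z by simp
  ultimately obtain e where e: "e > 0" "ball 0 e \<subseteq> ?u -` chart_img c" using openE by blast
  let ?J = "{-e<..<e}" and ?\<eta> = "\<lambda>s. point c (?u s)"
  have J: "open ?J" and 0: "0 \<in> ?J" using e by auto
  have us: "smooth_on ?J ?u"
    by (intro smooth_on_add smooth_on_scaleR smooth_on_const smooth_on_id J)
  have vu: "velocity ?u = (\<lambda>s. v)"
    by (intro ext vector_derivative_at) (auto intro!: derivative_eq_intros)
  have uc: "?u s \<in> chart_img c" if "s \<in> ?J" for s
    using e(2) that by (auto simp: subset_iff dist_real_def)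
  have u2: "\<And>s. s \<in> ?J \<Longrightarrow> ?u s \<in> chart_img c \<and> velocity ?u s \<noteq> 0" using uc v by (simp add: vu)
  have uJ: "?u ` ?J \<subseteq> chart_img c" using uc by auto
  have "\<forall>s\<in>?J. ?u s \<in> chart_img c \<and> velocity ?u s \<noteq> 0" using u2 by blast
    note reg = regular_at_point[OF J us this]
  have chc: "is_chart c" by (rule manifold_chart[OF man(1) c])
  have fin': "finsler_on (chart_img d) (loc A L' d)" and fin: "finsler_on (chart_img d) (loc A L d)"
    using L L' d by (simp_all add: finsler_finsler_on)
  then have sm': "smooth_on (slit (chart_img d)) (case_prod (loc A L' d))"
    and sm: "smooth_on (slit (chart_img d)) (case_prod (loc A L d))" by (simp_all add: finsler_on_def)
  have xs: "smooth_on ?J (\<lambda>s. coord_expr c d \<iota> (?u s))"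
    by (rule smooth_on_compose[OF J coord_expr_facts(1,3) us uJ])
  have x2: "coord_expr c d \<iota> (?u s) \<in> chart_img d \<and> velocity (\<lambda>s. coord_expr c d \<iota> (?u s)) s \<noteq> 0" if s: "s \<in> ?J" for s
    using velocity_compose[OF coord_expr_facts(1,3) J us uJ s] u2[OF s] coord_expr_facts(4,5) by simp
  have acc: "acceleration (\<lambda>s. coord_expr c d \<iota> (?u s)) s = 0" if s: "s \<in> ?J" for s
    using acceleration_compose[OF coord_expr_facts(1,3) J us uJ s] flat[OF uc[OF s]]
      linear_0[OF linear_fderiv[OF smooth_on_differentiable[OF coord_expr_facts(3) uc[OF s]]]]
    by (simp add: vu)
  have regd: "regular_at d (\<iota> \<circ> ?\<eta>) ?J"
    using xs x2 J cd chart_point_mem[OF chc uc]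
    by (auto simp: regular_at_def coord_expr_def o_def)
  have "local_geodesic A L' d (\<iota> \<circ> ?\<eta>) t" if t: "t \<in> ?J" for t
  proof -
    have "euler_lagrange (loc A L' d) (\<lambda>s. coord_expr c d \<iota> (?u s)) t"
      using euler_lagrange_iff[OF coord_expr_facts(2) sm' J xs x2 t] minkowski_straight[OF coord_expr_facts(2) sm' mink] x2[OF t] acc[OF t]
      by auto
    then have "euler_lagrange (loc A L' d) (coord d \<circ> (\<iota> \<circ> ?\<eta>)) t" by (simp add: coord_expr_def o_def)
    then show ?thesis unfolding local_geodesic_def using regd t by blast
  qed
  then have "geodesic A L' ?J (\<iota> \<circ> ?\<eta>)"
    unfolding geodesic_iff_local[OF man(2) L'] using d e by (intro conjI ballI bexI[of _ d]) (auto simp: is_interval_oo)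
  then have geo: "geodesic A L ?J (\<iota> \<circ> ?\<eta>)" by (rule proj)
  have "(\<iota> \<circ> ?\<eta>) 0 \<in> chart_dom d" using regd 0 unfolding regular_at_def by blast
  from geodesic_local[OF man(2) geo 0 d this]
  have "euler_lagrange (loc A L d) (coord d \<circ> (\<iota> \<circ> ?\<eta>)) 0" unfolding local_geodesic_def by blast
  then have "euler_lagrange (loc A L d) (\<lambda>s. coord_expr c d \<iota> (?u s)) 0" by (simp add: coord_expr_def o_def)
  from euler_lagrange_pullback[OF immersion_on_coord_expr sm pulls_back_total J us u2 0 this]
  have "euler_lagrange (loc B (induced B A \<iota> L) c) ?u 0" .
  moreover have "velocity (\<lambda>s::real. v) 0 = 0" by simp
  ultimately show ?thesis
    using euler_lagrange_iff[OF coord_expr_facts(1) pullback_smooth[OF immersion_on_coord_expr sm pulls_back_total] J us u2 0] by (simp add: vu)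
qed

text \<open>The right-hand side does not mention the metric: all induced metrics for which straight lines are
geodesics have the same geodesics.\<close>

lemma local_geodesic_straight_iff:
  assumes L: "finsler A L"
    and straight: "\<And>z v w. z \<in> chart_img c \<Longrightarrow> v \<noteq> 0 \<Longrightarrow> euler (loc B (induced B A \<iota> L) c) z v 0 w = 0"
  shows "local_geodesic B (induced B A \<iota> L) c \<gamma> t \<longleftrightarrow>
    (\<exists>J. t \<in> J \<and> regular_at c \<gamma> J) \<and> (\<exists>r. acceleration (coord c \<circ> \<gamma>) t = r *\<^sub>R velocity (coord c \<circ> \<gamma>) t)"
proof (cases "\<exists>J. t \<in> J \<and> regular_at c \<gamma> J")
  case True
  then obtain J where t: "t \<in> J" and J: "open J" "\<gamma> ` J \<subseteq> chart_dom c" "smooth_on J (coord c \<circ> \<gamma>)"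
    "\<And>s. s \<in> J \<Longrightarrow> velocity (coord c \<circ> \<gamma>) s \<noteq> 0" by (auto simp: regular_at_def)
  let ?x = "coord c \<circ> \<gamma>"
  have fin: "finsler_on (chart_img c) (loc B (induced B A \<iota> L) c)"
    using finsler_induced[OF man h L] c by (simp add: finsler_finsler_on)
  then have sm: "smooth_on (slit (chart_img c)) (case_prod (loc B (induced B A \<iota> L) c))" by (simp add: finsler_on_def)
  have x2: "?x s \<in> chart_img c \<and> velocity ?x s \<noteq> 0" if "s \<in> J" for s
    using J(2,4) that by (auto simp: chart_img_def)
  have "euler_lagrange (loc B (induced B A \<iota> L) c) ?x t \<longleftrightarrow>
      (\<forall>w. euler (loc B (induced B A \<iota> L) c) (?x t) (velocity ?x t) (acceleration ?x t) w = 0)"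
    by (rule euler_lagrange_iff[OF coord_expr_facts(1) sm J(1,3) x2 t])
  also have "\<dots> \<longleftrightarrow> (\<exists>r. acceleration ?x t = r *\<^sub>R velocity ?x t)"
    using x2[OF t] straight by (intro euler_straight_iff[OF coord_expr_facts(1) fin]) auto
  finally have "euler_lagrange (loc B (induced B A \<iota> L) c) ?x t \<longleftrightarrow> (\<exists>r. acceleration ?x t = r *\<^sub>R velocity ?x t)" .
  with True show ?thesis by (simp add: local_geodesic_def)
qed (auto simp: local_geodesic_def)

end

theorem theorem5p3:
  fixes A :: "('m::{t2_space,second_countable_topology}, 'n::finite) chart set"
    and B :: "('h::{t2_space,second_countable_topology}, 'k::finite) chart set"
    and L Ls \<beta> :: "('m, 'n) tfun"
    and \<sigma> :: "'m \<Rightarrow> real"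
    and \<iota> :: "'h \<Rightarrow> 'm"
  assumes "CARD('n) > 3"
    and "smooth_manifold A"
    and "finsler A L"
    and "projectively_flat A L"
    and "finsler A Ls"
    and "randers_conformal_change A \<sigma> \<beta> L Ls"
    and "projective_change A L Ls"
    and "smooth_manifold B"
    and "hypersurface B A \<iota>"
    and "totally_geodesic B A \<iota> L"
  shows "projectively_flat B (induced B A \<iota> Ls)"
proof -
  note man = assms(8,2) and h = assms(9)
  obtain L' where L': "projective_change A L L'" "locally_minkowski A L'"
    using assms(4) by (auto simp: projectively_flat_def)
  then have fL': "finsler A L'" by (simp add: locally_minkowski_def)
  note finB = finsler_induced[OF man h]
  have to_L': "\<And>I \<gamma>. geodesic A L I \<gamma> \<Longrightarrow> geodesic A L' I \<gamma>"
    and to_Ls: "\<And>I \<gamma>. geodesic A L' I \<gamma> \<Longrightarrow> geodesic A Ls I \<gamma>"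
    using L'(1) assms(7) by (auto simp: projective_change_def)
  \<comment> \<open>Around every point there is one chart that is Minkowskian for the metric induced by \<open>L'\<close> and in which the
    metrics induced by \<open>Ls\<close> and by \<open>L'\<close> have the same local geodesics.\<close>
  have adapted: "\<exists>c\<in>B. p \<in> chart_dom c \<and>
      (\<forall>x\<in>chart_img c. \<forall>x'\<in>chart_img c. \<forall>y. y \<noteq> 0 \<longrightarrow> loc B (induced B A \<iota> L') c x y = loc B (induced B A \<iota> L') c x' y) \<and>
      (\<forall>\<gamma> t. local_geodesic B (induced B A \<iota> Ls) c \<gamma> t \<longleftrightarrow> local_geodesic B (induced B A \<iota> L') c \<gamma> t)" for p
  proof -
    obtain d where d: "d \<in> A" "\<iota> p \<in> chart_dom d"
      "\<And>x x' y. x \<in> chart_img d \<Longrightarrow> x' \<in> chart_img d \<Longrightarrow> y \<noteq> 0 \<Longrightarrow> loc A L' d x y = loc A L' d x' y"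
      using L'(2) unfolding locally_minkowski_def by meson
    obtain c P where c: "c \<in> B" "p \<in> chart_dom c" "\<iota> ` chart_dom c \<subseteq> chart_dom d" "convex (chart_img c)"
      and P: "linear P" "\<And>u. u \<in> chart_img c \<Longrightarrow> P (coord_expr c d \<iota> u) = u"
      by (rule graph_chart[OF man h d(1,2)]) (rule that, auto)
    note facts = man h c(1) d(1) c(3)
    let ?f = "coord_expr c d \<iota>"
    have flat: "fderiv (\<lambda>p. fderiv ?f p v) z w = 0" if "z \<in> chart_img c" for z v w
      by (rule second_derivative_zero[OF facts assms(3) fL' to_L' assms(10) d(3) P that])
    have const: "fderiv ?f x v = fderiv ?f x' v" if x: "x \<in> chart_img c" "x' \<in> chart_img c" for x x' v
    proof -
      have "((\<lambda>p. fderiv ?f p v) has_derivative (\<lambda>w. 0)) (at z within chart_img c)" if z: "z \<in> chart_img c" for z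
      proof (rule has_derivative_at_withinI)
        have "fderiv (\<lambda>p. fderiv ?f p v) z = (\<lambda>w. 0)" by (intro ext flat z)
        then show "((\<lambda>p. fderiv ?f p v) has_derivative (\<lambda>w. 0)) (at z)"
          using smooth_on_has_derivative[OF smooth_on_fderiv[OF coord_expr_facts(3)[OF facts], of v] z] by simp
      qed
      from has_derivative_zero_constant[OF c(4) this]
      obtain k where "\<forall>z\<in>chart_img c. fderiv ?f z v = k" by blast
      then show ?thesis using x by simp
    qed
    have mink: "loc B (induced B A \<iota> L') c x y = loc B (induced B A \<iota> L') c x' y"
      if "x \<in> chart_img c" "x' \<in> chart_img c" "y \<noteq> 0" for x x' y
      using that loc_induced_total[OF facts] const[OF that(1,2), of y] d(3) coord_expr_facts(4,5)[OF facts] by simp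
    have iff: "local_geodesic B (induced B A \<iota> F) c \<gamma> t \<longleftrightarrow>
        (\<exists>J. t \<in> J \<and> regular_at c \<gamma> J) \<and> (\<exists>r. acceleration (coord c \<circ> \<gamma>) t = r *\<^sub>R velocity (coord c \<circ> \<gamma>) t)"
      if F: "finsler A F" and proj: "\<And>I \<gamma>. geodesic A L' I \<gamma> \<Longrightarrow> geodesic A F I \<gamma>" for F \<gamma> t
      by (rule local_geodesic_straight_iff[OF facts F induced_straight[OF facts fL' F proj d(3) flat]])
    have "local_geodesic B (induced B A \<iota> Ls) c \<gamma> t \<longleftrightarrow> local_geodesic B (induced B A \<iota> L') c \<gamma> t" for \<gamma> t
      using iff[of Ls \<gamma> t] iff[of L' \<gamma> t] assms(5) fL' to_Ls by blast
    with c(1,2) mink show ?thesis by blast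
  qed
  have "geodesic B (induced B A \<iota> Ls) I \<gamma> \<longleftrightarrow> geodesic B (induced B A \<iota> L') I \<gamma>" for I \<gamma>
  proof -
    have "local_geodesic B (induced B A \<iota> F2) e \<gamma> t"
      if "local_geodesic B (induced B A \<iota> F1) e \<gamma> t" "e \<in> B" "F1 = Ls \<and> F2 = L' \<or> F1 = L' \<and> F2 = Ls" for F1 F2 e t
    proof -
      have F: "finsler B (induced B A \<iota> F1)" "finsler B (induced B A \<iota> F2)" using that(3) finB assms(5) fL' by auto
      obtain c where c: "c \<in> B" "\<gamma> t \<in> chart_dom c"
        "\<And>\<gamma> t. local_geodesic B (induced B A \<iota> Ls) c \<gamma> t \<longleftrightarrow> local_geodesic B (induced B A \<iota> L') c \<gamma> t"
        using adapted[of "\<gamma> t"] by blast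
      have "\<gamma> t \<in> chart_dom e" using that(1) by (auto simp: local_geodesic_def regular_at_def)
      moreover have "local_geodesic B (induced B A \<iota> F2) c \<gamma> t"
        using local_geodesic_change_chart[OF man(1) F(1) that(2) c(1) that(1) c(2)] c(3) that(3) by auto
      ultimately show ?thesis using local_geodesic_change_chart[OF man(1) F(2) c(1) that(2)] by blast
    qed
    then show ?thesis
      unfolding geodesic_iff_local[OF man(1) finB[OF assms(5)]] geodesic_iff_local[OF man(1) finB[OF fL']] by blast
  qed
  then have "projective_change B (induced B A \<iota> Ls) (induced B A \<iota> L')" by (simp add: projective_change_def)
  moreover have "locally_minkowski B (induced B A \<iota> L')"
    unfolding locally_minkowski_def using finB[OF fL'] adapted by blast
  ultimately show ?thesis
    unfolding projectively_flat_def using finB[OF assms(5)] by blast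
qed


end
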